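(* For $su(n)$, $n\ge2$, let $t^{(m)}$ be the symmetric invariant tensors $$t^{i_1\dots i_m}=[\Omega^{(2m-1)}]^{j_1\dots j_{2m-2}i_m}\,f^{i_1}{}_{j_1j_2}\cdots f^{i_{m-1}}{}_{j_{2m-3}j_{2m-2}}$$ built from the cocycles $\Omega^{(2m-1)}$. Then $$t_{i_1i_2}=n\,\delta_{i_1i_2},\qquad t_{i_1i_2i_3}=\frac{n^2}{3}k_{i_1i_2i_3}=\frac{i\,n^2}{12}\,d_{i_1i_2i_3},$$ $$t_{i_1i_2i_3i_4}=\frac1{120}\Big[n(n^2+1)\,d^{(4)}_{(i_1i_2i_3i_4)}-2(n^2-4)\,\delta_{(i_1i_2}\delta_{i_3i_4)}\Big],$$ and, for some scalar $\lambda(n)$, $$t_{i_1i_2i_3i_4i_5}=\lambda(n)\Big[n(n^2+5)\,d^{(5)}_{(i_1i_2i_3i_4i_5)}-2(3n^2-20)\,d_{(i_1i_2i_3}\delta_{i_4i_5)}\Big].$$ Moreover these expressions vanish identically when the order exceeds $n$: for $n=3$, $t_{i_1i_2i_3i_4}=0$ and $t_{i_1i_2i_3i_4i_5}=0$; for $n=4$, $t_{i_1i_2i_3i_4i_5}=0$.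
   Context: The $su(n)$ generators $T_i$, $i=1,\dots,n^2-1$, are the hermitian traceless $n\times n$ matrices with $\mathrm{Tr}(T_iT_j)=\frac12\delta_{ij}$, $[T_i,T_j]=i f_{ij}{}^kT_k$, $\{T_i,T_j\}=\frac1n\delta_{ij}+d_{ij}{}^kT_k$ ($d_{ijk}=0$ for $n=2$); $X_i=-iT_i$, so $[X_i,X_j]=f_{ij}{}^kX_k$. Indices are raised and lowered with $\delta_{ij}$; repeated indices are summed; round brackets denote unit-weight symmetrisation. The $d$-tensors are $d^{(3)}_{ijk}=d_{ijk}$ and $d^{(r+1)}_{i_1\dots i_{r+1}}=d^{(r)}_{i_1\dots i_{r-1}}{}^{j}d_{ji_ri_{r+1}}$ for $r\ge3$. Let $k_{i_1\dots i_m}=\mathrm{Tr}(X_{(i_1}\cdots X_{i_m)})$; in particular $k_{ijk}=\frac{i}{4}d_{ijk}$. With $\epsilon_{\alpha_1\dots\alpha_N}^{\beta_1\dots\beta_N}=\sum_{\sigma\in S_N}\mathrm{sgn}(\sigma)\,\delta_{\alpha_1}^{\beta_{\sigma(1)}}\cdots\delta_{\alpha_N}^{\beta_{\sigma(N)}}$, the cocycles are, for $m\ge3$, $$\Omega^{(2m-1)}_{i_1\dots i_{2m-2}\sigma}=\frac{1}{(2m-1)!}\,\epsilon^{j_1\dots j_{2m-2}\rho}_{i_1\dots i_{2m-2}\sigma}\,f_{j_1j_2}{}^{l_1}\cdots f_{j_{2m-3}j_{2m-2}}{}^{l_{m-1}}\,k_{l_1\dots l_{m-1}\rho},$$ while for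 $m=2$ the tensor $\delta_{ij}$ is used instead of $k_{ij}$, so that $\Omega^{(3)}_{ijk}=f_{ijk}$. *)

theory Defs
  imports "Jordan_Normal_Form.Schur_Decomposition" "HOL-Combinatorics.Permutations"
begin

(* Tensors of rank r on su(n) are functions of the list [i_1, ..., i_r] of their indices, each
   index ranging over 1, ..., n^2 - 1.  Since indices are raised and lowered with the Kronecker
   delta, no distinction is made between upper and lower ones. *)

definition su_idx :: "nat \<Rightarrow> nat set" where
  "su_idx n = {1..n\<^sup>2 - 1}"

definition multi_idx :: "nat \<Rightarrow> nat \<Rightarrow> nat list set" where
  "multi_idx n r = {js. set js \<subseteq> su_idx n \<and> length js = r}"

definition kdelta :: "nat \<Rightarrow> nat \<Rightarrow> complex" where
  "kdelta i j = (if i = j then 1 else 0)"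

definition mtrace :: "complex mat \<Rightarrow> complex" where
  "mtrace A = (\<Sum>a<dim_row A. A $$ (a, a))"

(* The linear combination c^k T_k; type mat has no additive monoid instance, hence entrywise. *)
definition lincomb_gen :: "nat \<Rightarrow> (nat \<Rightarrow> complex mat) \<Rightarrow> (nat \<Rightarrow> real) \<Rightarrow> complex mat" where
  "lincomb_gen n T c =
     mat n n (\<lambda>(a, b). \<Sum>k\<in>su_idx n. complex_of_real (c k) * T k $$ (a, b))"

(* T is an arbitrary choice of generators.  The T_k are linearly independent, so the last two
   equations determine f and d on the index range; in particular they force d = 0 for n = 2. *)
definition su_generators ::
  "nat \<Rightarrow> (nat \<Rightarrow> complex mat) \<Rightarrow> (nat \<Rightarrow> nat \<Rightarrow> nat \<Rightarrow> real) \<Rightarrow> (nat \<Rightarrow> nat \<Rightarrow> nat \<Rightarrow> real) \<Rightarrow> bool"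
  where
  "su_generators n T f d \<longleftrightarrow>
     (\<forall>i\<in>su_idx n. T i \<in> carrier_mat n n \<and> mat_adjoint (T i) = T i \<and> mtrace (T i) = 0) \<and>
     (\<forall>i\<in>su_idx n. \<forall>j\<in>su_idx n.
        mtrace (T i * T j) = 1 / 2 * kdelta i j \<and>
        T i * T j - T j * T i = \<i> \<cdot>\<^sub>m lincomb_gen n T (f i j) \<and>
        T i * T j + T j * T i =
          (1 / of_nat n * kdelta i j) \<cdot>\<^sub>m 1\<^sub>m n + lincomb_gen n T (d i j))"

(* Unit-weight symmetrisation over all indices of a tensor. *)
definition symmetrise :: "(nat list \<Rightarrow> complex) \<Rightarrow> nat list \<Rightarrow> complex" where
  "symmetrise F is =
     (\<Sum>p | p permutes {..<length is}. F (permute_list p is)) / fact (length is)"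

(* d^(r) with r the length of the index list; only used for r >= 3. *)
function d_tensor :: "nat \<Rightarrow> (nat \<Rightarrow> nat \<Rightarrow> nat \<Rightarrow> real) \<Rightarrow> nat list \<Rightarrow> real" where
  "d_tensor n d is =
     (if length is \<le> 3 then d (is ! 0) (is ! 1) (is ! 2)
      else (\<Sum>j\<in>su_idx n. d_tensor n d (take (length is - 2) is @ [j]) *
              d j (is ! (length is - 2)) (is ! (length is - 1))))"
  by auto
termination
  by (relation "measure (\<lambda>(n, d, is). length is)") auto

declare d_tensor.simps [simp del]

definition X_gen :: "(nat \<Rightarrow> complex mat) \<Rightarrow> nat \<Rightarrow> complex mat" where
  "X_gen T i = (- \<i>) \<cdot>\<^sub>m T i"

definition k_tensor :: "nat \<Rightarrow> (nat \<Rightarrow> complex mat) \<Rightarrow> nat list \<Rightarrow> complex" where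
  "k_tensor n T = symmetrise (\<lambda>is. mtrace (foldr (\<lambda>i A. X_gen T i * A) is (1\<^sub>m n)))"

(* The symmetric tensor entering the cocycle: the Kronecker delta replaces k_ij in rank 2. *)
definition cocycle_seed :: "nat \<Rightarrow> (nat \<Rightarrow> complex mat) \<Rightarrow> nat list \<Rightarrow> complex" where
  "cocycle_seed n T is =
     (if length is = 2 then kdelta (is ! 0) (is ! 1) else k_tensor n T is)"

(* The symbol epsilon with upper indices js and lower indices is. *)
definition gen_delta :: "nat list \<Rightarrow> nat list \<Rightarrow> complex" where
  "gen_delta js is =
     (\<Sum>p | p permutes {..<length is}.
        of_int (sign p) * (\<Prod>a<length is. kdelta (is ! a) (js ! p a)))"

(* Omega^(2m-1); list positions start at 0, so j_(2a+1), j_(2a+2) are js ! (2*a), js ! (2*a+1)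
   and rho is js ! (2*m-2). *)
definition cocycle ::
  "nat \<Rightarrow> (nat \<Rightarrow> complex mat) \<Rightarrow> (nat \<Rightarrow> nat \<Rightarrow> nat \<Rightarrow> real) \<Rightarrow> nat \<Rightarrow> nat list \<Rightarrow> complex" where
  "cocycle n T f m is =
     1 / fact (2 * m - 1) *
     (\<Sum>js\<in>multi_idx n (2 * m - 1). \<Sum>ls\<in>multi_idx n (m - 1).
        gen_delta js is *
        (\<Prod>a<m - 1. complex_of_real (f (js ! (2 * a)) (js ! (2 * a + 1)) (ls ! a))) *
        cocycle_seed n T (ls @ [js ! (2 * m - 2)]))"

definition t_tensor ::
  "nat \<Rightarrow> (nat \<Rightarrow> complex mat) \<Rightarrow> (nat \<Rightarrow> nat \<Rightarrow> nat \<Rightarrow> real) \<Rightarrow> nat \<Rightarrow> nat list \<Rightarrow> complex" where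
  "t_tensor n T f m is =
     (\<Sum>js\<in>multi_idx n (2 * m - 2).
        cocycle n T f m (js @ [is ! (m - 1)]) *
        (\<Prod>a<m - 1. complex_of_real (f (is ! a) (js ! (2 * a)) (js ! (2 * a + 1)))))"

definition d_sym :: "nat \<Rightarrow> (nat \<Rightarrow> nat \<Rightarrow> nat \<Rightarrow> real) \<Rightarrow> nat list \<Rightarrow> complex" where
  "d_sym n d = symmetrise (\<lambda>is. complex_of_real (d_tensor n d is))"

definition delta_delta_sym :: "nat list \<Rightarrow> complex" where
  "delta_delta_sym = symmetrise (\<lambda>is. kdelta (is ! 0) (is ! 1) * kdelta (is ! 2) (is ! 3))"

definition d_delta_sym :: "(nat \<Rightarrow> nat \<Rightarrow> nat \<Rightarrow> real) \<Rightarrow> nat list \<Rightarrow> complex" where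
  "d_delta_sym d =
     symmetrise (\<lambda>is. complex_of_real (d (is ! 0) (is ! 1) (is ! 2)) * kdelta (is ! 3) (is ! 4))"

end

(* Since f_{j j'}^l X_l = [X_j, X_j'], antisymmetrising turns the cocycle Omega^(2m-1) into a multiple of
   the antisymmetrised trace Tr (X_{[i_1} ... X_{i_{2m-1}]}).  The tensor t is symmetric in its first m - 1
   indices, so by polarisation it suffices to contract these with x^i; the remaining sum over
   permutations is a Wick expansion with the antisymmetric pairing x^i f_{ijk}.  Every single pairing is
   evaluated with the Fierz identity: it either splits one trace into two or merges two traces into one,
   and the 1/n terms cancel.  For m <= 5 the resulting finite sums are polynomials in n and in the traces
   of powers of Y = x^i X_i, and they are compared with the traces obtained from the d-tensors through
   the anticommutators.  The vanishing for m > n is Newton's identity for the power sums of at most four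
   eigenvalues with sum zero. *)
theory Submission
  imports Defs
begin

text \<open>The definition makes t symmetric in its first m - 1 indices only, so the last index z is
  never contracted with x: it survives as the letter \<open>Z\<close> and in the traces Tr (Y^k
  X_z), and the comparison with the d-tensors is made for each z separately. The brackets on the
  right are fully symmetric, so their vanishing can be settled with x in every slot, where only
  power sums remain.

  A direct expansion for m = 5 would run over the 8! permutations of the contracted indices. The
  symmetries of a product of four pairings reduce it to 7 * 5 * 3 = 105 pairings; each of the four
  Fierz contractions has two terms, so 1680 products of traces are left, few enough for evaluation
  inside the logic.

  With k = m - 1 the commutators, the symmetries of the pairings and the antisymmetriser combine to
  the prefactor 2^k k! / (2k)! = 1 / (2k - 1)!!, that is 1/3, 1/15 and 1/105 for m = 3, 4, 5. For m
  = 2 there is a further factor -2, from delta_ij = -2 Tr (X_i X_j). The contracted right-hand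
  brackets carry factors 8 and 16 i, whence 1/120 and lambda(n) = -i n / 1680.\<close>

unbundle no m_inv_syntax


section \<open>Sums over permutations, split into cosets of a point stabiliser\<close>

text \<open>The cosets of the stabiliser of \<open>a\<close> are told apart by the preimage b of
  \<open>a\<close>. The representative \<open>c b\<close> is left free: below it is a power of a
  cycle, an insertion cycle, or a symmetry of a product of pairings.\<close>

lemma sum_permutes_coset_right:
  fixes g :: "('a \<Rightarrow> 'a) \<Rightarrow> 'b::comm_monoid_add"
  assumes a: "a \<in> S" and c: "\<And>b. b \<in> S \<Longrightarrow> c b permutes S \<and> c b b = a"
  shows "(\<Sum>p | p permutes S. g p) = (\<Sum>b\<in>S. \<Sum>p | p permutes (S - {a}). g (p \<circ> c b))"
proof (cases "finite S")
  case True
  have sub: "p permutes S" if "p permutes (S - {a})" for p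
    using that by (rule permutes_subset) auto
  have fixa: "p a = a" if "p permutes (S - {a})" for p
    using that by (simp add: permutes_def)
  have "(\<Sum>b\<in>S. \<Sum>p | p permutes (S - {a}). g (p \<circ> c b)) =
      (\<Sum>(b, p)\<in>S \<times> {p. p permutes (S - {a})}. g (p \<circ> c b))"
    using True by (simp add: sum.cartesian_product)
  also have "\<dots> = (\<Sum>p | p permutes S. g p)"
  proof (rule sum.reindex_bij_witness[of _ "\<lambda>p. (inv p a, p \<circ> inv (c (inv p a)))" "\<lambda>(b, p). p \<circ> c b"], goal_cases)
    case (1 x)
    obtain b p where x: "x = (b, p)" by (cases x)
    from 1 x have b: "b \<in> S" and p: "p permutes (S - {a})" by auto
    have pc: "p \<circ> c b permutes S" using permutes_compose[of "c b" S p] c[OF b] sub[OF p] by auto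
    have "(p \<circ> c b) b = a" using c[OF b] fixa[OF p] by simp
    then have i: "inv (p \<circ> c b) a = b" using permutes_inv_eq[OF pc] by auto
    have "p \<circ> c b \<circ> inv (c b) = p" using permutes_inv_o(1)[of "c b" S] c[OF b] by (simp add: o_assoc[symmetric])
    with i x show ?case by simp
  next
    case (2 x)
    obtain b p where x: "x = (b, p)" by (cases x)
    from 2 x have b: "b \<in> S" and p: "p permutes (S - {a})" by auto
    show ?case using permutes_compose[of "c b" S p] c[OF b] sub[OF p] x by auto
  next
    case (3 p)
    then have p: "p permutes S" by simp
    have b: "inv p a \<in> S" using permutes_in_image[OF permutes_inv[OF p]] a by simp
    have "inv (c (inv p a)) \<circ> c (inv p a) = id" using permutes_inv_o(2)[of "c (inv p a)" S] c[OF b] by auto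
    then show ?case by (simp add: o_assoc[symmetric])
  next
    case (4 p)
    then have p: "p permutes S" by simp
    have b: "inv p a \<in> S" using permutes_in_image[OF permutes_inv[OF p]] a by simp
    let ?q = "p \<circ> inv (c (inv p a))"
    have q: "?q permutes S" using permutes_compose[of "inv (c (inv p a))" S p] permutes_inv c[OF b] p by auto
    have "inv (c (inv p a)) a = inv p a" using permutes_inv_eq[of "c (inv p a)" S] c[OF b] by auto
    then have "?q a = a" using permutes_inverses(1)[OF p] by simp
    then have "?q permutes (S - {a})" using q by (intro permutes_superset[OF q]) auto
    then show ?case using b by simp
  next
    case (5 x)
    then show ?case by (auto simp: case_prod_unfold)
  qed
  finally show ?thesis by simp
next
  case False
  \<comment> \<open>Transpositions alone give infinitely many permutations, so both sides are sums
    over infinite sets and take the default value 0.\<close>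
  have "infinite {p. p permutes S}"
  proof
    assume fin: "finite {p. p permutes S}"
    have "(\<lambda>b. transpose a b) ` S \<subseteq> {p. p permutes S}" using a by (auto intro: permutes_swap_id)
    moreover have "inj_on (\<lambda>b. transpose a b) S" by (rule inj_onI) (metis transpose_apply_first)
    ultimately show False using False fin by (meson finite_imageD finite_subset)
  qed
  then show ?thesis using False by simp
qed

text \<open>Inversion exchanges the two kinds of cosets; here they are told apart by the image of
  \<open>a\<close>.\<close>

lemma sum_permutes_coset_left:
  fixes g :: "('a \<Rightarrow> 'a) \<Rightarrow> 'b::comm_monoid_add"
  assumes a: "a \<in> S" and c: "\<And>b. b \<in> S \<Longrightarrow> c b permutes S \<and> c b a = b"
  shows "(\<Sum>p | p permutes S. g p) = (\<Sum>b\<in>S. \<Sum>p | p permutes (S - {a}). g (c b \<circ> p))"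
proof -
  have "(\<Sum>p | p permutes S. g p) = (\<Sum>p | p permutes S. g (inv p))"
    by (rule sum_permutations_inverse)
  also have "\<dots> = (\<Sum>b\<in>S. \<Sum>p | p permutes (S - {a}). g (inv (p \<circ> inv (c b))))"
  proof (rule sum_permutes_coset_right[OF a])
    fix b assume b: "b \<in> S"
    show "inv (c b) permutes S \<and> inv (c b) b = a"
      using c[OF b] permutes_inv[of "c b" S] permutes_inv_eq[of "c b" S b a] by auto
  qed
  also have "\<dots> = (\<Sum>b\<in>S. \<Sum>p | p permutes (S - {a}). g (c b \<circ> inv p))"
  proof (intro sum.cong refl)
    fix b p assume b: "b \<in> S" and "p \<in> {p. p permutes (S - {a})}"
    then have p: "p permutes S" by (auto intro: permutes_subset)
    have cb: "c b permutes S" using c[OF b] by simp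
    have "inv (p \<circ> inv (c b)) = inv (inv (c b)) \<circ> inv p"
      by (rule o_inv_distrib) (use p permutes_inv[OF cb] permutes_bij in auto)
    then show "g (inv (p \<circ> inv (c b))) = g (c b \<circ> inv p)"
      using permutes_inv_inv[OF cb] by simp
  qed
  also have "\<dots> = (\<Sum>b\<in>S. \<Sum>p | p permutes (S - {a}). g (c b \<circ> p))"
    by (intro sum.cong refl sum_permutations_inverse[symmetric])
  finally show ?thesis .
qed

lemma sign_permutes_compose:
  assumes "finite S" "p permutes S" "q permutes S"
  shows "sign (p \<circ> q) = sign p * sign q"
  using assms by (intro sign_compose) (auto intro: permutes_imp_permutation)

section \<open>Sums over multi-indices\<close>

lemma finite_su_idx [simp]: "finite (su_idx n)"
  by (simp add: su_idx_def)

lemma finite_multi_idx [simp]: "finite (multi_idx n r)"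
  unfolding multi_idx_def by (rule finite_lists_length_eq) simp

lemma length_multi_idx: "js \<in> multi_idx n r \<Longrightarrow> length js = r"
  by (simp add: multi_idx_def)

lemma multi_idx_0 [simp]: "multi_idx n 0 = {[]}"
  by (auto simp: multi_idx_def)

lemma nth_multi_idx: "js \<in> multi_idx n r \<Longrightarrow> a < r \<Longrightarrow> js ! a \<in> su_idx n"
  unfolding multi_idx_def using nth_mem by blast

lemma permute_list_in_multi_idx:
  "p permutes {..<r} \<Longrightarrow> js \<in> multi_idx n r \<Longrightarrow> permute_list p js \<in> multi_idx n r"
  by (auto simp: multi_idx_def)

lemma permute_list_inv:
  assumes "p permutes {..<length xs}"
  shows "permute_list (inv p) (permute_list p xs) = xs"
    and "permute_list p (permute_list (inv p) xs) = xs"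
  using permute_list_compose[of "inv p" xs p] permute_list_compose[of p xs "inv p"]
    permutes_inv[OF assms] permutes_inv_o[OF assms] assms by simp_all

lemma sum_multi_idx_permute:
  assumes p: "p permutes {..<r}"
  shows "(\<Sum>js\<in>multi_idx n r. h (permute_list p js)) = (\<Sum>js\<in>multi_idx n r. h js)"
  by (rule sum.reindex_bij_witness[of _ "permute_list (inv p)" "permute_list p"])
    (use p permutes_inv[OF p] in \<open>auto simp: permute_list_inv length_multi_idx permute_list_in_multi_idx\<close>)

lemma sum_multi_idx_Suc:
  fixes h :: "nat list \<Rightarrow> 'a::comm_monoid_add"
  shows "(\<Sum>js\<in>multi_idx n (Suc r). h js) = (\<Sum>j\<in>su_idx n. \<Sum>js\<in>multi_idx n r. h (j # js))"
proof -
  have "(\<Sum>js\<in>multi_idx n (Suc r). h js) = (\<Sum>(j, js)\<in>su_idx n \<times> multi_idx n r. h (j # js))"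
    by (rule sum.reindex_bij_witness[of _ "\<lambda>(j, js). j # js" "\<lambda>js. (hd js, tl js)"])
      (auto simp: multi_idx_def length_Suc_conv)
  then show ?thesis by (simp add: sum.cartesian_product)
qed

lemma sum_multi_idx_snoc:
  fixes h :: "nat list \<Rightarrow> 'a::comm_monoid_add"
  shows "(\<Sum>js\<in>multi_idx n (Suc r). h js) = (\<Sum>js\<in>multi_idx n r. \<Sum>j\<in>su_idx n. h (js @ [j]))"
proof -
  have "(\<Sum>js\<in>multi_idx n (Suc r). h js) = (\<Sum>(js, j)\<in>multi_idx n r \<times> su_idx n. h (js @ [j]))"
    by (rule sum.reindex_bij_witness[of _ "\<lambda>(js, j). js @ [j]" "\<lambda>js. (butlast js, last js)"])
      (auto simp: multi_idx_def length_Suc_conv_rev)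
  then show ?thesis by (simp add: sum.cartesian_product)
qed

lemma permute_list_append_fixed:
  assumes "p permutes {..<length xs}"
  shows "permute_list p (xs @ ys) = permute_list p xs @ ys"
proof (rule nth_equalityI)
  fix i assume "i < length (permute_list p (xs @ ys))"
  then have i: "i < length xs + length ys" by simp
  have p': "p permutes {..<length (xs @ ys)}" using assms by (rule permutes_subset) auto
  show "permute_list p (xs @ ys) ! i = (permute_list p xs @ ys) ! i"
  proof (cases "i < length xs")
    case True
    then have "p i < length xs" using permutes_in_image[OF assms, of i] by simp
    then show ?thesis using i True by (simp add: permute_list_nth[OF p'] permute_list_nth[OF assms] nth_append)
  next
    case False
    then have "p i = i" using assms by (simp add: permutes_def)
    then show ?thesis using i False by (simp add: permute_list_nth[OF p'] nth_append)
  qed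
qed simp

section \<open>Cycles and block permutations\<close>

text \<open>\<open>move_last N q\<close> carries the last entry of a list of length \<open>N + 1\<close> to position \<open>q\<close>.\<close>

definition move_last :: "nat \<Rightarrow> nat \<Rightarrow> nat \<Rightarrow> nat" where
  "move_last N q i = (if i = q then N else if q < i \<and> i \<le> N then i - 1 else i)"

lemma move_last_same: "move_last N N = id"
  by (auto simp: move_last_def fun_eq_iff)

lemma move_last_step:
  "q < N \<Longrightarrow> move_last N q = move_last N (Suc q) \<circ> transpose q (Suc q)"
  by (auto simp: move_last_def fun_eq_iff transpose_def)

text \<open>The cycle is a product of N - q adjacent transpositions, each of which contributes a
  sign.\<close>

lemma move_last_permutes_sign:
  "q \<le> N \<Longrightarrow> move_last N q permutes {..<Suc N} \<and> sign (move_last N q) = (-1) ^ (N - q)"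
proof (induction rule: inc_induct)
  case base
  show ?case by (simp only: move_last_same permutes_id sign_id) simp
next
  case (step q)
  have t: "transpose q (Suc q) permutes {..<Suc N}" using step by (intro permutes_swap_id) auto
  have e: "N - q = Suc (N - Suc q)" using step by simp
  have "sign (move_last N q) = sign (move_last N (Suc q)) * sign (transpose q (Suc q))"
    unfolding move_last_step[OF step(2)]
    using step t by (intro sign_permutes_compose[of "{..<Suc N}"]) auto
  also have "\<dots> = (-1) ^ (N - q)" using step by (subst e) (simp add: sign_swap_id)
  finally have "sign (move_last N q) = (-1) ^ (N - q)" .
  moreover have "move_last N q permutes {..<Suc N}"
    unfolding move_last_step[OF step(2)] using step by (intro permutes_compose[OF t]) simp
  ultimately show ?case by blast
qed

lemmas move_last_permutes = move_last_permutes_sign[THEN conjunct1]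
lemmas sign_move_last = move_last_permutes_sign[THEN conjunct2]

lemma permute_list_move_last:
  assumes "q \<le> length xs"
  shows "permute_list (move_last (length xs) q) (xs @ [z]) = take q xs @ z # drop q xs"
proof (rule nth_equalityI)
  fix i assume "i < length (permute_list (move_last (length xs) q) (xs @ [z]))"
  then have i: "i < Suc (length xs)" by simp
  have p: "move_last (length xs) q permutes {..<length (xs @ [z])}"
    using move_last_permutes[OF assms] by simp
  show "permute_list (move_last (length xs) q) (xs @ [z]) ! i = (take q xs @ z # drop q xs) ! i"
    using i assms
    by (subst permute_list_nth[OF p]) (auto simp: move_last_def nth_append nth_Cons min_def split: nat.split intro!: arg_cong[of _ _ "(!) xs"])
qed (use assms in simp)

lemma permute_list_comp_move_last:
  assumes "p permutes {..<length xs}" "q \<le> length xs"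
  shows "permute_list (p \<circ> move_last (length xs) q) (xs @ [z]) =
    take q (permute_list p xs) @ z # drop q (permute_list p xs)"
proof -
  have "permute_list (p \<circ> move_last (length xs) q) (xs @ [z]) =
      permute_list (move_last (length xs) q) (permute_list p (xs @ [z]))"
    by (rule permute_list_compose) (use move_last_permutes[OF assms(2)] in simp)
  then show ?thesis
    using permute_list_move_last[of q "permute_list p xs"] assms
    by (simp add: permute_list_append_fixed)
qed

text \<open>Coset sum for the point N: since \<open>move_last N q\<close> carries q to N, the
  summation index q is the place at which the last list entry is inserted.\<close>

lemma sum_permutes_insert_last:
  fixes g :: "(nat \<Rightarrow> nat) \<Rightarrow> 'b::comm_monoid_add"
  shows "(\<Sum>p | p permutes {..<Suc N}. g p) =
    (\<Sum>q\<le>N. \<Sum>p | p permutes {..<N}. g (p \<circ> move_last N q))"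
proof -
  have "{..<Suc N} - {N} = {..<N}" by auto
  then show ?thesis
    using sum_permutes_coset_right[of N "{..<Suc N}" "move_last N" g] move_last_permutes[of _ N]
    by (simp add: move_last_def lessThan_Suc_atMost)
qed

definition double_perm :: "(nat \<Rightarrow> nat) \<Rightarrow> nat \<Rightarrow> nat" where
  "double_perm q i = 2 * q (i div 2) + i mod 2"

lemma double_perm_comp: "double_perm (p \<circ> q) = double_perm p \<circ> double_perm q"
  by (auto simp: double_perm_def fun_eq_iff)

lemma double_perm_id: "double_perm id = id"
  by (auto simp: double_perm_def fun_eq_iff)

lemma double_perm_transpose:
  "double_perm (transpose a b) = transpose (2 * a) (2 * b) \<circ> transpose (2 * a + 1) (2 * b + 1)"
proof
  fix i
  consider "i = 2 * a" | "i = 2 * a + 1" | "i = 2 * b" | "i = 2 * b + 1" | "i div 2 \<noteq> a" "i div 2 \<noteq> b"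
    by linarith
  then show "double_perm (transpose a b) i = (transpose (2 * a) (2 * b) \<circ> transpose (2 * a + 1) (2 * b + 1)) i"
    by cases (auto simp: double_perm_def transpose_def; presburger)+
qed

text \<open>Exchanging two blocks of length two is a product of two transpositions, so every
  permutation of whole pairs is even. This is why the symmetry among the factors f survives
  antisymmetrisation.\<close>

lemma double_perm_permutes_sign:
  assumes "q permutes {..<k}"
  shows "double_perm q permutes {..<2 * k} \<and> sign (double_perm q) = 1"
  using assms finite_lessThan
proof (induction rule: permutes_induct)
  case id
  show ?case by (simp only: double_perm_id permutes_id sign_id simp_thms)
next
  case (swap a b p)
  have t: "transpose (2 * a) (2 * b) permutes {..<2 * k}"
      "transpose (2 * a + 1) (2 * b + 1) permutes {..<2 * k}"
    using swap by (auto intro!: permutes_swap_id)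
  then have d: "double_perm (transpose a b) permutes {..<2 * k}"
    unfolding double_perm_transpose by (metis permutes_compose)
  have "sign (double_perm (transpose a b)) = 1"
    unfolding double_perm_transpose
    by (subst sign_permutes_compose[OF _ t]) (use swap in \<open>auto simp: sign_swap_id\<close>)
  then have "sign (double_perm (transpose a b) \<circ> double_perm p) = 1"
    using swap sign_permutes_compose[OF _ d, of "double_perm p"] by simp
  then show ?case
    using permutes_compose[OF _ d, of "double_perm p"] swap unfolding double_perm_comp by blast
qed

lemmas double_perm_permutes = double_perm_permutes_sign[THEN conjunct1]
lemmas sign_double_perm = double_perm_permutes_sign[THEN conjunct2]


section \<open>Antisymmetrised sums\<close>

definition alt_sum :: "(nat list \<Rightarrow> complex) \<Rightarrow> nat list \<Rightarrow> complex" where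
  "alt_sum G is = (\<Sum>p | p permutes {..<length is}. of_int (sign p) * G (permute_list p is))"

lemma alt_sum_cong:
  "(\<And>js. mset js = mset is \<Longrightarrow> G js = H js) \<Longrightarrow> alt_sum G is = alt_sum H is"
  by (auto simp: alt_sum_def intro!: sum.cong)

text \<open>Translating the summation variable on the right permutes the slots of \<open>G\<close>;
  the translation on the left in \<open>alt_sum_permute_list\<close> permutes the indices
  themselves.\<close>

lemma alt_sum_permuted_arg:
  assumes r: "r permutes {..<length is}"
  shows "alt_sum (\<lambda>js. G (permute_list r js)) is = of_int (sign r) * alt_sum G is"
proof -
  have "alt_sum G is =
      (\<Sum>p | p permutes {..<length is}. of_int (sign (p \<circ> r)) * G (permute_list (p \<circ> r) is))"
    unfolding alt_sum_def by (rule sum_permutations_compose_right[OF r])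
  also have "\<dots> = of_int (sign r) * alt_sum (\<lambda>js. G (permute_list r js)) is"
    using r by (auto simp: alt_sum_def sum_distrib_left permute_list_compose
        sign_permutes_compose[OF finite_lessThan] intro!: sum.cong)
  finally show ?thesis by (simp add: mult.assoc[symmetric] flip: of_int_mult)
qed

lemma alt_sum_permute_list:
  assumes r: "r permutes {..<length is}"
  shows "alt_sum G (permute_list r is) = of_int (sign r) * alt_sum G is"
proof -
  have "alt_sum G is =
      (\<Sum>p | p permutes {..<length is}. of_int (sign (r \<circ> p)) * G (permute_list (r \<circ> p) is))"
    unfolding alt_sum_def by (rule setum_permutations_compose_left[OF r])
  also have "\<dots> = of_int (sign r) * alt_sum G (permute_list r is)"
    using r by (auto simp: alt_sum_def sum_distrib_left permute_list_compose
        sign_permutes_compose[OF finite_lessThan] intro!: sum.cong)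
  finally show ?thesis by (simp add: mult.assoc[symmetric] flip: of_int_mult)
qed

section \<open>Cyclic rotation inside sums over permutations\<close>

lemma funpow_permutes: "p permutes S \<Longrightarrow> p ^^ i permutes S"
  by (induction i) (auto simp: permutes_id[unfolded id_def] intro: permutes_compose)

lemma funpow_move_last: "i \<le> b \<Longrightarrow> b \<le> N \<Longrightarrow> (move_last N 0 ^^ i) b = b - i"
  by (induction i) (auto simp: move_last_def)

text \<open>The powers of the cycle of length N + 1 represent all cosets of the stabiliser of N and
  do not change \<open>g\<close>, so every coset contributes the same amount.\<close>

lemma sum_permutes_rotate:
  fixes g :: "(nat \<Rightarrow> nat) \<Rightarrow> 'b::comm_semiring_1"
  assumes g: "\<And>p. p permutes {..<Suc N} \<Longrightarrow> g (p \<circ> move_last N 0) = g p"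
  shows "(\<Sum>p | p permutes {..<Suc N}. g p) = of_nat (Suc N) * (\<Sum>p | p permutes {..<N}. g p)"
proof -
  let ?r = "move_last N 0"
  have r: "?r ^^ i permutes {..<Suc N}" for i
    by (rule funpow_permutes) (rule move_last_permutes, simp)
  have gi: "g (p \<circ> ?r ^^ i) = g p" if "p permutes {..<Suc N}" for p i
  proof (induction i)
    case (Suc i)
    have "g (p \<circ> ?r ^^ Suc i) = g ((p \<circ> ?r ^^ i) \<circ> ?r)"
      by (simp only: funpow_Suc_right o_assoc)
    also have "\<dots> = g (p \<circ> ?r ^^ i)" by (rule g) (rule permutes_compose[OF r that])
    also have "\<dots> = g p" by (rule Suc)
    finally show ?case .
  qed simp
  have S: "{..<Suc N} - {N} = {..<N}" by auto
  have "(\<Sum>p | p permutes {..<Suc N}. g p) =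
      (\<Sum>b<Suc N. \<Sum>p | p permutes ({..<Suc N} - {N}). g (p \<circ> ?r ^^ Suc b))"
  proof (rule sum_permutes_coset_right)
    fix b assume b: "b \<in> {..<Suc N}"
    \<comment> \<open>The cycle lowers positions by one: b steps bring b down to 0, and one more
      step carries 0 to N.\<close>
    have "(?r ^^ Suc b) b = ?r ((?r ^^ b) b)" by simp
    also have "\<dots> = N" using funpow_move_last[of b b N] b by (simp add: move_last_def)
    finally show "?r ^^ Suc b permutes {..<Suc N} \<and> (?r ^^ Suc b) b = N" using r by blast
  qed simp
  also have "\<dots> = (\<Sum>b<Suc N. \<Sum>p | p permutes {..<N}. g p)"
    unfolding S
  proof (intro sum.cong refl)
    fix b p assume "p \<in> {p. p permutes {..<N}}"
    then have "p permutes {..<Suc N}" by (auto intro: permutes_subset)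
    then show "g (p \<circ> ?r ^^ Suc b) = g p" by (rule gi)
  qed
  finally show ?thesis by simp
qed

lemma permute_list_rotate:
  assumes "p permutes {..<Suc N}" "length xs = Suc N"
  shows "permute_list (p \<circ> move_last N 0) xs = last (permute_list p xs) # butlast (permute_list p xs)"
proof -
  let ?ys = "permute_list p xs"
  have "?ys \<noteq> []" using assms by (metis length_permute_list list.size(3) nat.simps(3))
  then have ys: "?ys = butlast ?ys @ [last ?ys]" by simp
  have "permute_list (p \<circ> move_last N 0) xs = permute_list (move_last N 0) ?ys"
    using move_last_permutes[of 0 N] assms by (intro permute_list_compose) simp
  also have "\<dots> = permute_list (move_last N 0) (butlast ?ys @ [last ?ys])"
    using ys by simp
  also have "\<dots> = last ?ys # butlast ?ys"
    using permute_list_move_last[of 0 "butlast ?ys" "last ?ys"] assms by simp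
  finally show ?thesis .
qed

text \<open>The weight \<open>s\<close> is general so that one argument serves both the signed sums,
  where a cycle of odd length is even, and the symmetrised traces, where the weight is 1.\<close>

lemma sum_permutes_cyclic:
  assumes cyc: "\<And>x ks. mset (x # ks) = mset (js @ [z]) \<Longrightarrow> G (x # ks) = G (ks @ [x])"
    and s: "\<And>p. p permutes {..<Suc (length js)} \<Longrightarrow> s (p \<circ> move_last (length js) 0) = s p"
  shows "(\<Sum>p | p permutes {..<Suc (length js)}. s p * G (permute_list p (js @ [z]))) =
    of_nat (Suc (length js)) *
      (\<Sum>p | p permutes {..<length js}. s p * G (permute_list p js @ [z]) :: 'a::comm_semiring_1)"
proof -
  have "(\<Sum>p | p permutes {..<Suc (length js)}. s p * G (permute_list p (js @ [z]))) =
    of_nat (Suc (length js)) * (\<Sum>p | p permutes {..<length js}. s p * G (permute_list p (js @ [z])))"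
  proof (rule sum_permutes_rotate)
    fix p assume p: "p permutes {..<Suc (length js)}"
    let ?ys = "permute_list p (js @ [z])"
    have p': "p permutes {..<length (js @ [z])}" using p by simp
    have "length ?ys = Suc (length js)" by simp
    then have ys: "butlast ?ys @ [last ?ys] = ?ys"
      by (metis append_butlast_last_id list.size(3) nat.simps(3))
    have m: "mset (last ?ys # butlast ?ys) = mset (js @ [z])"
      using arg_cong[OF ys, of mset] mset_permute_list[OF p'] by simp
    show "s (p \<circ> move_last (length js) 0) * G (permute_list (p \<circ> move_last (length js) 0) (js @ [z])) =
        s p * G (permute_list p (js @ [z]))"
      using permute_list_rotate[OF p, of "js @ [z]"] cyc[OF m] ys s[OF p] by simp
  qed
  then show ?thesis by (simp add: permute_list_append_fixed)
qed

lemma alt_sum_cyclic: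
  assumes "even (length js)"
    and "\<And>x ks. mset (x # ks) = mset (js @ [z]) \<Longrightarrow> G (x # ks) = G (ks @ [x])"
  shows "alt_sum G (js @ [z]) = of_nat (Suc (length js)) * alt_sum (\<lambda>ks. G (ks @ [z])) js"
  unfolding alt_sum_def length_append list.size add_Suc_right add_0_right
proof (rule sum_permutes_cyclic)
  fix p assume p: "p permutes {..<Suc (length js)}"
  have r: "move_last (length js) 0 permutes {..<Suc (length js)}" by (rule move_last_permutes) simp
  show "of_int (sign (p \<circ> move_last (length js) 0)) = (of_int (sign p) :: complex)"
    using sign_permutes_compose[OF _ p r] sign_move_last[of 0 "length js"] assms(1) by simp
qed (rule assms(2))

section \<open>Wick expansion\<close>

definition pair_prod :: "(nat \<Rightarrow> nat \<Rightarrow> complex) \<Rightarrow> nat \<Rightarrow> nat list \<Rightarrow> complex" where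
  "pair_prod \<phi> k js = (\<Prod>a<k. \<phi> (js ! (2 * a)) (js ! (2 * a + 1)))"

text \<open>A Pfaffian-like contraction of \<open>G\<close> with k pairings;
  \<open>wick_expansion\<close> resembles the expansion of a Pfaffian along its last row.\<close>

definition pair_contract :: "nat \<Rightarrow> (nat \<Rightarrow> nat \<Rightarrow> complex) \<Rightarrow> nat \<Rightarrow> (nat list \<Rightarrow> complex) \<Rightarrow> complex" where
  "pair_contract n \<phi> k G = (\<Sum>js\<in>multi_idx n (2 * k). pair_prod \<phi> k js * alt_sum G js)"

lemma pair_prod_double_perm:
  assumes q: "q permutes {..<k}" and js: "length js = 2 * k"
  shows "pair_prod \<phi> k (permute_list (double_perm q) js) = pair_prod \<phi> k js"
proof -
  have d: "double_perm q permutes {..<length js}" using double_perm_permutes[OF q] js by simp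
  have "pair_prod \<phi> k (permute_list (double_perm q) js) =
      (\<Prod>a<k. (\<lambda>a. \<phi> (js ! (2 * a)) (js ! (2 * a + 1))) (q a))"
    unfolding pair_prod_def using js
    by (intro prod.cong refl) (simp add: permute_list_nth[OF d], simp add: double_perm_def)
  also have "\<dots> = pair_prod \<phi> k js"
    unfolding pair_prod_def by (rule prod.permute[OF q, symmetric, unfolded comp_def])
  finally show ?thesis .
qed

lemma pair_prod_snoc:
  assumes "length js = 2 * k"
  shows "pair_prod \<phi> (Suc k) (js @ [i, j]) = pair_prod \<phi> k js * \<phi> i j"
proof -
  have "(js @ [i, j]) ! (2 * k) = i" "(js @ [i, j]) ! (2 * k + 1) = j"
    using assms by (simp_all add: nth_append)
  moreover have "(js @ [i, j]) ! b = js ! b" if "b < 2 * k" for b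
    using that assms by (simp add: nth_append)
  ultimately show ?thesis unfolding pair_prod_def by simp
qed

lemma pair_prod_swap_last:
  assumes anti: "\<And>i j. i \<in> su_idx n \<Longrightarrow> j \<in> su_idx n \<Longrightarrow> \<phi> i j = - \<phi> j i"
    and js: "js \<in> multi_idx n (2 * Suc k)"
  shows "pair_prod \<phi> (Suc k) (permute_list (transpose (2 * k) (2 * k + 1)) js) = - pair_prod \<phi> (Suc k) js"
proof -
  have len: "length js = 2 * k + 2" using js by (simp add: length_multi_idx)
  have t: "transpose (2 * k) (2 * k + 1) permutes {..<length js}"
    using len by (intro permutes_swap_id) auto
  note nth = permute_list_nth[OF t, unfolded Suc_eq_plus1[symmetric]]
  have "pair_prod \<phi> k (permute_list (transpose (2 * k) (2 * k + 1)) js) = pair_prod \<phi> k js"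
    unfolding pair_prod_def using len by (intro prod.cong refl) (simp add: nth transpose_def)
  moreover have "\<phi> (js ! (2 * k + 1)) (js ! (2 * k)) = - \<phi> (js ! (2 * k)) (js ! (2 * k + 1))"
    by (rule anti) (rule nth_multi_idx[OF js], simp)+
  ultimately show ?thesis
    using len by (simp add: pair_prod_def nth)
qed

lemma sum_alt_flip:
  "(\<Sum>js\<in>multi_idx n N. w js * alt_sum G js) =
    (\<Sum>p | p permutes {..<N}. of_int (sign p) * (\<Sum>js\<in>multi_idx n N. w js * G (permute_list p js)))"
proof -
  have "(\<Sum>js\<in>multi_idx n N. w js * alt_sum G js) =
      (\<Sum>js\<in>multi_idx n N. \<Sum>p | p permutes {..<N}. w js * (of_int (sign p) * G (permute_list p js)))"
    by (intro sum.cong refl) (simp add: alt_sum_def length_multi_idx sum_distrib_left)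
  also have "\<dots> = (\<Sum>p | p permutes {..<N}. \<Sum>js\<in>multi_idx n N. w js * (of_int (sign p) * G (permute_list p js)))"
    by (rule sum.swap)
  finally show ?thesis by (simp add: sum_distrib_left ac_simps)
qed

text \<open>Permuting the pairs, or swapping the members of the last pair, multiplies
  \<open>pair_prod\<close> by the sign of that permutation, so these operations leave the signed
  summand of a permutation unchanged. They act transitively on the 2(k + 1) positions, so the last
  slot of \<open>G\<close> may be given to the second member of the last pair at the cost of this
  factor. The first member then stands at some place q among the other indices, with sign
  (-1)^q.\<close>

theorem wick_expansion:
  assumes anti: "\<And>i j. i \<in> su_idx n \<Longrightarrow> j \<in> su_idx n \<Longrightarrow> \<phi> i j = - \<phi> j i"
  shows "pair_contract n \<phi> (Suc k) G = of_nat (2 * Suc k) * (\<Sum>q\<le>2 * k. (-1) ^ q *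
    pair_contract n \<phi> k (\<lambda>ks. \<Sum>i\<in>su_idx n. \<Sum>j\<in>su_idx n. \<phi> i j * G (take q ks @ i # drop q ks @ [j])))"
proof -
  define N where "N = 2 * k + 1"
  let ?S = "{..<Suc N}"
  let ?\<Phi> = "pair_prod \<phi> (Suc k)"
  define T where "T p = of_int (sign p) * (\<Sum>js\<in>multi_idx n (Suc N). ?\<Phi> js * G (permute_list p js))" for p
  \<comment> \<open>A symmetry that carries the last position N = 2k + 1 to b: the last pair is
    exchanged with the pair containing b, and for even b its two members are swapped
    beforehand.\<close>
  define r where "r b = (if even b then double_perm (transpose k (b div 2)) \<circ> transpose (2 * k) (2 * k + 1)
      else double_perm (transpose k (b div 2)))" for b
  have tp: "transpose k (b div 2) permutes {..<Suc k}" if "b < Suc N" for b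
  proof -
    have "b div 2 < Suc k" using that by (simp add: N_def)
    then show ?thesis by (intro permutes_swap_id) auto
  qed
  have dp: "double_perm (transpose k (b div 2)) permutes ?S \<and> sign (double_perm (transpose k (b div 2))) = 1"
    if "b < Suc N" for b
    using double_perm_permutes_sign[OF tp[OF that]] by (simp add: N_def)
  have tr: "transpose (2 * k) (2 * k + 1) permutes ?S"
    by (intro permutes_swap_id) (auto simp: N_def)
  \<comment> \<open>Renaming the summed multi-index by \<open>c\<close> produces the sign of
    \<open>c\<close> from the pairings, which cancels the one in the sign of
    \<open>c \<circ> p\<close>.\<close>
  have inv_T: "T (c \<circ> p) = T p"
    if c: "c permutes ?S" and p: "p permutes ?S"
      and s: "\<And>js. js \<in> multi_idx n (Suc N) \<Longrightarrow> ?\<Phi> (permute_list c js) = of_int (sign c) * ?\<Phi> js" for c p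
  proof -
    have "(\<Sum>js\<in>multi_idx n (Suc N). ?\<Phi> js * G (permute_list p js)) =
        (\<Sum>js\<in>multi_idx n (Suc N). ?\<Phi> (permute_list c js) * G (permute_list p (permute_list c js)))"
      by (rule sum_multi_idx_permute[OF c, symmetric])
    also have "\<dots> = (\<Sum>js\<in>multi_idx n (Suc N). of_int (sign c) * (?\<Phi> js * G (permute_list (c \<circ> p) js)))"
      using p by (intro sum.cong refl) (simp add: s permute_list_compose length_multi_idx)
    finally have "T p = of_int (sign p * sign c) * (\<Sum>js\<in>multi_idx n (Suc N). ?\<Phi> js * G (permute_list (c \<circ> p) js))"
      by (simp add: T_def sum_distrib_left[symmetric] mult.assoc)
    then show ?thesis
      using sign_permutes_compose[OF _ c p] by (simp add: T_def mult.commute)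
  qed
  have dT: "T (double_perm (transpose k (b div 2)) \<circ> p) = T p" if b: "b < Suc N" and p: "p permutes ?S" for b p
  proof (rule inv_T)
    fix js assume js: "js \<in> multi_idx n (Suc N)"
    show "?\<Phi> (permute_list (double_perm (transpose k (b div 2))) js) =
        of_int (sign (double_perm (transpose k (b div 2)))) * ?\<Phi> js"
      using dp[OF b] pair_prod_double_perm[OF tp[OF b], of js] js
      by (simp add: N_def length_multi_idx)
  qed (use dp[OF b] p in auto)
  have rT: "T (r b \<circ> p) = T p" if b: "b < Suc N" and p: "p permutes ?S" for b p
  proof (cases "even b")
    case True
    have "T (r b \<circ> p) = T (double_perm (transpose k (b div 2)) \<circ> (transpose (2 * k) (2 * k + 1) \<circ> p))"
      using True by (simp add: r_def o_assoc)
    also have "\<dots> = T (transpose (2 * k) (2 * k + 1) \<circ> p)"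
      by (rule dT[OF b]) (rule permutes_compose[OF p tr])
    also have "\<dots> = T p"
      by (rule inv_T[OF tr p]) (use pair_prod_swap_last[OF anti] in \<open>simp add: N_def sign_swap_id\<close>)
    finally show ?thesis .
  qed (simp add: r_def dT[OF b p])
  have "pair_contract n \<phi> (Suc k) G = (\<Sum>p | p permutes ?S. T p)"
    using sum_alt_flip[of "?\<Phi>" G n "Suc N"] by (simp add: pair_contract_def T_def N_def)
  also have "\<dots> = (\<Sum>b\<in>?S. \<Sum>p | p permutes (?S - {N}). T (r b \<circ> p))"
  proof (rule sum_permutes_coset_left)
    fix b assume b: "b \<in> ?S"
    have "r b permutes ?S"
      using dp[of b] b tr by (auto simp: r_def intro!: permutes_compose)
    moreover have "r b N = b"
      by (simp add: r_def N_def double_perm_def transpose_def)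
    ultimately show "r b permutes ?S \<and> r b N = b" by simp
  qed simp
  also have "\<dots> = (\<Sum>b\<in>?S. \<Sum>p | p permutes (?S - {N}). T p)"
    by (intro sum.cong refl rT) (auto intro: permutes_subset)
  also have "\<dots> = of_nat (2 * Suc k) * (\<Sum>p | p permutes (?S - {N}). T p)"
    by (simp add: N_def)
  also have "?S - {N} = {..<Suc (2 * k)}" by (auto simp: N_def)
  \<comment> \<open>A permutation fixing N keeps the second member j of the last pair in the last
    slot; q becomes the slot of its partner i.\<close>
  also have "(\<Sum>p | p permutes {..<Suc (2 * k)}. T p) =
      (\<Sum>q\<le>2 * k. \<Sum>p | p permutes {..<2 * k}. T (p \<circ> move_last (2 * k) q))"
    by (rule sum_permutes_insert_last)
  also have "\<dots> = (\<Sum>q\<le>2 * k. (-1) ^ q * pair_contract n \<phi> k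
      (\<lambda>ks. \<Sum>i\<in>su_idx n. \<Sum>j\<in>su_idx n. \<phi> i j * G (take q ks @ i # drop q ks @ [j])))"
  proof (intro sum.cong refl)
    fix q assume "q \<in> {..2 * k}"
    then have q: "q \<le> 2 * k" by simp
    let ?H = "\<lambda>ks. \<Sum>i\<in>su_idx n. \<Sum>j\<in>su_idx n. \<phi> i j * G (take q ks @ i # drop q ks @ [j])"
    have "T (p \<circ> move_last (2 * k) q) = (-1) ^ q * (of_int (sign p) *
        (\<Sum>js\<in>multi_idx n (2 * k). pair_prod \<phi> k js * ?H (permute_list p js)))"
      if p: "p permutes {..<2 * k}" for p
    proof -
      let ?c = "p \<circ> move_last (2 * k) q"
      have p1: "p permutes {..<Suc (2 * k)}" using p by (rule permutes_subset) auto
      have c: "?c permutes {..<Suc (2 * k)}"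
        by (rule permutes_compose[OF move_last_permutes[OF q] p1])
      have "sign ?c = sign p * (-1) ^ (2 * k - q)"
        using sign_permutes_compose[OF _ p1 move_last_permutes[OF q]] sign_move_last[OF q] by simp
      also have "(-1) ^ (2 * k - q) = ((-1) ^ q :: int)"
        using q by (simp add: minus_one_power_iff)
      finally have s: "sign ?c = sign p * (-1) ^ q" .
      have pl: "permute_list ?c (js @ [i, j]) =
          take q (permute_list p js) @ i # drop q (permute_list p js) @ [j]"
        if js: "js \<in> multi_idx n (2 * k)" for js i j
      proof -
        have len: "length js = 2 * k" using js by (rule length_multi_idx)
        have "permute_list ?c ((js @ [i]) @ [j]) = permute_list ?c (js @ [i]) @ [j]"
          by (rule permute_list_append_fixed) (use c len in simp)
        then show ?thesis
          using permute_list_comp_move_last[of p js q i] p q len by simp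
      qed
      have "(\<Sum>js\<in>multi_idx n (Suc N). ?\<Phi> js * G (permute_list ?c js)) =
          (\<Sum>js\<in>multi_idx n (2 * k). \<Sum>i\<in>su_idx n. \<Sum>j\<in>su_idx n.
            ?\<Phi> (js @ [i, j]) * G (permute_list ?c (js @ [i, j])))"
        by (simp add: N_def sum_multi_idx_snoc)
      also have "\<dots> = (\<Sum>js\<in>multi_idx n (2 * k). pair_prod \<phi> k js * ?H (permute_list p js))"
        by (intro sum.cong refl)
          (simp add: pair_prod_snoc length_multi_idx pl sum_distrib_left mult.assoc)
      finally show ?thesis by (simp add: T_def s mult.assoc mult.left_commute)
    qed
    then have "(\<Sum>p | p permutes {..<2 * k}. T (p \<circ> move_last (2 * k) q)) =
        (-1) ^ q * (\<Sum>p | p permutes {..<2 * k}. of_int (sign p) *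
        (\<Sum>js\<in>multi_idx n (2 * k). pair_prod \<phi> k js * ?H (permute_list p js)))"
      by (simp add: sum_distrib_left)
    also have "\<dots> = (-1) ^ q * pair_contract n \<phi> k ?H"
      unfolding pair_contract_def by (simp only: sum_alt_flip)
    finally show "(\<Sum>p | p permutes {..<2 * k}. T (p \<circ> move_last (2 * k) q)) =
      (-1) ^ q * pair_contract n \<phi> k ?H" .
  qed
  finally show ?thesis .
qed


section \<open>Traces of words of matrices\<close>

definition word_prod :: "nat \<Rightarrow> complex mat list \<Rightarrow> complex mat" where
  "word_prod n ws = foldr (*) ws (1\<^sub>m n)"

definition word_trace :: "nat \<Rightarrow> complex mat list \<Rightarrow> complex" where
  "word_trace n ws = mtrace (word_prod n ws)"

lemma word_prod_simps [simp]:
  "word_prod n [] = 1\<^sub>m n"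
  "word_prod n (A # ws) = A * word_prod n ws"
  by (simp_all add: word_prod_def)

lemma word_prod_carrier [simp]:
  "set ws \<subseteq> carrier_mat n n \<Longrightarrow> word_prod n ws \<in> carrier_mat n n"
  by (induction ws) auto

lemma word_prod_append:
  "set u \<subseteq> carrier_mat n n \<Longrightarrow> set v \<subseteq> carrier_mat n n \<Longrightarrow>
    word_prod n (u @ v) = word_prod n u * word_prod n v"
  by (induction u) (auto simp: assoc_mult_mat[of _ n n _ n _ n] left_mult_one_mat[OF word_prod_carrier])

lemma mat_mult_entry:
  assumes "A \<in> carrier_mat n n" "B \<in> carrier_mat n n" "a < n" "b < n"
  shows "(A * B) $$ (a, b) = (\<Sum>c<n. A $$ (a, c) * B $$ (c, b))"
  using assms by (auto simp: scalar_prod_def lessThan_atLeast0)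

lemma mtrace_mult:
  assumes "A \<in> carrier_mat n n" "B \<in> carrier_mat n n"
  shows "mtrace (A * B) = (\<Sum>a<n. \<Sum>b<n. A $$ (a, b) * B $$ (b, a))"
  using assms by (auto simp: mtrace_def scalar_prod_def lessThan_atLeast0)

lemma mtrace_mult_commute:
  assumes "A \<in> carrier_mat n n" "B \<in> carrier_mat n n"
  shows "mtrace (A * B) = mtrace (B * A)"
  using assms by (subst (1 2) mtrace_mult) (auto simp: mult.commute intro: sum.swap)

lemma word_trace_Nil [simp]: "word_trace n [] = of_nat n"
  by (simp add: word_trace_def mtrace_def)

lemma word_trace_rotate:
  "set u \<subseteq> carrier_mat n n \<Longrightarrow> set v \<subseteq> carrier_mat n n \<Longrightarrow>
    word_trace n (u @ v) = word_trace n (v @ u)"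
  by (simp add: word_trace_def word_prod_append mtrace_mult_commute[of _ n])

lemma word_trace_append:
  assumes "set u \<subseteq> carrier_mat n n" "set v \<subseteq> carrier_mat n n"
  shows "word_trace n (u @ v) = (\<Sum>a<n. \<Sum>b<n. word_prod n u $$ (a, b) * word_prod n v $$ (b, a))"
  using assms by (simp add: word_trace_def word_prod_append mtrace_mult[of _ n])

lemma word_trace_Cons:
  assumes "A \<in> carrier_mat n n" "set v \<subseteq> carrier_mat n n"
  shows "word_trace n (A # v) = (\<Sum>a<n. \<Sum>b<n. A $$ (a, b) * word_prod n v $$ (b, a))"
  using assms by (simp add: word_trace_def mtrace_mult[of _ n])

lemma word_trace_slot:
  assumes "A \<in> carrier_mat n n" "set u \<subseteq> carrier_mat n n" "set v \<subseteq> carrier_mat n n"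
  shows "word_trace n (u @ A # v) = word_trace n (A # v @ u)"
  using word_trace_rotate[of u n "A # v"] assms by simp

text \<open>Rotating the slot to the front writes the trace as a sum of entries of \<open>A\<close>
  against entries of a fixed matrix. The relation between the matrices is taken entrywise, the form
  in which the linear combinations of generators are available.\<close>

lemma word_trace_linear:
  assumes A: "A \<in> carrier_mat n n" and B: "\<And>i. i \<in> I \<Longrightarrow> B i \<in> carrier_mat n n"
    and uv: "set u \<subseteq> carrier_mat n n" "set v \<subseteq> carrier_mat n n"
    and lin: "\<And>a b. a < n \<Longrightarrow> b < n \<Longrightarrow> A $$ (a, b) = (\<Sum>i\<in>I. c i * B i $$ (a, b))"
  shows "word_trace n (u @ A # v) = (\<Sum>i\<in>I. c i * word_trace n (u @ B i # v))"
proof -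
  let ?P = "word_prod n (v @ u)"
  have "word_trace n (u @ A # v) = (\<Sum>a<n. \<Sum>b<n. A $$ (a, b) * ?P $$ (b, a))"
    using A uv by (simp add: word_trace_slot word_trace_Cons)
  also have "\<dots> = (\<Sum>a<n. \<Sum>b<n. \<Sum>i\<in>I. c i * B i $$ (a, b) * ?P $$ (b, a))"
    by (intro sum.cong refl) (simp add: lin sum_distrib_right)
  also have "\<dots> = (\<Sum>a<n. \<Sum>i\<in>I. \<Sum>b<n. c i * B i $$ (a, b) * ?P $$ (b, a))"
    by (intro sum.cong refl sum.swap)
  also have "\<dots> = (\<Sum>i\<in>I. \<Sum>a<n. \<Sum>b<n. c i * B i $$ (a, b) * ?P $$ (b, a))"
    by (rule sum.swap)
  also have "\<dots> = (\<Sum>i\<in>I. c i * word_trace n (u @ B i # v))"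
    using B uv by (intro sum.cong refl) (simp add: word_trace_slot word_trace_Cons sum_distrib_left mult.assoc)
  finally show ?thesis .
qed

lemma word_trace_mult:
  assumes "A \<in> carrier_mat n n" "B \<in> carrier_mat n n" "set u \<subseteq> carrier_mat n n" "set v \<subseteq> carrier_mat n n"
  shows "word_trace n (u @ (A * B) # v) = word_trace n (u @ A # B # v)"
  using assms by (simp add: word_trace_def word_prod_append assoc_mult_mat[of _ n n _ n _ n])

text \<open>Both su(n) relations have this shape: a product is a multiple of the reversed product,
  plus a multiple of a third matrix, plus a combination of generators.\<close>

lemma word_trace_relation:
  assumes A: "A \<in> carrier_mat n n" "A' \<in> carrier_mat n n" "C \<in> carrier_mat n n"
    and B: "\<And>i. i \<in> I \<Longrightarrow> B i \<in> carrier_mat n n"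
    and uv: "set u \<subseteq> carrier_mat n n" "set v \<subseteq> carrier_mat n n" and I: "finite I"
    and lin: "\<And>a b. a < n \<Longrightarrow> b < n \<Longrightarrow>
      A $$ (a, b) = s * A' $$ (a, b) + r * C $$ (a, b) + (\<Sum>i\<in>I. c i * B i $$ (a, b))"
  shows "word_trace n (u @ A # v) = s * word_trace n (u @ A' # v) + r * word_trace n (u @ C # v)
    + (\<Sum>i\<in>I. c i * word_trace n (u @ B i # v))"
proof -
  \<comment> \<open>The nested option type merges the three kinds of summands into a single index
    set, to which \<open>word_trace_linear\<close> applies.\<close>
  let ?J = "insert None (insert (Some None) (Some ` Some ` I))"
  let ?c = "case_option s (case_option r c)" and ?B = "case_option A' (case_option C B)"
  have "word_trace n (u @ A # v) = (\<Sum>i\<in>?J. ?c i * word_trace n (u @ ?B i # v))"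
    by (rule word_trace_linear[OF A(1) _ uv])
      (use A B I in \<open>auto simp: lin sum.reindex add.assoc image_iff\<close>)
  then show ?thesis using I by (simp add: sum.reindex image_iff add.assoc)
qed

section \<open>Generators\<close>

locale su_gens =
  fixes n :: nat and T :: "nat \<Rightarrow> complex mat" and f d :: "nat \<Rightarrow> nat \<Rightarrow> nat \<Rightarrow> real"
  assumes n_ge_2: "n \<ge> 2" and gens: "su_generators n T f d"
begin

abbreviation "X \<equiv> X_gen T"
abbreviation "tr \<equiv> word_trace n"
abbreviation "I \<equiv> su_idx n"
abbreviation "C \<equiv> carrier_mat n n :: complex mat set"

lemma n_pos: "n > 0" "of_nat n \<noteq> (0 :: complex)"
  using n_ge_2 by auto

lemma T_carrier [simp]: "i \<in> I \<Longrightarrow> T i \<in> C"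
  using gens by (simp add: su_generators_def)

lemma T_dims [simp]: "i \<in> I \<Longrightarrow> dim_row (T i) = n" "i \<in> I \<Longrightarrow> dim_col (T i) = n"
  by (rule carrier_matD[OF T_carrier], assumption)+

lemma T_trace: "i \<in> I \<Longrightarrow> mtrace (T i) = 0"
  using gens by (simp add: su_generators_def)

lemma T_norm: "i \<in> I \<Longrightarrow> j \<in> I \<Longrightarrow> mtrace (T i * T j) = 1 / 2 * kdelta i j"
  using gens by (simp add: su_generators_def)

lemma T_comm: "i \<in> I \<Longrightarrow> j \<in> I \<Longrightarrow> T i * T j - T j * T i = \<i> \<cdot>\<^sub>m lincomb_gen n T (f i j)"
  using gens by (simp add: su_generators_def)

lemma T_anticomm: "i \<in> I \<Longrightarrow> j \<in> I \<Longrightarrow>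
    T i * T j + T j * T i = (1 / of_nat n * kdelta i j) \<cdot>\<^sub>m 1\<^sub>m n + lincomb_gen n T (d i j)"
  using gens by (simp add: su_generators_def)

lemma X_carrier [simp]: "i \<in> I \<Longrightarrow> X i \<in> C"
  by (simp add: X_gen_def)

lemma X_dims [simp]: "i \<in> I \<Longrightarrow> dim_row (X i) = n" "i \<in> I \<Longrightarrow> dim_col (X i) = n"
  by (simp_all add: X_gen_def)

lemma X_entry: "i \<in> I \<Longrightarrow> a < n \<Longrightarrow> b < n \<Longrightarrow> X i $$ (a, b) = - \<i> * T i $$ (a, b)"
  by (simp add: X_gen_def)

lemma minus_i_mult: "(- \<i> * p) * (- \<i> * q) = - (p * q)"
  by (simp add: complex_eq_iff)

lemma X_words [simp]: "set js \<subseteq> I \<Longrightarrow> X ` set js \<subseteq> C"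
  by auto

lemma XX_entry:
  assumes "i \<in> I" "j \<in> I" "a < n" "b < n"
  shows "(X i * X j) $$ (a, b) = - (T i * T j) $$ (a, b)"
  using assms
  by (simp add: X_gen_def scalar_prod_def sum_negf[symmetric] sum_distrib_left mult_ac)

lemma tr_X: "i \<in> I \<Longrightarrow> tr [X i] = 0"
  using T_trace[of i] by (simp add: word_trace_def mtrace_def X_gen_def sum_negf sum_distrib_left[symmetric])

lemma tr_XX:
  assumes "i \<in> I" "j \<in> I"
  shows "tr [X i, X j] = - 1 / 2 * kdelta i j"
proof -
  have "tr [X i, X j] = mtrace (X i * X j)"
    using assms by (simp add: word_trace_def right_mult_one_mat[OF X_carrier])
  also have "\<dots> = - mtrace (T i * T j)"
    using assms X_carrier[of i] by (simp add: mtrace_def XX_entry sum_negf del: index_mult_mat(1))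
  finally have "tr [X i, X j] = - mtrace (T i * T j)" .
  then show ?thesis by (simp add: T_norm[OF assms])
qed

lemma tr_commutator:
  assumes ij: "i \<in> I" "j \<in> I" and uv: "set u \<subseteq> C" "set v \<subseteq> C"
  shows "tr (u @ X i # X j # v) = tr (u @ X j # X i # v) + (\<Sum>l\<in>I. of_real (f i j l) * tr (u @ X l # v))"
proof -
  \<comment> \<open>The commutator has no identity term, so the third matrix is a dummy with
    coefficient 0.\<close>
  have "tr (u @ (X i * X j) # v) = 1 * tr (u @ (X j * X i) # v) + 0 * tr (u @ (X j * X i) # v)
      + (\<Sum>l\<in>I. of_real (f i j l) * tr (u @ X l # v))"
  proof (rule word_trace_relation)
    fix a b assume ab: "a < n" "b < n"
    have "(T i * T j - T j * T i) $$ (a, b) = (\<i> \<cdot>\<^sub>m lincomb_gen n T (f i j)) $$ (a, b)"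
      by (simp only: T_comm[OF ij])
    then have "(T i * T j) $$ (a, b) - (T j * T i) $$ (a, b) = \<i> * (\<Sum>l\<in>I. of_real (f i j l) * T l $$ (a, b))"
      using ij ab by (simp add: lincomb_gen_def del: index_mult_mat(1))
    then show "(X i * X j) $$ (a, b) = 1 * (X j * X i) $$ (a, b) + 0 * (X j * X i) $$ (a, b)
        + (\<Sum>l\<in>I. of_real (f i j l) * X l $$ (a, b))"
      using ij ab
      by (simp add: XX_entry X_entry sum_distrib_left sum_negf algebra_simps del: index_mult_mat(1))
  qed (use ij uv in \<open>auto intro: mult_carrier_mat[of _ n n]\<close>)
  then show ?thesis using ij uv by (simp add: word_trace_mult)
qed

text \<open>Because X = -i T, the product X_i X_j equals -T_i T_j while T_l = i X_l; this gives the
  signs and the factor i of the last term.\<close>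

lemma tr_anticommutator:
  assumes ij: "i \<in> I" "j \<in> I" and uv: "set u \<subseteq> C" "set v \<subseteq> C"
  shows "tr (u @ X i # X j # v) = - tr (u @ X j # X i # v) - kdelta i j / of_nat n * tr (u @ v)
    - \<i> * (\<Sum>l\<in>I. of_real (d i j l) * tr (u @ X l # v))"
proof -
  let ?r = "- (kdelta i j / of_nat n) :: complex"
  have "tr (u @ (X i * X j) # v) = (- 1) * tr (u @ (X j * X i) # v) + ?r * tr (u @ 1\<^sub>m n # v)
      + (\<Sum>l\<in>I. (- \<i> * of_real (d i j l)) * tr (u @ X l # v))"
  proof (rule word_trace_relation[where A = "X i * X j" and A' = "X j * X i" and C = "1\<^sub>m n" and B = X and I = I
        and s = "- 1" and r = ?r and c = "\<lambda>l. - \<i> * of_real (d i j l)" and u = u and v = v])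
    fix a b assume ab: "a < n" "b < n"
    have "(T i * T j + T j * T i) $$ (a, b) =
        ((1 / of_nat n * kdelta i j) \<cdot>\<^sub>m 1\<^sub>m n + lincomb_gen n T (d i j)) $$ (a, b)"
      by (simp only: T_anticomm[OF ij])
    then have e: "(T i * T j) $$ (a, b) + (T j * T i) $$ (a, b) =
        kdelta i j / of_nat n * 1\<^sub>m n $$ (a, b) + (\<Sum>l\<in>I. of_real (d i j l) * T l $$ (a, b))"
      using ij ab by (simp add: lincomb_gen_def del: index_mult_mat(1) index_one_mat(1))
    have x: "(\<Sum>l\<in>I. (- \<i> * of_real (d i j l)) * X l $$ (a, b)) = - (\<Sum>l\<in>I. of_real (d i j l) * T l $$ (a, b))"
      unfolding sum_negf[symmetric] using ab by (intro sum.cong refl) (simp only: X_entry minus_i_mult)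
    have "- p = (- 1) * (- q) + - r * z + - s" if "p + q = r * z + s" for p q r s z :: complex
      using that by (simp add: algebra_simps)
    from this[OF e]
    show "(X i * X j) $$ (a, b) = (- 1) * (X j * X i) $$ (a, b) + ?r * 1\<^sub>m n $$ (a, b)
        + (\<Sum>l\<in>I. (- \<i> * of_real (d i j l)) * X l $$ (a, b))"
      unfolding x XX_entry[OF ij ab] XX_entry[OF ij(2,1) ab] .
  qed (use ij uv in \<open>auto intro: mult_carrier_mat[of _ n n]\<close>)
  moreover have "tr (u @ 1\<^sub>m n # v) = tr (u @ v)"
    using uv by (simp add: word_trace_def word_prod_append left_mult_one_mat[OF word_prod_carrier])
  moreover have "(\<Sum>l\<in>I. (- \<i> * of_real (d i j l)) * tr (u @ X l # v)) =
      - \<i> * (\<Sum>l\<in>I. of_real (d i j l) * tr (u @ X l # v))"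
    by (simp only: sum_distrib_left mult.assoc)
  ultimately show ?thesis using ij uv by (simp add: word_trace_mult)
qed

text \<open>Tracing the commutator against X_k isolates one structure constant, as Tr (X_l X_k) = -
  delta_lk / 2. The symmetries of f and d, which \<open>su_generators\<close> does not list, then
  come from the cyclicity of the trace.\<close>

lemma f_eq_tr:
  assumes "i \<in> I" "j \<in> I" "k \<in> I"
  shows "complex_of_real (f i j k) = - 2 * (tr [X i, X j, X k] - tr [X j, X i, X k])"
proof -
  have "tr [X i, X j, X k] - tr [X j, X i, X k] = (\<Sum>l\<in>I. of_real (f i j l) * tr [X l, X k])"
    using tr_commutator[of i j "[]" "[X k]"] assms by simp
  also have "\<dots> = (\<Sum>l\<in>I. if l = k then - of_real (f i j k) / 2 else 0)"
    using assms by (intro sum.cong refl) (simp add: tr_XX kdelta_def)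
  finally show ?thesis using assms by simp
qed

lemma d_eq_tr:
  assumes "i \<in> I" "j \<in> I" "k \<in> I"
  shows "complex_of_real (d i j k) = - 2 * \<i> * (tr [X i, X j, X k] + tr [X j, X i, X k])"
proof -
  have "tr [X i, X j, X k] + tr [X j, X i, X k] = - \<i> * (\<Sum>l\<in>I. of_real (d i j l) * tr [X l, X k])"
    using tr_anticommutator[of i j "[]" "[X k]"] assms by (simp add: tr_X)
  also have "(\<Sum>l\<in>I. of_real (d i j l) * tr [X l, X k]) = (\<Sum>l\<in>I. if l = k then - of_real (d i j k) / 2 else 0)"
    using assms by (intro sum.cong refl) (simp add: tr_XX kdelta_def)
  finally have "tr [X i, X j, X k] + tr [X j, X i, X k] = \<i> * of_real (d i j k) / 2"
    using assms by simp
  then show ?thesis by (simp only:) simp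
qed

lemma tr_cyclic3:
  "i \<in> I \<Longrightarrow> j \<in> I \<Longrightarrow> k \<in> I \<Longrightarrow> tr [X i, X j, X k] = tr [X j, X k, X i]"
  using word_trace_rotate[of "[X i]" n "[X j, X k]"] by simp

lemma f_anti: "i \<in> I \<Longrightarrow> j \<in> I \<Longrightarrow> k \<in> I \<Longrightarrow> f i j k = - f j i k"
  by (rule of_real_eq_iff[where 'a = complex, THEN iffD1]) (simp add: f_eq_tr)

lemma f_cyclic: "i \<in> I \<Longrightarrow> j \<in> I \<Longrightarrow> k \<in> I \<Longrightarrow> f i j k = f j k i"
  using tr_cyclic3[of i j k] tr_cyclic3[of j i k] tr_cyclic3[of i k j]
  by (intro of_real_eq_iff[where 'a = complex, THEN iffD1]) (simp add: f_eq_tr)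

lemma d_cyclic: "i \<in> I \<Longrightarrow> j \<in> I \<Longrightarrow> k \<in> I \<Longrightarrow> d i j k = d j k i"
  using tr_cyclic3[of i j k] tr_cyclic3[of j i k] tr_cyclic3[of i k j]
  by (intro of_real_eq_iff[where 'a = complex, THEN iffD1]) (simp add: d_eq_tr)

lemma sum_entries:
  "(\<Sum>e<n * n. h (e div n) (e mod n)) = (\<Sum>a<n. \<Sum>b<n. h a b :: complex)"
proof -
  have *: "a * n + b < n * n" if "a < n" "b < n" for a b
  proof -
    have "a * n + b < Suc a * n" using that by simp
    also have "\<dots> \<le> n * n" using that by (intro mult_right_mono) auto
    finally show ?thesis .
  qed
  have "(\<Sum>e<n * n. h (e div n) (e mod n)) = (\<Sum>(a, b)\<in>{..<n} \<times> {..<n}. h a b)"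
    by (rule sum.reindex_bij_witness[of _ "\<lambda>(a, b). a * n + b" "\<lambda>e. (e div n, e mod n)"])
      (use n_pos * in \<open>auto simp: less_mult_imp_div_less\<close>)
  then show ?thesis by (simp add: sum.cartesian_product)
qed

text \<open>The \<open>T\<^sub>i\<close> and the identity are \<open>n\<^sup>2\<close> orthogonal vectors in an \<open>n\<^sup>2\<close>-dimensional space, so
  the square matrix of their entries is invertible; its left inverse gives the completeness relation.\<close>

lemma T_completeness:
  assumes lt: "a < n" "b < n" "c < n" "e < n"
  shows "(\<Sum>i\<in>I. T i $$ (a, b) * T i $$ (c, e)) =
    1 / 2 * (kdelta a e * kdelta b c - kdelta a b * kdelta c e / of_nat n)"
proof -
  define m where "m = n * n"
  define T' where "T' r = (if r < m - 1 then T (Suc r) else 1\<^sub>m n)" for r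
  \<comment> \<open>Weights of the dual basis: the inverses of Tr (T_i T_i) = 1/2 and Tr 1 =
    n.\<close>
  define w where "w r = (if r < m - 1 then 2 else 1 / of_nat n :: complex)" for r :: nat
  define R where "R = mat m m (\<lambda>(r, q). T' r $$ (q div n, q mod n))"
  define S where "S = mat m m (\<lambda>(q, r). w r * T' r $$ (q mod n, q div n))"
  have m1: "m \<ge> 1" using n_ge_2 by (simp add: m_def)
  have Suc_I: "Suc r \<in> I" if "r < m - 1" for r
    using that by (auto simp: su_idx_def m_def power2_eq_square)
  have T'C: "T' r \<in> C" for r using Suc_I by (auto simp: T'_def)
  have orth: "mtrace (T' r * T' s) * w s = kdelta r s" if rs: "r < m" "s < m" for r s
  proof -
    consider "r < m - 1" "s < m - 1" | "r < m - 1" "s = m - 1" | "r = m - 1" "s < m - 1" | "r = m - 1" "s = m - 1"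
      using rs by linarith
    then show ?thesis
    proof cases
      case 1
      then show ?thesis using T_norm[OF Suc_I Suc_I, of r s] by (simp add: T'_def w_def kdelta_def)
    next
      case 2
      then show ?thesis using T_trace[OF Suc_I, of r] T_carrier[OF Suc_I, of r]
        by (simp add: T'_def w_def kdelta_def)
    next
      case 3
      then show ?thesis using T_trace[OF Suc_I, of s] T_carrier[OF Suc_I, of s]
        by (simp add: T'_def w_def kdelta_def)
    next
      case 4
      then show ?thesis using n_pos by (simp add: T'_def w_def kdelta_def mtrace_def)
    qed
  qed
  have "R * S = 1\<^sub>m m"
  proof (rule eq_matI)
    fix r s assume "r < dim_row (1\<^sub>m m)" "s < dim_col (1\<^sub>m m)"
    then have rs: "r < m" "s < m" by auto
    have "(R * S) $$ (r, s) = (\<Sum>q<n * n. T' r $$ (q div n, q mod n) * (w s * T' s $$ (q mod n, q div n)))"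
      using rs by (simp add: R_def S_def scalar_prod_def lessThan_atLeast0 m_def)
    also have "\<dots> = mtrace (T' r * T' s) * w s"
      by (subst sum_entries, subst mtrace_mult[OF T'C T'C]) (simp add: sum_distrib_left sum_distrib_right mult_ac)
    finally show "(R * S) $$ (r, s) = 1\<^sub>m m $$ (r, s)" using orth[OF rs] rs by (simp add: kdelta_def)
  qed (simp_all add: R_def S_def)
  then have SR: "S * R = 1\<^sub>m m"
    by (intro mat_mult_left_right_inverse[of R m S]) (simp_all add: R_def S_def)
  have idx: "x * n + y < m" if "x < n" "y < n" for x y
  proof -
    have "x * n + y < Suc x * n" using that by simp
    also have "\<dots> \<le> n * n" using that by (intro mult_right_mono) auto
    finally show ?thesis by (simp add: m_def)
  qed
  \<comment> \<open>\<open>S\<close> stores its matrices transposed, as the trace pairing demands,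
    so its row b n + a belongs to the entry (a, b).\<close>
  let ?p = "b * n + a" and ?q = "c * n + e"
  have "(S * R) $$ (?p, ?q) = (\<Sum>r<m. w r * T' r $$ (a, b) * T' r $$ (c, e))"
    using idx[of b a] idx[of c e] lt by (simp add: R_def S_def scalar_prod_def lessThan_atLeast0)
  also have "{..<m} = insert (m - 1) {..<m - 1}" using m1 by auto
  also have "(\<Sum>r\<in>\<dots>. w r * T' r $$ (a, b) * T' r $$ (c, e)) =
      kdelta a b * kdelta c e / of_nat n + (\<Sum>r<m - 1. 2 * (T (Suc r) $$ (a, b) * T (Suc r) $$ (c, e)))"
    using lt by (simp add: w_def T'_def kdelta_def mult.assoc)
  also have "(\<Sum>r<m - 1. 2 * (T (Suc r) $$ (a, b) * T (Suc r) $$ (c, e))) =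
      (\<Sum>i\<in>I. 2 * (T i $$ (a, b) * T i $$ (c, e)))"
    by (rule sum.reindex_bij_witness[of _ "\<lambda>i. i - 1" Suc])
      (auto simp: su_idx_def m_def power2_eq_square)
  finally have "kdelta a b * kdelta c e / of_nat n + 2 * (\<Sum>i\<in>I. T i $$ (a, b) * T i $$ (c, e)) =
      1\<^sub>m m $$ (?p, ?q)"
    by (simp add: SR sum_distrib_left)
  also have "\<dots> = kdelta a e * kdelta b c"
  proof -
    have "?p = ?q \<longleftrightarrow> a = e \<and> b = c"
    proof
      assume "?p = ?q"
      then have "?p mod n = ?q mod n" "?p div n = ?q div n" by simp_all
      then show "a = e \<and> b = c" using lt by simp
    qed simp
    then show ?thesis using idx[of b a] idx[of c e] lt by (simp add: kdelta_def)
  qed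
  finally show ?thesis by (simp add: field_simps)
qed

lemma X_completeness:
  assumes "a < n" "b < n" "c < n" "e < n"
  shows "(\<Sum>i\<in>I. X i $$ (a, b) * X i $$ (c, e)) =
    - 1 / 2 * (kdelta a e * kdelta b c - kdelta a b * kdelta c e / of_nat n)"
proof -
  have "(\<Sum>i\<in>I. X i $$ (a, b) * X i $$ (c, e)) = - (\<Sum>i\<in>I. T i $$ (a, b) * T i $$ (c, e))"
    unfolding sum_negf[symmetric] using assms by (intro sum.cong refl) (simp only: X_entry minus_i_mult)
  then show ?thesis unfolding T_completeness[OF assms] by simp
qed

section \<open>Fierz identities\<close>

lemma kdelta_sum [simp]:
  "a < n \<Longrightarrow> (\<Sum>e<n. kdelta a e * h e) = h a" "a < n \<Longrightarrow> (\<Sum>e<n. kdelta e a * h e) = h a"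
  by (simp_all add: kdelta_def if_distrib[of "\<lambda>x. x * _"] cong: if_cong)

text \<open>Completeness contracted with an arbitrary array \<open>h\<close>. The two Fierz
  identities below differ only in how the entries of two words are assigned to the four indices of
  \<open>h\<close>.\<close>

lemma fierz_sum:
  "(\<Sum>i\<in>I. \<Sum>a<n. \<Sum>b<n. \<Sum>c<n. \<Sum>e<n. X i $$ (a, b) * X i $$ (c, e) * h a b c e) =
    - 1 / 2 * ((\<Sum>a<n. \<Sum>b<n. h a b b a) - (\<Sum>a<n. \<Sum>c<n. h a a c c) / of_nat n)"
proof -
  have "(\<Sum>i\<in>I. \<Sum>a<n. \<Sum>b<n. \<Sum>c<n. \<Sum>e<n. X i $$ (a, b) * X i $$ (c, e) * h a b c e) =
      (\<Sum>a<n. \<Sum>b<n. \<Sum>c<n. \<Sum>e<n. (\<Sum>i\<in>I. X i $$ (a, b) * X i $$ (c, e)) * h a b c e)"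
    unfolding sum_distrib_right
    by (simp only: sum.swap[where A = I and B = "{..<n}"])
  also have "\<dots> = (\<Sum>a<n. \<Sum>b<n. \<Sum>c<n. \<Sum>e<n.
      - 1 / 2 * (kdelta a e * (kdelta b c * h a b c e)) + 1 / (2 * of_nat n) * (kdelta c e * (kdelta a b * h a b c e)))"
  proof (intro sum.cong refl)
    fix a b c e assume "a \<in> {..<n}" "b \<in> {..<n}" "c \<in> {..<n}" "e \<in> {..<n}"
    then have x: "(\<Sum>i\<in>I. X i $$ (a, b) * X i $$ (c, e)) =
        - 1 / 2 * (kdelta a e * kdelta b c - kdelta a b * kdelta c e / of_nat n)"
      by (intro X_completeness) auto
    have "- 1 / 2 * (p * q - r * s / N) * t = - 1 / 2 * (p * (q * t)) + 1 / (2 * N) * (s * (r * t))"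
      for p q r s t N :: complex
      by (simp add: algebra_simps)
    then show "(\<Sum>i\<in>I. X i $$ (a, b) * X i $$ (c, e)) * h a b c e =
        - 1 / 2 * (kdelta a e * (kdelta b c * h a b c e)) + 1 / (2 * of_nat n) * (kdelta c e * (kdelta a b * h a b c e))"
      unfolding x .
  qed
  also have "\<dots> = - 1 / 2 * (\<Sum>a<n. \<Sum>b<n. \<Sum>c<n. \<Sum>e<n. kdelta a e * (kdelta b c * h a b c e))
      + 1 / (2 * of_nat n) * (\<Sum>a<n. \<Sum>b<n. \<Sum>c<n. \<Sum>e<n. kdelta c e * (kdelta a b * h a b c e))"
    by (simp only: sum.distrib sum_distrib_left)
  finally have main: "(\<Sum>i\<in>I. \<Sum>a<n. \<Sum>b<n. \<Sum>c<n. \<Sum>e<n. X i $$ (a, b) * X i $$ (c, e) * h a b c e) =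
      - 1 / 2 * (\<Sum>a<n. \<Sum>b<n. \<Sum>c<n. \<Sum>e<n. kdelta a e * (kdelta b c * h a b c e))
      + 1 / (2 * of_nat n) * (\<Sum>a<n. \<Sum>b<n. \<Sum>c<n. \<Sum>e<n. kdelta c e * (kdelta a b * h a b c e))" .
  have 1: "(\<Sum>a<n. \<Sum>b<n. \<Sum>c<n. \<Sum>e<n. kdelta a e * (kdelta b c * h a b c e)) = (\<Sum>a<n. \<Sum>b<n. h a b b a)"
    by (intro sum.cong refl) simp
  have "(\<Sum>a<n. \<Sum>b<n. \<Sum>c<n. \<Sum>e<n. kdelta c e * (kdelta a b * h a b c e)) =
      (\<Sum>a<n. \<Sum>b<n. kdelta a b * (\<Sum>c<n. h a b c c))"
    by (intro sum.cong refl) (simp add: sum_distrib_left)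
  also have "\<dots> = (\<Sum>a<n. \<Sum>c<n. h a a c c)"
    by (rule sum.cong[OF refl]) simp
  finally have 2: "(\<Sum>a<n. \<Sum>b<n. \<Sum>c<n. \<Sum>e<n. kdelta c e * (kdelta a b * h a b c e)) = (\<Sum>a<n. \<Sum>c<n. h a a c c)" .
  show ?thesis unfolding main 1 2 by (simp add: right_diff_distrib)
qed

text \<open>With one generator in each trace, the crossed deltas of the completeness relation join
  the two index cycles into one; the 1/n term just deletes both generators.\<close>

lemma fierz_merge:
  assumes "set u \<subseteq> C" "set v \<subseteq> C"
  shows "(\<Sum>i\<in>I. tr (X i # u) * tr (X i # v)) = - 1 / 2 * (tr (u @ v) - tr u * tr v / of_nat n)"
proof -
  let ?P = "word_prod n u" and ?Q = "word_prod n v"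
  have "(\<Sum>i\<in>I. tr (X i # u) * tr (X i # v)) =
      (\<Sum>i\<in>I. \<Sum>a<n. \<Sum>b<n. \<Sum>c<n. \<Sum>e<n. X i $$ (a, b) * X i $$ (c, e) * (?P $$ (b, a) * ?Q $$ (e, c)))"
  proof (intro sum.cong refl)
    fix i assume "i \<in> I"
    then show "tr (X i # u) * tr (X i # v) = (\<Sum>a<n. \<Sum>b<n. \<Sum>c<n. \<Sum>e<n.
        X i $$ (a, b) * X i $$ (c, e) * (?P $$ (b, a) * ?Q $$ (e, c)))"
      using assms
      by (simp only: word_trace_Cons X_carrier sum_distrib_right)
        (simp only: sum_distrib_left, simp only: mult.assoc mult.left_commute)
  qed
  also have "\<dots> = - 1 / 2 * ((\<Sum>a<n. \<Sum>b<n. ?P $$ (b, a) * ?Q $$ (a, b))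
      - (\<Sum>a<n. \<Sum>c<n. ?P $$ (a, a) * ?Q $$ (c, c)) / of_nat n)"
    by (rule fierz_sum)
  finally have main: "(\<Sum>i\<in>I. tr (X i # u) * tr (X i # v)) =
      - 1 / 2 * ((\<Sum>a<n. \<Sum>b<n. ?P $$ (b, a) * ?Q $$ (a, b))
      - (\<Sum>a<n. \<Sum>c<n. ?P $$ (a, a) * ?Q $$ (c, c)) / of_nat n)" .
  have 1: "(\<Sum>a<n. \<Sum>b<n. ?P $$ (b, a) * ?Q $$ (a, b)) = tr (u @ v)"
    using assms by (subst sum.swap) (simp add: word_trace_append)
  have 2: "(\<Sum>a<n. \<Sum>c<n. ?P $$ (a, a) * ?Q $$ (c, c)) = tr u * tr v"
    using word_prod_carrier[OF assms(1)] word_prod_carrier[OF assms(2)]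
    by (auto simp: word_trace_def mtrace_def sum_product)
  show ?thesis by (simp only: main 1 2)
qed

text \<open>With both generators in the same trace, the crossed deltas cut its index cycle at the
  two slots into two cycles.\<close>

lemma fierz_split:
  assumes "set u \<subseteq> C" "set v \<subseteq> C"
  shows "(\<Sum>i\<in>I. tr (X i # u @ X i # v)) = - 1 / 2 * (tr u * tr v - tr (u @ v) / of_nat n)"
proof -
  let ?P = "word_prod n u" and ?Q = "word_prod n v"
  have PQ: "?P \<in> C" "?Q \<in> C" using assms by auto
  have "(\<Sum>i\<in>I. tr (X i # u @ X i # v)) =
      (\<Sum>i\<in>I. \<Sum>a<n. \<Sum>b<n. \<Sum>c<n. \<Sum>e<n. X i $$ (a, b) * X i $$ (c, e) * (?P $$ (b, c) * ?Q $$ (e, a)))"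
  proof (intro sum.cong refl)
    fix i assume i: "i \<in> I"
    have XQ: "(X i * ?Q) \<in> C" using X_carrier[OF i] PQ by simp
    have "tr (X i # u @ X i # v) = (\<Sum>a<n. \<Sum>b<n. X i $$ (a, b) * (?P * (X i * ?Q)) $$ (b, a))"
      using assms i by (simp add: word_trace_Cons word_prod_append del: index_mult_mat(1))
    also have "\<dots> = (\<Sum>a<n. \<Sum>b<n. X i $$ (a, b) * (\<Sum>c<n. ?P $$ (b, c) * (\<Sum>e<n. X i $$ (c, e) * ?Q $$ (e, a))))"
    proof (intro sum.cong refl arg_cong2[of _ _ _ _ "(*)"])
      fix a b assume ab: "a \<in> {..<n}" "b \<in> {..<n}"
      have "(?P * (X i * ?Q)) $$ (b, a) = (\<Sum>c<n. ?P $$ (b, c) * (X i * ?Q) $$ (c, a))"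
        using ab PQ XQ by (intro mat_mult_entry) auto
      also have "\<dots> = (\<Sum>c<n. ?P $$ (b, c) * (\<Sum>e<n. X i $$ (c, e) * ?Q $$ (e, a)))"
        using ab PQ X_carrier[OF i] by (intro sum.cong refl) (simp add: mat_mult_entry[of _ n] del: index_mult_mat(1))
      finally show "(?P * (X i * ?Q)) $$ (b, a) = (\<Sum>c<n. ?P $$ (b, c) * (\<Sum>e<n. X i $$ (c, e) * ?Q $$ (e, a)))" .
    qed
    finally show "tr (X i # u @ X i # v) =
        (\<Sum>a<n. \<Sum>b<n. \<Sum>c<n. \<Sum>e<n. X i $$ (a, b) * X i $$ (c, e) * (?P $$ (b, c) * ?Q $$ (e, a)))"
      by (simp add: sum_distrib_left mult_ac)
  qed
  also have "\<dots> = - 1 / 2 * ((\<Sum>a<n. \<Sum>b<n. ?P $$ (b, b) * ?Q $$ (a, a))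
      - (\<Sum>a<n. \<Sum>c<n. ?P $$ (a, c) * ?Q $$ (c, a)) / of_nat n)"
    by (rule fierz_sum)
  finally have main: "(\<Sum>i\<in>I. tr (X i # u @ X i # v)) =
      - 1 / 2 * ((\<Sum>a<n. \<Sum>b<n. ?P $$ (b, b) * ?Q $$ (a, a))
      - (\<Sum>a<n. \<Sum>c<n. ?P $$ (a, c) * ?Q $$ (c, a)) / of_nat n)" .
  have 1: "(\<Sum>a<n. \<Sum>c<n. ?P $$ (a, c) * ?Q $$ (c, a)) = tr (u @ v)"
    using assms by (simp add: word_trace_append)
  have 2: "(\<Sum>a<n. \<Sum>b<n. ?P $$ (b, b) * ?Q $$ (a, a)) = tr u * tr v"
    using PQ by (subst sum.swap) (auto simp: word_trace_def mtrace_def sum_product)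
  show ?thesis by (simp only: main 1 2)
qed

section \<open>Contraction with the pairing x^i f_ijk\<close>

definition vec_mat :: "(nat \<Rightarrow> complex) \<Rightarrow> complex mat" where
  "vec_mat x = mat n n (\<lambda>(a, b). \<Sum>i\<in>I. x i * X i $$ (a, b))"

lemma vec_mat_carrier [simp]: "vec_mat x \<in> C"
  by (simp add: vec_mat_def)

lemma tr_vec_mat:
  "set u \<subseteq> C \<Longrightarrow> set v \<subseteq> C \<Longrightarrow> tr (u @ vec_mat x # v) = (\<Sum>i\<in>I. x i * tr (u @ X i # v))"
  by (rule word_trace_linear) (auto simp: vec_mat_def)

lemma tr_vec_mat_single: "tr [vec_mat x] = 0"
  using tr_vec_mat[of "[]" "[]" x] by (simp add: tr_X)

definition f_form :: "(nat \<Rightarrow> complex) \<Rightarrow> nat \<Rightarrow> nat \<Rightarrow> complex" where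
  "f_form x j k = (\<Sum>i\<in>I. x i * of_real (f i j k))"

lemma f_form_anti: "j \<in> I \<Longrightarrow> k \<in> I \<Longrightarrow> f_form x j k = - f_form x k j"
  unfolding f_form_def sum_negf[symmetric]
proof (intro sum.cong refl)
  fix i assume "i \<in> I" "j \<in> I" "k \<in> I"
  then have "f i j k = f j k i" "f j k i = - f k j i" "f k j i = f i k j"
    by (blast intro: f_cyclic f_anti f_cyclic[symmetric])+
  then have "f i j k = - f i k j" by linarith
  then show "x i * of_real (f i j k) = - (x i * of_real (f i k j))" by (metis mult_minus_right of_real_minus)
qed

text \<open>The pairing is the adjoint action of Y = \<open>vec_mat x\<close>: contracted with X_k
  in its second index it gives [Y, X_j].\<close>

lemma tr_f_form:
  assumes j: "j \<in> I" and uv: "set u \<subseteq> C" "set v \<subseteq> C"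
  shows "(\<Sum>k\<in>I. f_form x j k * tr (u @ X k # v)) =
    tr (u @ vec_mat x # X j # v) - tr (u @ X j # vec_mat x # v)"
proof -
  have "(\<Sum>k\<in>I. f_form x j k * tr (u @ X k # v)) =
      (\<Sum>i\<in>I. x i * (\<Sum>k\<in>I. of_real (f i j k) * tr (u @ X k # v)))"
    unfolding f_form_def sum_distrib_right sum_distrib_left by (subst sum.swap) (simp add: mult.assoc)
  also have "\<dots> = (\<Sum>i\<in>I. x i * (tr (u @ X i # X j # v) - tr (u @ X j # X i # v)))"
  proof (intro sum.cong refl)
    fix i assume "i \<in> I"
    from tr_commutator[OF this assms]
    have "(\<Sum>k\<in>I. of_real (f i j k) * tr (u @ X k # v)) = tr (u @ X i # X j # v) - tr (u @ X j # X i # v)"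
      by simp
    then show "x i * (\<Sum>k\<in>I. of_real (f i j k) * tr (u @ X k # v)) =
        x i * (tr (u @ X i # X j # v) - tr (u @ X j # X i # v))" by (simp only:)
  qed
  also have "\<dots> = (\<Sum>i\<in>I. x i * tr (u @ X i # X j # v)) - (\<Sum>i\<in>I. x i * tr ((u @ [X j]) @ X i # v))"
    by (simp add: right_diff_distrib sum_subtractf)
  also have "\<dots> = tr (u @ vec_mat x # X j # v) - tr ((u @ [X j]) @ vec_mat x # v)"
    using assms by (subst (1 2) tr_vec_mat) auto
  finally show ?thesis by simp
qed

text \<open>The \<open>1/n\<close> terms of the Fierz identities cancel in both contractions, because \<open>f\<close> only sees
  commutators.\<close>

lemma contract_split:
  assumes "set u \<subseteq> C" "set v \<subseteq> C"
  shows "(\<Sum>j\<in>I. \<Sum>k\<in>I. f_form x j k * tr (u @ X j # v @ [X k])) =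
    1 / 2 * (tr v * tr (vec_mat x # u) - tr (v @ [vec_mat x]) * tr u)"
proof -
  let ?Y = "vec_mat x"
  have "(\<Sum>j\<in>I. \<Sum>k\<in>I. f_form x j k * tr (u @ X j # v @ [X k])) =
      (\<Sum>j\<in>I. tr (X j # (v @ [?Y]) @ X j # u) - tr (X j # v @ X j # (?Y # u)))"
  proof (intro sum.cong refl)
    fix j assume j: "j \<in> I"
    have "(\<Sum>k\<in>I. f_form x j k * tr ((u @ X j # v) @ X k # [])) =
        tr ((u @ X j # v) @ ?Y # X j # []) - tr ((u @ X j # v) @ X j # ?Y # [])"
      by (rule tr_f_form) (use j assms in auto)
    also have "tr ((u @ X j # v) @ ?Y # X j # []) = tr (X j # (v @ [?Y]) @ X j # u)"
      using word_trace_rotate[of u n "X j # v @ [?Y, X j]"] j assms by simp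
    also have "tr ((u @ X j # v) @ X j # ?Y # []) = tr (X j # v @ X j # (?Y # u))"
      using word_trace_rotate[of u n "X j # v @ [X j, ?Y]"] j assms by simp
    finally show "(\<Sum>k\<in>I. f_form x j k * tr (u @ X j # v @ [X k])) =
        tr (X j # (v @ [?Y]) @ X j # u) - tr (X j # v @ X j # (?Y # u))" by simp
  qed
  also have "\<dots> = - 1 / 2 * (tr (v @ [?Y]) * tr u - tr ((v @ [?Y]) @ u) / of_nat n)
      - (- 1 / 2 * (tr v * tr (?Y # u) - tr (v @ ?Y # u) / of_nat n))"
    unfolding sum_subtractf using assms by (subst (1 2) fierz_split) auto
  finally show ?thesis by (simp add: algebra_simps)
qed

lemma contract_merge:
  assumes "set u \<subseteq> C" "set v \<subseteq> C"
  shows "(\<Sum>j\<in>I. \<Sum>k\<in>I. f_form x j k * (tr (u @ [X j]) * tr (v @ [X k]))) =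
    1 / 2 * (tr (u @ vec_mat x # v) - tr (u @ v @ [vec_mat x]))"
proof -
  let ?Y = "vec_mat x"
  have "(\<Sum>j\<in>I. \<Sum>k\<in>I. f_form x j k * (tr (u @ [X j]) * tr (v @ [X k]))) =
      (\<Sum>j\<in>I. tr (X j # u) * tr (X j # v @ [?Y]) - tr (X j # u) * tr (X j # ?Y # v))"
  proof (intro sum.cong refl)
    fix j assume j: "j \<in> I"
    have e: "tr (u @ [X j]) = tr (X j # u)"
      using word_trace_rotate[of u n "[X j]"] j assms by simp
    have "(\<Sum>k\<in>I. f_form x j k * (tr (u @ [X j]) * tr (v @ [X k]))) =
        tr (X j # u) * (\<Sum>k\<in>I. f_form x j k * tr (v @ X k # []))"
      by (simp add: e sum_distrib_left mult_ac)
    also have "(\<Sum>k\<in>I. f_form x j k * tr (v @ X k # [])) = tr (v @ ?Y # X j # []) - tr (v @ X j # ?Y # [])"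
      by (rule tr_f_form) (use j assms in auto)
    also have "tr (v @ ?Y # X j # []) = tr (X j # v @ [?Y])"
      using word_trace_rotate[of "v @ [?Y]" n "[X j]"] j assms by simp
    also have "tr (v @ X j # ?Y # []) = tr (X j # ?Y # v)"
      using word_trace_rotate[of v n "[X j, ?Y]"] j assms by simp
    finally show "(\<Sum>k\<in>I. f_form x j k * (tr (u @ [X j]) * tr (v @ [X k]))) =
        tr (X j # u) * tr (X j # v @ [?Y]) - tr (X j # u) * tr (X j # ?Y # v)"
      by (simp add: algebra_simps)
  qed
  also have "\<dots> = - 1 / 2 * (tr (u @ v @ [?Y]) - tr u * tr (v @ [?Y]) / of_nat n)
      - (- 1 / 2 * (tr (u @ ?Y # v) - tr u * tr (?Y # v) / of_nat n))"
    unfolding sum_subtractf using assms by (subst (1 2) fierz_merge) auto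
  also have "tr (v @ [?Y]) = tr (?Y # v)"
    using word_trace_rotate[of v n "[?Y]"] assms by simp
  finally show ?thesis by (simp add: algebra_simps)
qed

end


section \<open>Symbolic evaluation of the Wick expansion\<close>

text \<open>A product of traced words in the matrices \<open>Y = x\<^sup>i X\<^sub>i\<close> and \<open>Z\<close> and in the generators \<open>X\<close> at
  the positions of an index list is encoded as a list of words; the letter \<open>P i\<close> stands for the
  generator with the \<open>i\<close>-th index.\<close>

datatype letter = Y | Z | P nat

definition cut_before :: "nat \<Rightarrow> letter list \<Rightarrow> letter list" where
  "cut_before b w = takeWhile (\<lambda>l. l \<noteq> P b) w"

definition cut_after :: "nat \<Rightarrow> letter list \<Rightarrow> letter list" where
  "cut_after b w = tl (dropWhile (\<lambda>l. l \<noteq> P b) w)"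

lemma cut_append: "P b \<in> set w \<Longrightarrow> cut_before b w @ P b # cut_after b w = w"
  unfolding cut_before_def cut_after_def
  by (induction w) auto

text \<open>By cyclicity, the word that contains \<open>P b\<close> may be rotated until
  \<open>P b\<close> is its last letter. That letter is dropped, and the rest of the word is
  returned together with the other words.\<close>

fun pick :: "nat \<Rightarrow> letter list list \<Rightarrow> letter list \<times> letter list list" where
  "pick b [] = ([], [])"
| "pick b (w # S) = (if P b \<in> set w then (cut_after b w @ cut_before b w, S)
     else let (v, R) = pick b S in (v, w # R))"

text \<open>The two branches are the right-hand sides of \<open>contract_split\<close> and
  \<open>contract_merge\<close> without their common factor 1/2, so that all coefficients are
  integers.\<close>

definition contractions :: "nat \<Rightarrow> nat \<Rightarrow> letter list list \<Rightarrow> (int \<times> letter list list) list" where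
  "contractions a b S = (let (v, R) = pick b S in
     if P a \<in> set v
     then [(1, cut_after a v # (Y # cut_before a v) # R), (- 1, (cut_after a v @ [Y]) # cut_before a v # R)]
     else let (u, R') = pick a R in [(1, (u @ Y # v) # R'), (- 1, (u @ v @ [Y]) # R')])"

text \<open>Contracting the position q with the last one removes both from the index list, and the
  positions after q move down by one.\<close>

definition close_gap :: "nat \<Rightarrow> nat \<Rightarrow> nat" where
  "close_gap q l = (if l < q then l else l - 1)"

fun relabel :: "nat \<Rightarrow> letter \<Rightarrow> letter" where
  "relabel q (P l) = P (close_gap q l)"
| "relabel q l = l"

text \<open>Mirrors \<open>wick_expansion\<close>: the last position 2k + 1 is paired with q, with
  sign (-1)^q. The factor 2(k + 1) of that theorem and the 1/2 of each contraction are omitted;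
  their product over all steps reappears as \<open>fact k\<close> in
  \<open>pair_contract_words_val\<close>.\<close>

fun wick_terms :: "nat \<Rightarrow> letter list list \<Rightarrow> (int \<times> letter list list) list" where
  "wick_terms 0 S = [(1, S)]"
| "wick_terms (Suc k) S = concat (map (\<lambda>q. concat (map (\<lambda>(c, S').
     map (\<lambda>(e, U). ((if even q then c * e else - (c * e)), U)) (wick_terms k (map (map (relabel q)) S')))
     (contractions q (2 * k + 1) S))) [0..<2 * k + 1])"

definition labels :: "letter list list \<Rightarrow> letter multiset" where
  "labels S = filter_mset (\<lambda>l. l \<noteq> Y) (mset (concat S))"

lemma labels_simps [simp]:
  "labels [] = {#}" "labels (w # S) = filter_mset (\<lambda>l. l \<noteq> Y) (mset w) + labels S"
  by (simp_all add: labels_def)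

text \<open>The invariant of the recursion: \<open>Z\<close> and each open position occur exactly
  once. When no positions are left, each word is a power of Y, except for one that also contains a
  single \<open>Z\<close>.\<close>

definition well_labelled :: "nat \<Rightarrow> letter list list \<Rightarrow> bool" where
  "well_labelled N S \<longleftrightarrow> labels S = add_mset Z (image_mset P (mset_set {..<N}))"

lemma pick_labels:
  "P b \<in> set (concat S) \<Longrightarrow> pick b S = (v, R) \<Longrightarrow>
    labels S = add_mset (P b) (filter_mset (\<lambda>l. l \<noteq> Y) (mset v) + labels R)"
proof (induction S arbitrary: v R)
  case (Cons w S)
  show ?case
  proof (cases "P b \<in> set w")
    case True
    have "mset w = mset (cut_before b w @ P b # cut_after b w)" using cut_append[OF True] by simp
    then show ?thesis using Cons.prems True by auto
  next
    case False
    then show ?thesis using Cons by (auto split: prod.splits)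
  qed
qed simp

lemma mem_labels: "l \<in># labels S \<longleftrightarrow> l \<in> set (concat S) \<and> l \<noteq> Y"
  by (auto simp: labels_def)

lemma well_labelled_mem:
  "well_labelled N S \<Longrightarrow> P i \<in> set (concat S) \<longleftrightarrow> i < N"
  using mem_labels[of "P i" S] by (auto simp: well_labelled_def)

lemma well_labelled_remove:
  assumes "well_labelled N S" "labels S = add_mset (P b) M"
  shows "b < N" "P b \<notin># M" "M = add_mset Z (image_mset P (mset_set ({..<N} - {b})))"
proof -
  have e: "add_mset (P b) M = add_mset Z (image_mset P (mset_set {..<N}))"
    using assms by (simp add: well_labelled_def)
  have "P b \<in># add_mset Z (image_mset P (mset_set {..<N}))" unfolding e[symmetric] by simp
  then show b: "b < N" by auto
  then have "mset_set {..<N} = add_mset b (mset_set ({..<N} - {b}))"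
    by (intro mset_set.remove) auto
  then show M: "M = add_mset Z (image_mset P (mset_set ({..<N} - {b})))"
    using e by (simp add: add_mset_commute)
  show "P b \<notin># M" unfolding M by auto
qed

lemma close_gap_image: "q \<le> N \<Longrightarrow> close_gap q ` ({..<Suc N} - {q}) = {..<N}"
proof (intro equalityI subsetI)
  fix l assume "q \<le> N" "l \<in> {..<N}"
  then show "l \<in> close_gap q ` ({..<Suc N} - {q})"
    by (intro image_eqI[of _ _ "if l < q then l else Suc l"]) (auto simp: close_gap_def)
qed (auto simp: close_gap_def)

lemma close_gap_inj: "inj_on (close_gap q) ({..<Suc N} - {q})"
  by (auto simp: inj_on_def close_gap_def split: if_splits)

lemma labels_relabel: "labels (map (map (relabel q)) S) = image_mset (relabel q) (labels S)"
proof -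
  have "relabel q l \<noteq> Y \<longleftrightarrow> l \<noteq> Y" for l by (cases l) auto
  then show ?thesis
    by (simp add: labels_def filter_mset_image_mset map_concat[symmetric] o_def)
qed

lemma well_labelled_relabel:
  assumes q: "q \<le> N" and l: "labels S = add_mset Z (image_mset P (mset_set ({..<Suc N} - {q})))"
  shows "well_labelled N (map (map (relabel q)) S)"
proof -
  have "image_mset (relabel q) (image_mset P A) = image_mset P (image_mset (close_gap q) A)" for A
    by (simp add: multiset.map_comp o_def)
  then show ?thesis
    unfolding well_labelled_def labels_relabel l
    by (simp add: image_mset_mset_set[OF close_gap_inj] close_gap_image[OF q])
qed

text \<open>Preservation of the invariant and evaluation as traces both depend on whether the two
  contracted letters share a word. The case rule serves both, and records which letters are left
  over.\<close>

lemma contractions_cases: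
  assumes S: "well_labelled (Suc (Suc N)) S" and q: "q \<le> N"
  obtains (split) u w R where
    "contractions q (Suc N) S = [(1, w # (Y # u) # R), (- 1, (w @ [Y]) # u # R)]"
    "pick (Suc N) S = (u @ P q # w, R)"
    "filter_mset (\<lambda>l. l \<noteq> Y) (mset (u @ w)) + labels R =
      add_mset Z (image_mset P (mset_set ({..<Suc N} - {q})))"
  | (merge) u v R R' where
    "contractions q (Suc N) S = [(1, (u @ Y # v) # R), (- 1, (u @ v @ [Y]) # R)]"
    "pick (Suc N) S = (v, R')" "pick q R' = (u, R)" "P q \<in> set (concat R')"
    "filter_mset (\<lambda>l. l \<noteq> Y) (mset (u @ v)) + labels R =
      add_mset Z (image_mset P (mset_set ({..<Suc N} - {q})))"
proof -
  obtain v R where vR: "pick (Suc N) S = (v, R)" by fastforce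
  have "P (Suc N) \<in> set (concat S)" using well_labelled_mem[OF S] by simp
  from pick_labels[OF this vR]
  have l1: "labels S = add_mset (P (Suc N)) (filter_mset (\<lambda>l. l \<noteq> Y) (mset v) + labels R)" .
  have "{..<Suc (Suc N)} - {Suc N} = {..<Suc N}" by auto
  then have M: "filter_mset (\<lambda>l. l \<noteq> Y) (mset v) + labels R = add_mset Z (image_mset P (mset_set {..<Suc N}))"
    using well_labelled_remove(3)[OF S l1] by simp
  have rem: "mset_set {..<Suc N} = add_mset q (mset_set ({..<Suc N} - {q}))"
    by (rule mset_set.remove) (use q in auto)
  show thesis
  proof (cases "P q \<in> set v")
    case True
    have v: "v = cut_before q v @ P q # cut_after q v" using cut_append[OF True] by simp
    show thesis
    proof (rule split[of "cut_after q v" "cut_before q v" R])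
      show "contractions q (Suc N) S =
          [(1, cut_after q v # (Y # cut_before q v) # R), (- 1, (cut_after q v @ [Y]) # cut_before q v # R)]"
        using True by (simp add: contractions_def vR)
      show "pick (Suc N) S = (cut_before q v @ P q # cut_after q v, R)" using v vR by simp
      have "filter_mset (\<lambda>l. l \<noteq> Y) (mset v) =
          add_mset (P q) (filter_mset (\<lambda>l. l \<noteq> Y) (mset (cut_before q v @ cut_after q v)))"
        by (subst v) simp
      then show "filter_mset (\<lambda>l. l \<noteq> Y) (mset (cut_before q v @ cut_after q v)) + labels R =
          add_mset Z (image_mset P (mset_set ({..<Suc N} - {q})))"
        using M unfolding rem by (simp add: add_mset_commute add.assoc)
    qed
  next
    case False
    obtain u R' where uR: "pick q R = (u, R')" by fastforce
    have "P q \<in># filter_mset (\<lambda>l. l \<noteq> Y) (mset v) + labels R" unfolding M using q by auto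
    then have mem: "P q \<in> set (concat R)" using False by (auto simp: mem_labels)
    show thesis
    proof (rule merge[OF _ vR uR mem])
      show "contractions q (Suc N) S = [(1, (u @ Y # v) # R'), (- 1, (u @ v @ [Y]) # R')]"
        using False by (simp add: contractions_def vR uR)
      show "filter_mset (\<lambda>l. l \<noteq> Y) (mset (u @ v)) + labels R' =
          add_mset Z (image_mset P (mset_set ({..<Suc N} - {q})))"
        using M pick_labels[OF mem uR] unfolding rem by (simp add: add_mset_commute ac_simps)
    qed
  qed
qed

lemma contractions_well_labelled:
  assumes S: "well_labelled (Suc (Suc N)) S" and q: "q \<le> N"
    and cS: "(c, S') \<in> set (contractions q (Suc N) S)"
  shows "well_labelled N (map (map (relabel q)) S')"
proof (rule well_labelled_relabel[OF q])
  from S q show "labels S' = add_mset Z (image_mset P (mset_set ({..<Suc N} - {q})))"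
    by (cases rule: contractions_cases) (use cS in \<open>auto simp: ac_simps\<close>)
qed

lemma wick_terms_well_labelled:
  "well_labelled (2 * k) S \<Longrightarrow> (c, U) \<in> set (wick_terms k S) \<Longrightarrow> well_labelled 0 U"
proof (induction k arbitrary: S c)
  case (Suc k)
  from Suc.prems(2) obtain q c' S' e where q: "q < 2 * k + 1"
    and cS: "(c', S') \<in> set (contractions q (Suc (2 * k)) S)"
    and e: "(e, U) \<in> set (wick_terms k (map (map (relabel q)) S'))"
    by (auto simp del: upt_Suc)
  have "well_labelled (2 * k) (map (map (relabel q)) S')"
    by (rule contractions_well_labelled[OF _ _ cS]) (use Suc.prems q in auto)
  from Suc.IH[OF this e] show ?case .
qed simp

text \<open>The code of a word without \<open>P\<close> is \<open>2k\<close> if its trace is \<open>Tr Y\<^sup>k\<close> and \<open>2k + 1\<close> if its trace is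
  \<open>Tr (Y\<^sup>k Z)\<close>.\<close>

definition word_code :: "letter list \<Rightarrow> nat" where
  "word_code w = (if Z \<in> set w then 2 * (length w - 1) + 1 else 2 * length w)"

fun add_term :: "nat list \<Rightarrow> int \<Rightarrow> (nat list \<times> int) list \<Rightarrow> (nat list \<times> int) list" where
  "add_term k c [] = [(k, c)]"
| "add_term k c ((k', c') # ts) = (if k = k' then (k', c + c') # ts else (k', c') # add_term k c ts)"

text \<open>The codes 2 and 1 belong to \<open>Tr Y\<close> and \<open>Tr Z\<close>, which vanish.\<close>

definition collect_term :: "int \<times> letter list list \<Rightarrow> (nat list \<times> int) list \<Rightarrow> (nat list \<times> int) list" where
  "collect_term cU ts = (let k = map word_code (snd cU) in
     if 2 \<in> set k \<or> 1 \<in> set k then ts else add_term (sort k) (fst cU) ts)"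

definition collect_terms :: "(int \<times> letter list list) list \<Rightarrow> (nat list \<times> int) list" where
  "collect_terms L = filter (\<lambda>t. snd t \<noteq> 0) (foldr collect_term L [])"

text \<open>Encodes Tr (X_(j_1) ... X_(j_2k) X_z), the single trace to which the cocycle reduces;
  the letter \<open>Z\<close> is the uncontracted last index.\<close>

definition cyclic_word :: "nat \<Rightarrow> letter list list" where
  "cyclic_word k = [map P [0..<2 * k] @ [Z]]"

lemma well_labelled_cyclic_word: "well_labelled N [map P [0..<N] @ [Z]]"
  by (simp add: well_labelled_def filter_mset_image_mset lessThan_atLeast0)


section \<open>Interpretation of the words as traces\<close>

context su_gens
begin

definition letter_mat :: "(nat \<Rightarrow> complex) \<Rightarrow> complex mat \<Rightarrow> nat list \<Rightarrow> letter \<Rightarrow> complex mat" where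
  "letter_mat x Zm js l = (case l of Y \<Rightarrow> vec_mat x | Z \<Rightarrow> Zm | P i \<Rightarrow> X (js ! i))"

definition words_val :: "(nat \<Rightarrow> complex) \<Rightarrow> complex mat \<Rightarrow> nat list \<Rightarrow> letter list list \<Rightarrow> complex" where
  "words_val x Zm js S = prod_list (map (\<lambda>w. tr (map (letter_mat x Zm js) w)) S)"

lemma words_val_simps [simp]:
  "words_val x Zm js [] = 1"
  "words_val x Zm js (w # S) = tr (map (letter_mat x Zm js) w) * words_val x Zm js S"
  by (simp_all add: words_val_def)

lemma words_val_pick:
  assumes "P b \<in> set (concat S)" "pick b S = (v, R)"
    and "\<And>l. l \<in> set (concat S) \<Longrightarrow> letter_mat x Zm js l \<in> C"
  shows "words_val x Zm js S = tr (map (letter_mat x Zm js) (v @ [P b])) * words_val x Zm js R"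
  using assms
proof (induction S arbitrary: v R)
  case (Cons w S)
  let ?m = "letter_mat x Zm js"
  show ?case
  proof (cases "P b \<in> set w")
    case True
    have v: "v = cut_after b w @ cut_before b w" "R = S" using Cons.prems True by auto
    have w: "w = cut_before b w @ P b # cut_after b w" using cut_append[OF True] by simp
    have C: "?m ` set w \<subseteq> C" using Cons.prems(3) by auto
    then have "?m ` set (cut_before b w @ [P b]) \<subseteq> C" "?m ` set (cut_after b w) \<subseteq> C"
      by (subst (asm) w, auto)+
    then have "tr (map ?m ((cut_before b w @ [P b]) @ cut_after b w)) =
        tr (map ?m (cut_after b w @ (cut_before b w @ [P b])))"
      unfolding map_append by (intro word_trace_rotate) simp_all
    then show ?thesis using w v by simp
  next
    case False
    then obtain v' R' where "pick b S = (v', R')" "v = v'" "R = w # R'"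
      using Cons.prems(2) by (auto split: prod.splits)
    then show ?thesis using Cons.IH[of v' R'] Cons.prems False by (simp add: ac_simps)
  qed
qed simp

lemma words_val_cong:
  "(\<And>l. l \<in> set (concat S) \<Longrightarrow> letter_mat x Zm js l = letter_mat x Zm js' (g l)) \<Longrightarrow>
    words_val x Zm js S = words_val x Zm js' (map (map g) S)"
  by (induction S) (auto intro!: arg_cong2[of _ _ _ _ "(*)"] arg_cong[of _ _ tr])

text \<open>One step of the expansion: the symbolic rules of \<open>contractions\<close> are matched
  with the contraction identities for traces, the words not containing the two letters being carried
  along as a common factor.\<close>

lemma words_val_contractions:
  assumes S: "well_labelled (Suc (Suc N)) S" and q: "q \<le> N" and ks: "ks \<in> multi_idx n N" and Zm: "Zm \<in> C"
  shows "(\<Sum>i\<in>I. \<Sum>j\<in>I. f_form x i j * words_val x Zm (take q ks @ i # drop q ks @ [j]) S) =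
    1 / 2 * (\<Sum>(c, S')\<leftarrow>contractions q (Suc N) S. of_int c * words_val x Zm ks (map (map (relabel q)) S'))"
proof -
  let ?js = "\<lambda>i j. take q ks @ i # drop q ks @ [j]"
  let ?m = "\<lambda>i j. letter_mat x Zm (?js i j)" and ?m' = "\<lambda>l. letter_mat x Zm ks (relabel q l)"
  have len: "length ks = N" using ks by (rule length_multi_idx)
  have mq: "?m i j (P q) = X i" and mN: "?m i j (P (Suc N)) = X j" for i j
    using q len by (simp_all add: letter_mat_def nth_append)
  \<comment> \<open>Away from the two contracted positions, a letter read in the long index list and
    its relabelled form read in \<open>ks\<close> denote the same matrix.\<close>
  have other: "?m i j l = ?m' l" if "l \<noteq> Y \<Longrightarrow> l \<in># add_mset Z (image_mset P (mset_set ({..<Suc N} - {q})))" for i j l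
  proof (cases l)
    case (P a)
    then have "a < Suc N" "a \<noteq> q" using that by auto
    then show ?thesis using P q len
      by (auto simp: letter_mat_def close_gap_def nth_append nth_Cons min_def split: nat.split intro!: arg_cong[of _ _ X] arg_cong[of _ _ "(!) ks"])
  qed (simp_all add: letter_mat_def)
  have m'C: "?m' l \<in> C" if "l \<noteq> Y \<Longrightarrow> l \<in># add_mset Z (image_mset P (mset_set ({..<Suc N} - {q})))" for l
  proof (cases l)
    case (P a)
    then have "a < Suc N" "a \<noteq> q" using that by auto
    then show ?thesis using P q nth_multi_idx[OF ks, of a] nth_multi_idx[OF ks, of "a - 1"]
      by (auto simp: letter_mat_def close_gap_def)
  qed (use Zm in \<open>simp_all add: letter_mat_def\<close>)
  have mC: "?m i j l \<in> C" if "i \<in> I" "j \<in> I" "l \<in> set (concat S)" for i j l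
  proof (cases "l = P q \<or> l = P (Suc N)")
    case True
    then show ?thesis using mq mN that by auto
  next
    case False
    have "?m i j l = ?m' l \<and> ?m' l \<in> C"
    proof (rule conjI; rule other m'C)
      assume "l \<noteq> Y"
      then have "l \<in># labels S" using that by (simp add: mem_labels)
      then show "l \<in># add_mset Z (image_mset P (mset_set ({..<Suc N} - {q})))"
        "l \<in># add_mset Z (image_mset P (mset_set ({..<Suc N} - {q})))"
        using S False by (auto simp: well_labelled_def less_Suc_eq)
    qed
    then show ?thesis by simp
  qed
  have memN: "P (Suc N) \<in> set (concat S)" using well_labelled_mem[OF S] by simp
  from S q show ?thesis
  proof (cases rule: contractions_cases)
    case (split u w R)
    have mem: "l \<noteq> Y \<Longrightarrow> l \<in># add_mset Z (image_mset P (mset_set ({..<Suc N} - {q})))"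
      if "l \<in> set u \<union> set w \<union> set (concat R)" for l
      using that unfolding split(3)[symmetric] by (auto simp: mem_labels)
    let ?U = "map ?m' u" and ?W = "map ?m' w" and ?r = "words_val x Zm ks (map (map (relabel q)) R)"
    have C: "set ?U \<subseteq> C" "set ?W \<subseteq> C" using m'C mem by auto
    have val: "words_val x Zm (?js i j) S = ?r * tr (?U @ X i # ?W @ [X j])" if "i \<in> I" "j \<in> I" for i j
    proof -
      have "words_val x Zm (?js i j) S =
          tr (map (?m i j) ((u @ P q # w) @ [P (Suc N)])) * words_val x Zm (?js i j) R"
        by (rule words_val_pick[OF memN split(2)]) (rule mC[OF that])
      also have "map (?m i j) ((u @ P q # w) @ [P (Suc N)]) = ?U @ X i # ?W @ [X j]"
        using mem by (simp add: mq mN) (intro conjI ballI other; simp)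
      also have "words_val x Zm (?js i j) R = ?r"
        by (rule words_val_cong, rule other, rule mem) auto
      finally show ?thesis by (simp add: mult.commute)
    qed
    have "(\<Sum>i\<in>I. \<Sum>j\<in>I. f_form x i j * words_val x Zm (?js i j) S) =
        ?r * (\<Sum>i\<in>I. \<Sum>j\<in>I. f_form x i j * tr (?U @ X i # ?W @ [X j]))"
      unfolding sum_distrib_left by (intro sum.cong refl) (simp add: val)
    also have "\<dots> = ?r * (1 / 2 * (tr ?W * tr (vec_mat x # ?U) - tr (?W @ [vec_mat x]) * tr ?U))"
      by (simp only: contract_split[OF C])
    also have "\<dots> = 1 / 2 * (\<Sum>(c, S')\<leftarrow>contractions q (Suc N) S. of_int c * words_val x Zm ks (map (map (relabel q)) S'))"
      unfolding split(1) by (simp add: letter_mat_def[of _ _ _ Y] o_def algebra_simps)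
    finally show ?thesis .
  next
    case (merge u v R R')
    have mem: "l \<noteq> Y \<Longrightarrow> l \<in># add_mset Z (image_mset P (mset_set ({..<Suc N} - {q})))"
      if "l \<in> set u \<union> set v \<union> set (concat R)" for l
      using that unfolding merge(5)[symmetric] by (auto simp: mem_labels)
    let ?U = "map ?m' u" and ?V = "map ?m' v" and ?r = "words_val x Zm ks (map (map (relabel q)) R)"
    have C: "set ?U \<subseteq> C" "set ?V \<subseteq> C" using m'C mem by auto
    have R'C: "?m i j l \<in> C" if "i \<in> I" "j \<in> I" "l \<in> set (concat R')" for i j l
    proof (cases "l = Y")
      case False
      have "l \<in># labels R'" using that False by (simp add: mem_labels)
      then have "l \<in># labels S" using pick_labels[OF memN merge(2)] by simp
      then show ?thesis using mC that by (simp add: mem_labels)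
    qed (simp add: letter_mat_def)
    have val: "words_val x Zm (?js i j) S = ?r * (tr (?U @ [X i]) * tr (?V @ [X j]))" if "i \<in> I" "j \<in> I" for i j
    proof -
      have "words_val x Zm (?js i j) S =
          tr (map (?m i j) (v @ [P (Suc N)])) * words_val x Zm (?js i j) R'"
        by (rule words_val_pick[OF memN merge(2)]) (rule mC[OF that])
      also have "words_val x Zm (?js i j) R' = tr (map (?m i j) (u @ [P q])) * words_val x Zm (?js i j) R"
        by (rule words_val_pick[OF merge(4,3)]) (rule R'C[OF that])
      also have "map (?m i j) (u @ [P q]) = ?U @ [X i]"
        using mem by (simp add: mq) (intro ballI other; simp)
      also have "map (?m i j) (v @ [P (Suc N)]) = ?V @ [X j]"
        using mem by (simp add: mN) (intro ballI other; simp)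
      also have "words_val x Zm (?js i j) R = ?r"
        by (rule words_val_cong, rule other, rule mem) auto
      finally show ?thesis by (simp add: ac_simps)
    qed
    have "(\<Sum>i\<in>I. \<Sum>j\<in>I. f_form x i j * words_val x Zm (?js i j) S) =
        ?r * (\<Sum>i\<in>I. \<Sum>j\<in>I. f_form x i j * (tr (?U @ [X i]) * tr (?V @ [X j])))"
      unfolding sum_distrib_left by (intro sum.cong refl) (simp add: val)
    also have "\<dots> = ?r * (1 / 2 * (tr (?U @ vec_mat x # ?V) - tr (?U @ ?V @ [vec_mat x])))"
      by (simp only: contract_merge[OF C])
    also have "\<dots> = 1 / 2 * (\<Sum>(c, S')\<leftarrow>contractions q (Suc N) S. of_int c * words_val x Zm ks (map (map (relabel q)) S'))"
      unfolding merge(1) by (simp add: letter_mat_def[of _ _ _ Y] o_def algebra_simps)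
    finally show ?thesis .
  qed
qed

lemma pair_contract_cong:
  "(\<And>ks. ks \<in> multi_idx n (2 * k) \<Longrightarrow> G ks = H ks) \<Longrightarrow> pair_contract n \<phi> k G = pair_contract n \<phi> k H"
  unfolding pair_contract_def alt_sum_def
  by (intro sum.cong arg_cong2[of _ _ _ _ "(*)"] refl) (auto simp: length_multi_idx permute_list_in_multi_idx)

lemma pair_contract_zero: "pair_contract n \<phi> k (\<lambda>ks. 0) = 0"
  by (simp add: pair_contract_def alt_sum_def)

lemma pair_contract_add:
  "pair_contract n \<phi> k (\<lambda>ks. G ks + H ks) = pair_contract n \<phi> k G + pair_contract n \<phi> k H"
  by (simp add: pair_contract_def alt_sum_def distrib_left sum.distrib)

lemma pair_contract_mult:
  "pair_contract n \<phi> k (\<lambda>ks. c * G ks) = c * pair_contract n \<phi> k G"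
  by (simp add: pair_contract_def alt_sum_def sum_distrib_left mult_ac)

lemma pair_contract_sum_list:
  "pair_contract n \<phi> k (\<lambda>ks. \<Sum>(c, S)\<leftarrow>L. of_int c * G ks S) =
    (\<Sum>(c, S)\<leftarrow>L. of_int c * pair_contract n \<phi> k (\<lambda>ks. G ks S))"
  by (induction L) (auto simp: pair_contract_zero pair_contract_add pair_contract_mult)

text \<open>A step from k + 1 pairings to k multiplies by 2(k + 1) from
  \<open>wick_expansion\<close> and by 1/2 from the contraction; over all steps this accumulates to
  \<open>fact k\<close>.\<close>

lemma pair_contract_words_val:
  assumes Zm: "Zm \<in> C"
  shows "well_labelled (2 * k) S \<Longrightarrow> pair_contract n (f_form x) k (\<lambda>js. words_val x Zm js S) =
    fact k * (\<Sum>(c, U)\<leftarrow>wick_terms k S. of_int c * words_val x Zm [] U)"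
proof (induction k arbitrary: S)
  case 0
  show ?case by (simp add: pair_contract_def pair_prod_def alt_sum_def)
next
  case (Suc k)
  let ?pc = "\<lambda>S. pair_contract n (f_form x) k (\<lambda>js. words_val x Zm js S)"
  let ?L = "\<lambda>q. contractions q (Suc (2 * k)) S"
  let ?rel = "\<lambda>q. map (map (relabel q))"
  let ?s = "\<lambda>L. \<Sum>(c, U)\<leftarrow>L. of_int c * words_val x Zm [] U"
  have "pair_contract n (f_form x) (Suc k) (\<lambda>js. words_val x Zm js S) =
      of_nat (2 * Suc k) * (\<Sum>q\<le>2 * k. (-1) ^ q * pair_contract n (f_form x) k
        (\<lambda>ks. \<Sum>i\<in>I. \<Sum>j\<in>I. f_form x i j * words_val x Zm (take q ks @ i # drop q ks @ [j]) S))"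
    by (rule wick_expansion) (rule f_form_anti)
  also have "\<dots> = of_nat (2 * Suc k) * (\<Sum>q\<le>2 * k. (-1) ^ q *
      (1 / 2 * (\<Sum>(c, S')\<leftarrow>?L q. of_int c * ?pc (?rel q S'))))"
  proof (intro arg_cong2[of _ _ _ _ "(*)"] sum.cong refl)
    fix q assume "q \<in> {..2 * k}"
    then have q: "q \<le> 2 * k" by simp
    have "pair_contract n (f_form x) k
        (\<lambda>ks. \<Sum>i\<in>I. \<Sum>j\<in>I. f_form x i j * words_val x Zm (take q ks @ i # drop q ks @ [j]) S) =
      pair_contract n (f_form x) k (\<lambda>ks. 1 / 2 * (\<Sum>(c, S')\<leftarrow>?L q. of_int c * words_val x Zm ks (?rel q S')))"
      by (intro pair_contract_cong words_val_contractions q Zm) (use Suc.prems in simp_all)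
    then show "pair_contract n (f_form x) k
        (\<lambda>ks. \<Sum>i\<in>I. \<Sum>j\<in>I. f_form x i j * words_val x Zm (take q ks @ i # drop q ks @ [j]) S) =
        1 / 2 * (\<Sum>(c, S')\<leftarrow>?L q. of_int c * ?pc (?rel q S'))"
      by (simp only: pair_contract_mult pair_contract_sum_list)
  qed
  also have "\<dots> = of_nat (Suc k) * (\<Sum>q\<le>2 * k. (-1) ^ q * (\<Sum>(c, S')\<leftarrow>?L q. of_int c * ?pc (?rel q S')))"
  proof -
    have "of_nat (2 * m) * (s * (1 / 2 * A)) = of_nat m * (s * A)" for m and s A :: complex
      by simp
    then show ?thesis by (simp only: sum_distrib_left)
  qed
  also have "\<dots> = of_nat (Suc k) * (\<Sum>q\<le>2 * k. (-1) ^ q *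
      (\<Sum>(c, S')\<leftarrow>?L q. of_int c * (fact k * ?s (wick_terms k (?rel q S')))))"
  proof (intro arg_cong2[of _ _ _ _ "(*)"] sum.cong refl arg_cong[of _ _ sum_list] map_cong)
    fix q cS assume q: "q \<in> {..2 * k}" and cS: "cS \<in> set (?L q)"
    obtain c S' where cS': "cS = (c, S')" by fastforce
    have "well_labelled (2 * k) (?rel q S')"
      by (rule contractions_well_labelled) (use Suc.prems q cS cS' in auto)
    then show "(case cS of (c, S') \<Rightarrow> of_int c * ?pc (?rel q S')) =
        (case cS of (c, S') \<Rightarrow> of_int c * (fact k * ?s (wick_terms k (?rel q S'))))"
      by (simp add: cS' Suc.IH)
  qed
  also have "\<dots> = fact (Suc k) * (\<Sum>q\<le>2 * k. (-1) ^ q *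
      (\<Sum>(c, S')\<leftarrow>?L q. of_int c * ?s (wick_terms k (?rel q S'))))"
    by (simp add: sum_distrib_left sum_list_const_mult[symmetric] case_prod_unfold mult_ac)
  also have "(\<Sum>q\<le>2 * k. (-1) ^ q * (\<Sum>(c, S')\<leftarrow>?L q. of_int c * ?s (wick_terms k (?rel q S')))) =
      ?s (wick_terms (Suc k) S)"
  proof -
    have sc: "?s (concat Ls) = (\<Sum>L\<leftarrow>Ls. ?s L)" for Ls by (induction Ls) auto
    have sm: "?s (map (\<lambda>(e, U). ((if even q then c * e else - (c * e)), U)) L) = (-1) ^ q * (of_int c * ?s L)"
      for q :: nat and c L
      by (induction L) (auto simp: algebra_simps)
    have scm: "?s (concat (map (\<lambda>(c, S'). map (\<lambda>(e, U). ((if even q then c * e else - (c * e)), U))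
        (wick_terms k (?rel q S'))) L)) =
      (-1) ^ q * (\<Sum>(c, S')\<leftarrow>L. of_int c * ?s (wick_terms k (?rel q S')))" for q L
      by (induction L) (auto simp only: list.map concat.simps sum_list.Cons sum_list.Nil map_append
          sum_list_append sm distrib_left mult_zero_right prod.case)
    have "?s (wick_terms (Suc k) S) = (\<Sum>q\<leftarrow>[0..<2 * k + 1]. (-1) ^ q *
        (\<Sum>(c, S')\<leftarrow>?L q. of_int c * ?s (wick_terms k (?rel q S'))))"
      by (simp only: wick_terms.simps, subst sc, simp only: map_map o_def scm, simp only: Suc_eq_plus1)
    also have "\<dots> = (\<Sum>q\<in>set [0..<2 * k + 1]. (-1) ^ q *
        (\<Sum>(c, S')\<leftarrow>?L q. of_int c * ?s (wick_terms k (?rel q S'))))"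
      by (rule sum_list_distinct_conv_sum_set) simp
    also have "set [0..<2 * k + 1] = {..2 * k}" by auto
    finally show ?thesis by simp
  qed
  finally show ?case .
qed

definition pow_trace :: "(nat \<Rightarrow> complex) \<Rightarrow> nat \<Rightarrow> complex" where
  "pow_trace x k = tr (replicate k (vec_mat x))"

definition pow_trace_with :: "(nat \<Rightarrow> complex) \<Rightarrow> complex mat \<Rightarrow> nat \<Rightarrow> complex" where
  "pow_trace_with x Zm k = tr (replicate k (vec_mat x) @ [Zm])"

definition code_val :: "(nat \<Rightarrow> complex) \<Rightarrow> complex mat \<Rightarrow> nat \<Rightarrow> complex" where
  "code_val x Zm c = (if even c then pow_trace x (c div 2) else pow_trace_with x Zm (c div 2))"

lemma letter_mat_all_Y:
  "set u \<subseteq> {Y} \<Longrightarrow> map (letter_mat x Zm js) u = replicate (length u) (vec_mat x)"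
  by (induction u) (auto simp: letter_mat_def)

text \<open>Under the assumption the word is a power of Y or of the form Y^a Z Y^b, and in the
  latter case rotation brings \<open>Z\<close> to the end.\<close>

lemma tr_word_code:
  assumes Zm: "Zm \<in> C" and w: "filter_mset (\<lambda>l. l \<noteq> Y) (mset w) \<subseteq># {#Z#}"
  shows "tr (map (letter_mat x Zm js) w) = code_val x Zm (word_code w)"
proof (cases "Z \<in> set w")
  case True
  then obtain u v where uv: "w = u @ Z # v" by (meson split_list)
  have "filter_mset (\<lambda>l. l \<noteq> Y) (mset (u @ v)) = {#}" using w by (simp add: uv)
  then have Y: "set u \<subseteq> {Y}" "set v \<subseteq> {Y}" by (auto dest!: arg_cong[of _ _ set_mset])
  have "tr (map (letter_mat x Zm js) w) = tr ((replicate (length u) (vec_mat x) @ [Zm]) @ replicate (length v) (vec_mat x))"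
    by (simp add: uv letter_mat_all_Y[OF Y(1)] letter_mat_all_Y[OF Y(2)]) (simp add: letter_mat_def)
  also have "\<dots> = tr (replicate (length v) (vec_mat x) @ replicate (length u) (vec_mat x) @ [Zm])"
    by (rule word_trace_rotate) (use Zm in auto)
  also have "\<dots> = pow_trace_with x Zm (length v + length u)"
    by (simp add: pow_trace_with_def replicate_add)
  finally show ?thesis using True by (simp add: code_val_def word_code_def uv add.commute)
next
  case False
  have "filter_mset (\<lambda>l. l \<noteq> Y) (mset w) = {#}"
  proof (rule ccontr)
    assume "\<not> ?thesis"
    then obtain l where l: "l \<in># filter_mset (\<lambda>l. l \<noteq> Y) (mset w)" by blast
    then have "l = Z" using mset_subset_eqD[OF w l] by simp
    then show False using l False by simp
  qed
  then have "set w \<subseteq> {Y}" by (auto dest!: arg_cong[of _ _ set_mset])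
  then have "map (letter_mat x Zm js) w = replicate (length w) (vec_mat x)"
    by (rule letter_mat_all_Y)
  then show ?thesis using False by (simp add: code_val_def word_code_def pow_trace_def)
qed

lemma words_val_code:
  assumes Zm: "Zm \<in> C" and U: "well_labelled 0 U"
  shows "words_val x Zm js U = prod_list (map (code_val x Zm) (map word_code U))"
proof -
  have "labels U \<subseteq># {#Z#}" using U by (simp add: well_labelled_def)
  then show ?thesis
  proof (induction U)
    case (Cons w U)
    then have "filter_mset (\<lambda>l. l \<noteq> Y) (mset w) \<subseteq># {#Z#}" "labels U \<subseteq># {#Z#}"
      by (auto intro: subset_mset.order_trans[OF mset_subset_eq_add_left] subset_mset.order_trans[OF mset_subset_eq_add_right])
    then show ?case using Cons.IH by (simp add: tr_word_code[OF Zm])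
  qed simp
qed

abbreviation terms_val :: "(nat \<Rightarrow> complex) \<Rightarrow> complex mat \<Rightarrow> (nat list \<times> int) list \<Rightarrow> complex" where
  "terms_val x Zm ts \<equiv> (\<Sum>(k, c)\<leftarrow>ts. of_int c * prod_list (map (code_val x Zm) k))"

lemma terms_val_add_term:
  "terms_val x Zm (add_term k c ts) = of_int c * prod_list (map (code_val x Zm) k) + terms_val x Zm ts"
  by (induction k c ts rule: add_term.induct) (auto simp: algebra_simps)

lemma prod_list_sort: "prod_list (map (g :: nat \<Rightarrow> complex) (sort k)) = prod_list (map g k)"
  by (metis mset_map mset_sort prod_mset_prod_list)

lemma terms_val_collect_terms:
  assumes Zm: "Zm \<in> C" "tr [Zm] = 0" and L: "\<And>c U. (c, U) \<in> set L \<Longrightarrow> well_labelled 0 U"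
  shows "(\<Sum>(c, U)\<leftarrow>L. of_int c * words_val x Zm [] U) = terms_val x Zm (collect_terms L)"
proof -
  have z: "code_val x Zm 2 = 0" "code_val x Zm 1 = 0"
    using Zm tr_vec_mat_single by (simp_all add: code_val_def pow_trace_def pow_trace_with_def)
  have "(\<Sum>(c, U)\<leftarrow>L. of_int c * words_val x Zm [] U) = terms_val x Zm (foldr collect_term L [])"
    using L
  proof (induction L)
    case (Cons cU L)
    obtain c U where cU: "cU = (c, U)" by fastforce
    let ?k = "map word_code U"
    have U: "words_val x Zm [] U = prod_list (map (code_val x Zm) ?k)"
      by (rule words_val_code[OF Zm(1)]) (use Cons.prems cU in auto)
    have IH: "(\<Sum>(c, U)\<leftarrow>L. of_int c * words_val x Zm [] U) = terms_val x Zm (foldr collect_term L [])"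
      by (rule Cons.IH) (use Cons.prems in auto)
    show ?case
    proof (cases "2 \<in> set ?k \<or> 1 \<in> set ?k")
      case True
      then have "0 \<in> set (map (code_val x Zm) ?k)" using z by (metis image_eqI list.set_map)
      then have "words_val x Zm [] U = 0" unfolding U by (simp only: prod_list_zero_iff)
      then show ?thesis using True IH by (simp add: cU collect_term_def[of "(c, U)"] Let_def del: set_map)
    next
      case False
      then show ?thesis using IH
        by (simp add: cU collect_term_def[of "(c, U)"] Let_def terms_val_add_term prod_list_sort U del: set_map map_map)
    qed
  qed simp
  also have "\<dots> = terms_val x Zm (filter (\<lambda>t. snd t \<noteq> 0) ts)" if "ts = foldr collect_term L []" for ts
    unfolding that[symmetric] by (induction ts) auto
  finally show ?thesis by (simp add: collect_terms_def)
qed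

theorem pair_contract_cyclic_word:
  assumes z: "z \<in> I"
  shows "pair_contract n (f_form x) k (\<lambda>js. tr (map X (js @ [z]))) =
    fact k * terms_val x (X z) (collect_terms (wick_terms k (cyclic_word k)))"
proof -
  have wl: "well_labelled (2 * k) (cyclic_word k)"
    unfolding cyclic_word_def by (rule well_labelled_cyclic_word)
  have "pair_contract n (f_form x) k (\<lambda>js. tr (map X (js @ [z]))) =
      pair_contract n (f_form x) k (\<lambda>js. words_val x (X z) js (cyclic_word k))"
  proof (rule pair_contract_cong)
    fix js assume "js \<in> multi_idx n (2 * k)"
    then have "map (letter_mat x (X z) js) (map P [0..<2 * k]) = map X js"
      by (intro nth_equalityI) (auto simp: length_multi_idx letter_mat_def)
    then show "tr (map X (js @ [z])) = words_val x (X z) js (cyclic_word k)"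
      by (simp add: cyclic_word_def letter_mat_def[of _ _ _ Z])
  qed
  also have "\<dots> = fact k * (\<Sum>(c, U)\<leftarrow>wick_terms k (cyclic_word k). of_int c * words_val x (X z) [] U)"
    by (rule pair_contract_words_val[OF X_carrier[OF z] wl])
  also have "(\<Sum>(c, U)\<leftarrow>wick_terms k (cyclic_word k). of_int c * words_val x (X z) [] U) =
      terms_val x (X z) (collect_terms (wick_terms k (cyclic_word k)))"
    by (rule terms_val_collect_terms[OF X_carrier[OF z] tr_X[OF z]]) (rule wick_terms_well_labelled[OF wl])
  finally show ?thesis .
qed

end

section \<open>The collected terms for m = 2, ..., 5\<close>

text \<open>Code 0 stands for Tr 1 = n. With p_k = Tr Y^k and r_k = Tr (Y^k X_z) this term reads n
  r_1, and the next lemma gives n^2 r_2.\<close>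

lemma wick_terms_1: "collect_terms (wick_terms 1 (cyclic_word 1)) = [([0, 3], 1)]"
  by code_simp

lemma wick_terms_2: "collect_terms (wick_terms 2 (cyclic_word 2)) = [([0, 0, 5], 1)]"
  by code_simp

text \<open>In the same notation the sum is n (n^2 + 1) r_3 - (2 n^2 - 3) p_2 r_1, which already
  shows the coefficient of d^(4) in the formula for m = 4.\<close>

lemma wick_terms_3: "collect_terms (wick_terms 3 (cyclic_word 3)) =
    [([0, 0, 0, 7], 1), ([0, 7], 1), ([0, 0, 3, 4], - 2), ([3, 4], 3)]"
  by code_simp

text \<open>In the same notation the sum is n times n (n^2 + 5) r_4 - (3 n^2 - 6) p_2 r_2 - (2 n^2 -
  4) p_3 r_1.\<close>

lemma wick_terms_4: "collect_terms (wick_terms 4 (cyclic_word 4)) =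
    [([0, 0, 0, 0, 9], 1), ([0, 0, 9], 5), ([0, 0, 0, 4, 5], - 3), ([0, 3, 6], 4), ([0, 4, 5], 6),
     ([0, 0, 0, 3, 6], - 2)]"
  by code_simp


section \<open>Polarisation\<close>

definition sym_tensor :: "nat \<Rightarrow> nat \<Rightarrow> (nat list \<Rightarrow> complex) \<Rightarrow> bool" where
  "sym_tensor n k S \<longleftrightarrow> (\<forall>is js. is \<in> multi_idx n k \<longrightarrow> mset is = mset js \<longrightarrow> S is = S js)"

definition poly_form :: "nat \<Rightarrow> nat \<Rightarrow> (nat list \<Rightarrow> complex) \<Rightarrow> (nat \<Rightarrow> complex) \<Rightarrow> complex" where
  "poly_form n k S x = (\<Sum>is\<in>multi_idx n k. prod_list (map x is) * S is)"

lemma poly_form_0 [simp]: "poly_form n 0 S x = S []"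
  by (simp add: poly_form_def)

lemma poly_form_Suc:
  "poly_form n (Suc k) S x = (\<Sum>i\<in>su_idx n. x i * poly_form n k (\<lambda>is. S (i # is)) x)"
  by (simp add: poly_form_def sum_multi_idx_Suc sum_distrib_left mult.assoc)

lemma poly_form_cong:
  "(\<And>is. is \<in> multi_idx n k \<Longrightarrow> S is = S' is) \<Longrightarrow> poly_form n k S x = poly_form n k S' x"
  by (simp add: poly_form_def)

lemma Cons_in_multi_idx: "i # is \<in> multi_idx n (Suc k) \<longleftrightarrow> i \<in> su_idx n \<and> is \<in> multi_idx n k"
  by (auto simp: multi_idx_def)

lemma snoc_in_multi_idx: "is @ [i] \<in> multi_idx n (Suc k) \<longleftrightarrow> i \<in> su_idx n \<and> is \<in> multi_idx n k"
  by (auto simp: multi_idx_def)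

lemma sym_tensor_Cons:
  assumes "sym_tensor n (Suc k) S" "i \<in> su_idx n"
  shows "sym_tensor n k (\<lambda>is. S (i # is))"
  using assms by (auto simp: sym_tensor_def Cons_in_multi_idx)

lemma sym_tensor_snoc:
  assumes "sym_tensor n (Suc k) S" "i \<in> su_idx n"
  shows "sym_tensor n k (\<lambda>is. S (is @ [i]))"
  using assms by (auto simp: sym_tensor_def snoc_in_multi_idx)

text \<open>The product rule on the first slot: differentiating x_j there replaces it by the unit
  vector of i, and the remaining slots are handled by induction. Symmetry moves i to the front, so
  all k + 1 slots contribute equally.\<close>

lemma poly_form_derivative:
  assumes "sym_tensor n (Suc k) S" and i: "i \<in> su_idx n"
  shows "((\<lambda>s. poly_form n (Suc k) S (\<lambda>j. x j + s * kdelta j i)) has_field_derivative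
    of_nat (Suc k) * poly_form n k (\<lambda>is. S (i # is)) x) (at 0)"
  using assms(1)
proof (induction k arbitrary: S)
  case 0
  have "((\<lambda>s. \<Sum>j\<in>su_idx n. (x j + s * kdelta j i) * S [j]) has_field_derivative
      (\<Sum>j\<in>su_idx n. kdelta j i * S [j])) (at 0)"
    by (auto intro!: derivative_eq_intros)
  moreover have "(\<Sum>j\<in>su_idx n. kdelta j i * S [j]) = S [i]"
    using i by (simp add: kdelta_def if_distrib[of "\<lambda>x. x * _"] cong: if_cong)
  ultimately show ?case by (simp add: poly_form_Suc)
next
  case (Suc k)
  let ?y = "\<lambda>s j. x j + s * kdelta j i"
  let ?Q = "\<lambda>j s. poly_form n (Suc k) (\<lambda>is. S (j # is)) (?y s)"
  let ?Q' = "\<lambda>j. of_nat (Suc k) * poly_form n k (\<lambda>is. S (j # i # is)) x"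
  have IH: "(?Q j has_field_derivative ?Q' j) (at 0)" if "j \<in> su_idx n" for j
    by (rule Suc.IH) (rule sym_tensor_Cons[OF Suc.prems that])
  have "((\<lambda>s. \<Sum>j\<in>su_idx n. ?y s j * ?Q j s) has_field_derivative
      (\<Sum>j\<in>su_idx n. kdelta j i * ?Q j 0 + x j * ?Q' j)) (at 0)"
  proof (rule DERIV_sum)
    fix j assume j: "j \<in> su_idx n"
    have "((\<lambda>s. ?y s j) has_field_derivative kdelta j i) (at 0)"
      by (auto intro!: derivative_eq_intros)
    from DERIV_mult[OF this IH[OF j]]
    show "((\<lambda>s. ?y s j * ?Q j s) has_field_derivative kdelta j i * ?Q j 0 + x j * ?Q' j) (at 0)"
      by (simp add: mult.commute)
  qed
  also have "(\<Sum>j\<in>su_idx n. kdelta j i * ?Q j 0 + x j * ?Q' j) =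
      ?Q i 0 + of_nat (Suc k) * (\<Sum>j\<in>su_idx n. x j * poly_form n k (\<lambda>is. S (j # i # is)) x)"
    unfolding sum.distrib sum_distrib_left
    using i by (simp add: kdelta_def if_distrib[of "\<lambda>x. x * _"] mult.left_commute cong: if_cong)
  also have "(\<Sum>j\<in>su_idx n. x j * poly_form n k (\<lambda>is. S (j # i # is)) x) =
      poly_form n (Suc k) (\<lambda>is. S (i # is)) x"
    unfolding poly_form_Suc
  proof (intro sum.cong refl arg_cong2[of _ _ _ _ "(*)"] poly_form_cong)
    fix j "is" assume "j \<in> su_idx n" "is \<in> multi_idx n k"
    then show "S (j # i # is) = S (i # j # is)"
      using Suc.prems i by (auto simp: sym_tensor_def Cons_in_multi_idx)
  qed
  finally show ?case by (simp add: poly_form_Suc[of n "Suc k"] algebra_simps)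
qed

text \<open>If a form vanishes for all x, so does its derivative in direction i, which is a nonzero
  multiple of the form with the first index fixed to i. In this way the indices are stripped off one
  at a time.\<close>

theorem polarisation:
  assumes "sym_tensor n k S" and "\<And>x. poly_form n k S x = 0" and "is \<in> multi_idx n k"
  shows "S is = 0"
  using assms
proof (induction k arbitrary: S "is")
  case 0
  then show ?case by simp
next
  case (Suc k)
  then obtain i js where "is": "is = i # js" "i \<in> su_idx n" "js \<in> multi_idx n k"
    by (cases "is") (auto simp: multi_idx_def)
  have "poly_form n k (\<lambda>is. S (i # is)) x = 0" for x
  proof -
    have "((\<lambda>s. 0) has_field_derivative of_nat (Suc k) * poly_form n k (\<lambda>is. S (i # is)) x) (at (0::complex))"
      using poly_form_derivative[OF Suc.prems(1) "is"(2), of x] by (simp add: Suc.prems(2))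
    then have "of_nat (Suc k) * poly_form n k (\<lambda>is. S (i # is)) x = 0"
      using DERIV_const DERIV_unique by blast
    then show ?thesis by (simp only: mult_eq_0_iff of_nat_eq_0_iff) simp
  qed
  from Suc.IH[OF sym_tensor_Cons[OF Suc.prems(1) "is"(2)] this "is"(3)]
  show ?case by (simp add: "is"(1))
qed

lemma prod_list_nth: "prod_list (map x js) = (\<Prod>a<length js. x (js ! a) :: complex)"
  by (induction js rule: rev_induct) (simp_all add: nth_append)

lemma prod_list_permute:
  assumes "p permutes {..<length js}"
  shows "prod_list (map (x :: nat \<Rightarrow> complex) (permute_list p js)) = prod_list (map x js)"
  using mset_permute_list[OF assms] by (metis mset_map prod_mset_prod_list)

section \<open>Symmetrisation\<close>

lemma symmetrise_permute:
  assumes r: "r permutes {..<length is}"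
  shows "symmetrise F (permute_list r is) = symmetrise F is"
proof -
  have "(\<Sum>p | p permutes {..<length is}. F (permute_list p is)) =
      (\<Sum>p | p permutes {..<length is}. F (permute_list (r \<circ> p) is))"
    by (rule setum_permutations_compose_left[OF r])
  also have "\<dots> = (\<Sum>p | p permutes {..<length is}. F (permute_list p (permute_list r is)))"
    by (intro sum.cong refl) (simp add: permute_list_compose)
  finally show ?thesis by (simp add: symmetrise_def)
qed

lemma symmetrise_mset: "mset is = mset js \<Longrightarrow> symmetrise F is = symmetrise F js"
  by (metis mset_eq_permutation symmetrise_permute)

lemma sym_tensor_symmetrise: "sym_tensor n k (symmetrise F)"
  by (auto simp: sym_tensor_def intro: symmetrise_mset)

lemma sym_tensor_diff: "sym_tensor n k S \<Longrightarrow> sym_tensor n k S' \<Longrightarrow> sym_tensor n k (\<lambda>is. S is - S' is)"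
  unfolding sym_tensor_def by (intro allI impI arg_cong2[of _ _ _ _ "(-)"]) blast+

lemma sym_tensor_mult: "sym_tensor n k S \<Longrightarrow> sym_tensor n k (\<lambda>is. c * S is)"
  unfolding sym_tensor_def by (intro allI impI arg_cong2[of _ _ _ _ "(*)"] refl) blast

lemma poly_form_diff: "poly_form n k (\<lambda>is. S is - S' is) x = poly_form n k S x - poly_form n k S' x"
  by (simp add: poly_form_def right_diff_distrib sum_subtractf)

lemma poly_form_mult: "poly_form n k (\<lambda>is. c * S is) x = c * poly_form n k S x"
  by (simp add: poly_form_def sum_distrib_left mult.left_commute)

lemma poly_form_snoc:
  "poly_form n (Suc k) S x = (\<Sum>i\<in>su_idx n. x i * poly_form n k (\<lambda>is. S (is @ [i])) x)"
  unfolding poly_form_def sum_multi_idx_snoc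
  by (subst sum.swap) (simp add: sum_distrib_left mult_ac)

text \<open>Once the other slots are all contracted with the same x, only the place of z matters:
  the k! orderings of the other indices coincide, and an average over the k + 1 places
  remains.\<close>

lemma poly_form_symmetrise_snoc:
  "poly_form n k (\<lambda>is. symmetrise F (is @ [z])) x =
    (\<Sum>b\<le>k. poly_form n k (\<lambda>is. F (take b is @ z # drop b is)) x) / of_nat (Suc k)"
proof -
  let ?G = "\<lambda>b is. F (take b is @ z # drop b is)"
  have "poly_form n k (\<lambda>is. symmetrise F (is @ [z])) x =
      poly_form n k (\<lambda>is. (\<Sum>b\<le>k. \<Sum>p | p permutes {..<k}. ?G b (permute_list p is)) / fact (Suc k)) x"
  proof (rule poly_form_cong)
    fix "is" assume "is \<in> multi_idx n k"
    then have len: "length is = k" by (rule length_multi_idx)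
    have "symmetrise F (is @ [z]) = (\<Sum>p | p permutes {..<Suc k}. F (permute_list p (is @ [z]))) / fact (Suc k)"
      by (simp add: symmetrise_def len)
    also have "(\<Sum>p | p permutes {..<Suc k}. F (permute_list p (is @ [z]))) =
        (\<Sum>b\<le>k. \<Sum>p | p permutes {..<k}. F (permute_list (p \<circ> move_last k b) (is @ [z])))"
      by (rule sum_permutes_insert_last)
    also have "\<dots> = (\<Sum>b\<le>k. \<Sum>p | p permutes {..<k}. ?G b (permute_list p is))"
      using permute_list_comp_move_last[of _ "is" _ z] by (intro sum.cong refl) (auto simp: len)
    finally show "symmetrise F (is @ [z]) =
        (\<Sum>b\<le>k. \<Sum>p | p permutes {..<k}. ?G b (permute_list p is)) / fact (Suc k)" .
  qed
  also have "\<dots> = (\<Sum>b\<le>k. \<Sum>p | p permutes {..<k}. poly_form n k (\<lambda>is. ?G b (permute_list p is)) x) / fact (Suc k)"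
  proof -
    have "poly_form n k (\<lambda>is. (\<Sum>b\<le>k. \<Sum>p | p permutes {..<k}. ?G b (permute_list p is)) / fact (Suc k)) x =
        (\<Sum>is\<in>multi_idx n k. \<Sum>b\<le>k. \<Sum>p | p permutes {..<k}.
          prod_list (map x is) * ?G b (permute_list p is)) / fact (Suc k)"
      by (simp only: poly_form_def sum_distrib_left sum_divide_distrib times_divide_eq_right)
    also have "(\<Sum>is\<in>multi_idx n k. \<Sum>b\<le>k. \<Sum>p | p permutes {..<k}. prod_list (map x is) * ?G b (permute_list p is)) =
        (\<Sum>b\<le>k. \<Sum>is\<in>multi_idx n k. \<Sum>p | p permutes {..<k}. prod_list (map x is) * ?G b (permute_list p is))"
      by (rule sum.swap)
    also have "\<dots> = (\<Sum>b\<le>k. \<Sum>p | p permutes {..<k}. \<Sum>is\<in>multi_idx n k. prod_list (map x is) * ?G b (permute_list p is))"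
      by (intro sum.cong refl sum.swap)
    finally show ?thesis by (simp add: poly_form_def)
  qed
  also have "(\<Sum>b\<le>k. \<Sum>p | p permutes {..<k}. poly_form n k (\<lambda>is. ?G b (permute_list p is)) x) =
      (\<Sum>b\<le>k. \<Sum>p | p permutes {..<k}. poly_form n k (?G b) x)"
  proof (intro sum.cong refl)
    fix b p assume "p \<in> {p. p permutes {..<k}}"
    then have p: "p permutes {..<k}" by simp
    have "poly_form n k (\<lambda>is. ?G b (permute_list p is)) x =
        (\<Sum>is\<in>multi_idx n k. prod_list (map x (permute_list p is)) * ?G b (permute_list p is))"
      unfolding poly_form_def using p by (intro sum.cong refl) (simp add: prod_list_permute length_multi_idx)
    also have "\<dots> = poly_form n k (?G b) x"
      unfolding poly_form_def by (rule sum_multi_idx_permute[OF p])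
    finally show "poly_form n k (\<lambda>is. ?G b (permute_list p is)) x = poly_form n k (?G b) x" .
  qed
  also have "\<dots> = fact k * (\<Sum>b\<le>k. poly_form n k (?G b) x)"
    using card_permutations[of "{..<k}" k] by (simp add: sum_distrib_left)
  finally show ?thesis by (simp add: divide_simps del: of_nat_Suc)
qed

section \<open>The cocycles as antisymmetrised traces\<close>

lemma prod_sum_multi_idx:
  "(\<Sum>is\<in>multi_idx n k. \<Prod>a<k. g a (is ! a)) = (\<Prod>a<k. \<Sum>i\<in>su_idx n. g a i :: complex)"
proof (induction k)
  case (Suc k)
  have "(\<Sum>is\<in>multi_idx n (Suc k). \<Prod>a<Suc k. g a (is ! a)) =
      (\<Sum>is\<in>multi_idx n k. \<Sum>i\<in>su_idx n. (\<Prod>a<k. g a (is ! a)) * g k i)"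
    unfolding sum_multi_idx_snoc
    by (intro sum.cong refl) (simp add: length_multi_idx nth_append)
  also have "\<dots> = (\<Sum>is\<in>multi_idx n k. \<Prod>a<k. g a (is ! a)) * (\<Sum>i\<in>su_idx n. g k i)"
    by (simp only: sum_product)
  finally show ?case by (simp add: Suc)
qed simp

lemma gen_delta_eq:
  assumes "length is = N" "length js = N"
  shows "gen_delta js is = (\<Sum>p | p permutes {..<N}. if permute_list p js = is then of_int (sign p) else 0)"
  unfolding gen_delta_def assms(1)
proof (intro sum.cong refl)
  fix p assume "p \<in> {p. p permutes {..<N}}"
  then have p: "p permutes {..<length js}" using assms by simp
  have "permute_list p js = is \<longleftrightarrow> (\<forall>a<N. is ! a = js ! p a)"
    using assms by (auto simp: list_eq_iff_nth_eq permute_list_nth[OF p])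
  moreover have "(\<Prod>a<N. kdelta (is ! a) (js ! p a)) = (if \<forall>a<N. is ! a = js ! p a then 1 else 0)"
    by (auto simp: kdelta_def)
  ultimately show "of_int (sign p) * (\<Prod>a<N. kdelta (is ! a) (js ! p a)) =
      (if permute_list p js = is then of_int (sign p) else 0)" by simp
qed

text \<open>The generalised delta is a signed count of the permutations that turn \<open>js\<close>
  into \<open>is\<close>. Read backwards, through inverses of equal sign, these antisymmetrise
  \<open>H\<close> over \<open>is\<close>.\<close>

lemma sum_gen_delta:
  assumes "is \<in> multi_idx n N"
  shows "(\<Sum>js\<in>multi_idx n N. gen_delta js is * H js) = alt_sum H is"
proof -
  have len: "length is = N" using assms by (rule length_multi_idx)
  have "(\<Sum>js\<in>multi_idx n N. gen_delta js is * H js) =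
      (\<Sum>js\<in>multi_idx n N. \<Sum>p | p permutes {..<N}. if permute_list p js = is then of_int (sign p) * H js else 0)"
    by (intro sum.cong refl, simp only: gen_delta_eq[OF len length_multi_idx] sum_distrib_right)
      (intro sum.cong refl, simp)
  also have "\<dots> = (\<Sum>p | p permutes {..<N}. \<Sum>js\<in>multi_idx n N. if permute_list p js = is then of_int (sign p) * H js else 0)"
    by (rule sum.swap)
  also have "\<dots> = (\<Sum>p | p permutes {..<N}. of_int (sign p) * H (permute_list (inv p) is))"
  proof (intro sum.cong refl)
    fix p assume "p \<in> {p. p permutes {..<N}}"
    then have p: "p permutes {..<N}" by simp
    have eq: "permute_list p js = is \<longleftrightarrow> js = permute_list (inv p) is" if "js \<in> multi_idx n N" for js
    proof -
      have pl: "p permutes {..<length js}" "p permutes {..<length is}" using p len length_multi_idx[OF that] by auto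
      show ?thesis using permute_list_inv(1)[OF pl(1)] permute_list_inv(2)[OF pl(2)] by metis
    qed
    have "(\<Sum>js\<in>multi_idx n N. if permute_list p js = is then of_int (sign p) * H js else 0) =
        (\<Sum>js\<in>multi_idx n N. if js = permute_list (inv p) is then of_int (sign p) * H js else 0)"
      by (intro sum.cong refl) (simp add: eq)
    also have "\<dots> = of_int (sign p) * H (permute_list (inv p) is)"
      using permute_list_in_multi_idx[OF permutes_inv[OF p] assms] by simp
    finally show "(\<Sum>js\<in>multi_idx n N. if permute_list p js = is then of_int (sign p) * H js else 0) =
        of_int (sign p) * H (permute_list (inv p) is)" .
  qed
  also have "\<dots> = (\<Sum>p | p permutes {..<N}. of_int (sign (inv p)) * H (permute_list (inv p) is))"
    by (intro sum.cong refl) (auto simp: sign_inverse permutes_imp_permutation[OF finite_lessThan])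
  also have "\<dots> = alt_sum H is"
    unfolding alt_sum_def len by (rule sum_permutations_inverse[symmetric])
  finally show ?thesis .
qed

context su_gens
begin

definition ktr :: "nat list \<Rightarrow> complex" where
  "ktr js = tr (map X js)"

lemma ktr_rotate: "set (x # ks) \<subseteq> I \<Longrightarrow> ktr (x # ks) = ktr (ks @ [x])"
  using word_trace_rotate[of "[X x]" n "map X ks"] by (simp add: ktr_def)

lemma k_tensor_eq: "k_tensor n T = symmetrise ktr"
proof -
  have "(\<lambda>is. mtrace (foldr (\<lambda>i A. X i * A) is (1\<^sub>m n))) = ktr"
    by (simp add: fun_eq_iff ktr_def word_trace_def word_prod_def foldr_map o_def)
  then show ?thesis by (simp add: k_tensor_def)
qed

text \<open>Cyclicity rotates every ordering until \<open>r\<close> stands last, so averaging over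
  the orderings of the other k indices is enough.\<close>

lemma k_tensor_snoc:
  assumes ls: "ls \<in> multi_idx n k" and r: "r \<in> I"
  shows "k_tensor n T (ls @ [r]) = (\<Sum>q | q permutes {..<k}. ktr (permute_list q ls @ [r])) / fact k"
proof -
  have len: "length ls = k" using ls by (rule length_multi_idx)
  have "(\<Sum>p | p permutes {..<Suc (length ls)}. 1 * ktr (permute_list p (ls @ [r]))) =
      of_nat (Suc (length ls)) * (\<Sum>p | p permutes {..<length ls}. 1 * ktr (permute_list p ls @ [r]))"
  proof (rule sum_permutes_cyclic)
    fix y ks assume "mset (y # ks) = mset (ls @ [r])"
    from mset_eq_setD[OF this] have "set (y # ks) \<subseteq> I" using ls r by (auto simp: multi_idx_def)
    then show "ktr (y # ks) = ktr (ks @ [y])" by (rule ktr_rotate)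
  qed simp
  then show ?thesis by (simp add: k_tensor_eq symmetrise_def len divide_simps del: of_nat_Suc)
qed

text \<open>For m = 2 the seed is delta_ij = -2 Tr (X_i X_j) instead of the trace itself; the factor
  puts all m on the same footing.\<close>

definition seed_const :: "nat \<Rightarrow> complex" where
  "seed_const k = (if k = 1 then - 2 else 1)"

lemma cocycle_seed_snoc:
  assumes ls: "ls \<in> multi_idx n k" and r: "r \<in> I" and k: "k \<ge> 1"
  shows "cocycle_seed n T (ls @ [r]) = seed_const k / fact k * (\<Sum>q | q permutes {..<k}. ktr (permute_list q ls @ [r]))"
proof (cases "k = 1")
  case True
  then obtain l where l: "ls = [l]" "l \<in> I" using ls by (auto simp: multi_idx_def length_Suc_conv)
  have "{..<1} = {0::nat}" by auto
  then show ?thesis using True l r by (simp add: cocycle_seed_def seed_const_def ktr_def tr_XX)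
next
  case False
  then show ?thesis using k_tensor_snoc[OF ls r] length_multi_idx[OF ls] k
    by (simp add: cocycle_seed_def seed_const_def)
qed

definition f_chain :: "nat \<Rightarrow> nat list \<Rightarrow> nat list \<Rightarrow> complex" where
  "f_chain k js ls = (\<Prod>a<k. complex_of_real (f (js ! (2 * a)) (js ! (2 * a + 1)) (ls ! a)))"

lemma f_chain_permute:
  assumes q: "q permutes {..<k}" and ls: "length ls = k" and js: "length js = 2 * k + 1"
  shows "f_chain k js ls = f_chain k (permute_list (double_perm q) js) (permute_list q ls)"
proof -
  have d: "double_perm q permutes {..<length js}"
    using double_perm_permutes[OF q] js by (auto intro: permutes_subset)
  have q': "q permutes {..<length ls}" using q ls by simp
  have "f_chain k js ls = (\<Prod>a<k. (\<lambda>a. complex_of_real (f (js ! (2 * a)) (js ! (2 * a + 1)) (ls ! a))) (q a))"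
    unfolding f_chain_def by (rule prod.permute[OF q, unfolded comp_def])
  also have "\<dots> = f_chain k (permute_list (double_perm q) js) (permute_list q ls)"
    unfolding f_chain_def using js ls
    by (intro prod.cong refl) (simp add: permute_list_nth[OF d] permute_list_nth[OF q'], simp add: double_perm_def)
  finally show ?thesis .
qed

text \<open>Interpolates between the plain trace (r = 0) and the summand of the cocycle: the first r
  pairs are contracted with f, the later indices still carry their own generators.\<close>

definition partial_comm :: "nat \<Rightarrow> nat list \<Rightarrow> complex" where
  "partial_comm r js = (\<Sum>ls\<in>multi_idx n r. f_chain r js ls * ktr (ls @ drop (2 * r) js))"

text \<open>Undoing the last f turns a generator into the commutator of the two generators of its
  pair. The two orderings differ by a transposition, so after antisymmetrisation they add up to a
  factor 2.\<close>

lemma alt_sum_partial_comm_Suc: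
  assumes js: "js \<in> multi_idx n N" and r: "2 * Suc r \<le> N"
  shows "alt_sum (partial_comm (Suc r)) js = 2 * alt_sum (partial_comm r) js"
proof -
  let ?t = "transpose (2 * r) (Suc (2 * r))"
  have len: "length js = N" using js by (rule length_multi_idx)
  have t: "?t permutes {..<N}" using r by (intro permutes_swap_id) auto
  have step: "partial_comm (Suc r) ks = partial_comm r ks - partial_comm r (permute_list ?t ks)"
    if ks: "mset ks = mset js" for ks
  proof -
    have lk: "length ks = N" using mset_eq_length[OF ks] len by simp
    have sk: "set ks \<subseteq> I" using mset_eq_setD[OF ks] js by (auto simp: multi_idx_def)
    let ?a = "ks ! (2 * r)" and ?b = "ks ! Suc (2 * r)" and ?D = "drop (2 * r + 2) ks"
    have ab: "?a \<in> I" "?b \<in> I" using sk lk r by (auto intro!: subsetD[OF sk] nth_mem)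
    have D: "set ?D \<subseteq> I" using sk set_drop_subset by fast
    have dk: "drop (2 * r) ks = ?a # ?b # ?D"
      using lk r by (simp add: Cons_nth_drop_Suc)
    have t': "?t permutes {..<length ks}" using t lk by simp
    have nth: "permute_list ?t ks ! i = ks ! ?t i" if "i < N" for i
      using permute_list_nth[OF t', of i] that lk by simp
    have dt: "drop (2 * r) (permute_list ?t ks) = ?b # ?a # ?D"
    proof -
      have "drop (2 * r) (permute_list ?t ks) =
          permute_list ?t ks ! (2 * r) # permute_list ?t ks ! Suc (2 * r) # drop (2 * r + 2) (permute_list ?t ks)"
        using lk r by (simp add: Cons_nth_drop_Suc)
      also have "drop (2 * r + 2) (permute_list ?t ks) = ?D"
        by (rule nth_equalityI) (use lk r in \<open>auto simp: nth transpose_def\<close>)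
      finally show ?thesis using r by (simp add: nth)
    qed
    have ft: "f_chain r (permute_list ?t ks) ls = f_chain r ks ls" for ls
      unfolding f_chain_def using r by (intro prod.cong refl) (simp add: nth transpose_def)
    have "partial_comm (Suc r) ks = (\<Sum>ls\<in>multi_idx n r. f_chain r ks ls *
        (\<Sum>l\<in>I. of_real (f ?a ?b l) * ktr (ls @ l # ?D)))"
      unfolding partial_comm_def sum_multi_idx_snoc sum_distrib_left
    proof (intro sum.cong refl)
      fix ls l assume ls: "ls \<in> multi_idx n r" and "l \<in> I"
      have "f_chain (Suc r) ks (ls @ [l]) = f_chain r ks ls * of_real (f ?a ?b l)"
        using length_multi_idx[OF ls] by (simp add: f_chain_def nth_append)
      then show "f_chain (Suc r) ks (ls @ [l]) * ktr ((ls @ [l]) @ drop (2 * Suc r) ks) =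
          f_chain r ks ls * (of_real (f ?a ?b l) * ktr (ls @ l # ?D))" by simp
    qed
    also have "\<dots> = (\<Sum>ls\<in>multi_idx n r. f_chain r ks ls * (ktr (ls @ ?a # ?b # ?D) - ktr (ls @ ?b # ?a # ?D)))"
    proof (intro sum.cong refl arg_cong2[of _ _ _ _ "(*)"])
      fix ls assume "ls \<in> multi_idx n r"
      then have "set (map X ls) \<subseteq> C" "set (map X ?D) \<subseteq> C" using D by (auto simp: multi_idx_def)
      from tr_commutator[OF ab this]
      show "(\<Sum>l\<in>I. of_real (f ?a ?b l) * ktr (ls @ l # ?D)) = ktr (ls @ ?a # ?b # ?D) - ktr (ls @ ?b # ?a # ?D)"
        by (simp add: ktr_def)
    qed
    also have "\<dots> = partial_comm r ks - partial_comm r (permute_list ?t ks)"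
      unfolding partial_comm_def ft dk dt by (simp add: right_diff_distrib sum_subtractf)
    finally show ?thesis .
  qed
  have "alt_sum (partial_comm (Suc r)) js = alt_sum (\<lambda>ks. partial_comm r ks - partial_comm r (permute_list ?t ks)) js"
    by (rule alt_sum_cong) (rule step)
  also have "\<dots> = alt_sum (partial_comm r) js - alt_sum (\<lambda>ks. partial_comm r (permute_list ?t ks)) js"
    by (simp add: alt_sum_def right_diff_distrib sum_subtractf)
  also have "alt_sum (\<lambda>ks. partial_comm r (permute_list ?t ks)) js = - alt_sum (partial_comm r) js"
    using t len by (subst alt_sum_permuted_arg) (auto simp: sign_swap_id)
  finally show ?thesis by simp
qed

lemma alt_sum_partial_comm:
  "js \<in> multi_idx n N \<Longrightarrow> 2 * r \<le> N \<Longrightarrow> alt_sum (partial_comm r) js = 2 ^ r * alt_sum ktr js"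
proof (induction r)
  case 0
  have "partial_comm 0 = ktr" by (simp add: fun_eq_iff partial_comm_def f_chain_def)
  then show ?case by simp
qed (simp add: alt_sum_partial_comm_Suc)

text \<open>A permutation q of the symmetrised seed can be traded for the permutation of whole pairs
  of \<open>js\<close>, which is even. Hence all k! orderings contribute equally and cancel the
  normalisation of the seed, and each of the k commutators gives a factor 2.\<close>

theorem cocycle_eq_alt_trace:
  assumes k: "k \<ge> 1" and "is": "is \<in> multi_idx n (2 * k + 1)"
  shows "cocycle n T f (Suc k) is = seed_const k * 2 ^ k / fact (2 * k + 1) * alt_sum ktr is"
proof -
  have len: "length is = 2 * k + 1" using "is" by (rule length_multi_idx)
  let ?E = "\<lambda>q js. \<Sum>ls\<in>multi_idx n k. f_chain k js ls * ktr (permute_list q ls @ [js ! (2 * k)])"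
  let ?Q = "{q. q permutes {..<k}}"
  have "cocycle n T f (Suc k) is = 1 / fact (2 * k + 1) * (\<Sum>js\<in>multi_idx n (2 * k + 1). gen_delta js is *
      (\<Sum>ls\<in>multi_idx n k. f_chain k js ls * cocycle_seed n T (ls @ [js ! (2 * k)])))"
    by (simp add: cocycle_def f_chain_def sum_distrib_left mult.assoc)
  also have "(\<Sum>js\<in>multi_idx n (2 * k + 1). gen_delta js is *
      (\<Sum>ls\<in>multi_idx n k. f_chain k js ls * cocycle_seed n T (ls @ [js ! (2 * k)]))) =
      alt_sum (\<lambda>js. \<Sum>ls\<in>multi_idx n k. f_chain k js ls * cocycle_seed n T (ls @ [js ! (2 * k)])) is"
    by (rule sum_gen_delta[OF "is"])
  also have "\<dots> = alt_sum (\<lambda>js. seed_const k / fact k * (\<Sum>q\<in>?Q. ?E q js)) is"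
  proof (rule alt_sum_cong)
    fix js assume js: "mset js = mset is"
    have "js ! (2 * k) \<in> set js" using mset_eq_length[OF js] len by (intro nth_mem) simp
    then have r: "js ! (2 * k) \<in> I" using mset_eq_setD[OF js] "is" by (auto simp: multi_idx_def)
    have "(\<Sum>ls\<in>multi_idx n k. f_chain k js ls * cocycle_seed n T (ls @ [js ! (2 * k)])) =
        (\<Sum>ls\<in>multi_idx n k. f_chain k js ls * (seed_const k / fact k *
          (\<Sum>q\<in>?Q. ktr (permute_list q ls @ [js ! (2 * k)]))))"
      by (intro sum.cong refl) (simp only: cocycle_seed_snoc[OF _ r k])
    also have "\<dots> = seed_const k / fact k * (\<Sum>ls\<in>multi_idx n k. \<Sum>q\<in>?Q.
        f_chain k js ls * ktr (permute_list q ls @ [js ! (2 * k)]))"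
      by (simp add: sum_distrib_left mult_ac)
    also have "(\<Sum>ls\<in>multi_idx n k. \<Sum>q\<in>?Q. f_chain k js ls * ktr (permute_list q ls @ [js ! (2 * k)])) =
        (\<Sum>q\<in>?Q. ?E q js)" by (rule sum.swap)
    finally show "(\<Sum>ls\<in>multi_idx n k. f_chain k js ls * cocycle_seed n T (ls @ [js ! (2 * k)])) =
        seed_const k / fact k * (\<Sum>q\<in>?Q. ?E q js)" .
  qed
  also have "\<dots> = seed_const k / fact k * (\<Sum>q\<in>?Q. alt_sum (?E q) is)"
  proof -
    have "alt_sum (\<lambda>js. c * (\<Sum>q\<in>?Q. E q js)) is = c * (\<Sum>q\<in>?Q. alt_sum (E q) is)" for c E
      unfolding alt_sum_def sum_distrib_left by (subst sum.swap) (simp add: mult_ac)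
    then show ?thesis .
  qed
  also have "(\<Sum>q\<in>?Q. alt_sum (?E q) is) = (\<Sum>q\<in>?Q. 2 ^ k * alt_sum ktr is)"
  proof (intro sum.cong refl)
    fix q assume "q \<in> ?Q"
    then have q: "q permutes {..<k}" by simp
    have d: "double_perm q permutes {..<length is}"
      using double_perm_permutes[OF q] len by (auto intro: permutes_subset)
    have "alt_sum (?E q) is = alt_sum (\<lambda>js. partial_comm k (permute_list (double_perm q) js)) is"
    proof (rule alt_sum_cong)
      fix js assume js: "mset js = mset is"
      have lj: "length js = 2 * k + 1" using mset_eq_length[OF js] len by simp
      let ?js = "permute_list (double_perm q) js"
      have d': "double_perm q permutes {..<length js}" using d lj len by simp
      \<comment> \<open>The unpaired index rho sits at position 2k, outside all blocks, and stays in
        place.\<close>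
      have "double_perm q (2 * k) = 2 * k" using double_perm_permutes[OF q] by (simp add: permutes_def)
      then have last: "drop (2 * k) ?js = [js ! (2 * k)]"
        using lj permute_list_nth[OF d', of "2 * k"] Cons_nth_drop_Suc[of "2 * k" ?js] by simp
      have "?E q js = (\<Sum>ls\<in>multi_idx n k. f_chain k ?js (permute_list q ls) * ktr (permute_list q ls @ [js ! (2 * k)]))"
        using f_chain_permute[OF q _ lj] by (intro sum.cong refl) (simp add: length_multi_idx)
      also have "\<dots> = (\<Sum>ls\<in>multi_idx n k. f_chain k ?js ls * ktr (ls @ [js ! (2 * k)]))"
        by (rule sum_multi_idx_permute[OF q])
      finally show "?E q js = partial_comm k ?js" by (simp add: partial_comm_def last)
    qed
    also have "\<dots> = alt_sum (partial_comm k) is"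
      using alt_sum_permuted_arg[OF d] sign_double_perm[OF q] by simp
    also have "\<dots> = 2 ^ k * alt_sum ktr is" by (rule alt_sum_partial_comm[OF "is"]) simp
    finally show "alt_sum (?E q) is = 2 ^ k * alt_sum ktr is" .
  qed
  also have "\<dots> = fact k * (2 ^ k * alt_sum ktr is)"
    using card_permutations[of "{..<k}" k] by simp
  finally show ?thesis by simp
qed

section \<open>The tensors t as Wick contractions of traces\<close>

text \<open>The trace has odd length 2k + 1, so rotations are even and z can be kept last. The
  factor 2k + 1 reduces the (2k + 1)! of the cocycle to (2k)! in \<open>t_tensor_eq\<close>.\<close>

lemma alt_sum_ktr_snoc:
  assumes js: "js \<in> multi_idx n (2 * k)" and z: "z \<in> I"
  shows "alt_sum ktr (js @ [z]) = of_nat (2 * k + 1) * alt_sum (\<lambda>ks. ktr (ks @ [z])) js"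
proof -
  have len: "length js = 2 * k" using js by (rule length_multi_idx)
  have "alt_sum ktr (js @ [z]) = of_nat (Suc (length js)) * alt_sum (\<lambda>ks. ktr (ks @ [z])) js"
  proof (rule alt_sum_cyclic)
    fix y ks assume "mset (y # ks) = mset (js @ [z])"
    from mset_eq_setD[OF this] have "set (y # ks) \<subseteq> I" using js z by (auto simp: multi_idx_def)
    then show "ktr (y # ks) = ktr (ks @ [y])" by (rule ktr_rotate)
  qed (simp add: len)
  then show ?thesis by (simp add: len)
qed

lemma t_tensor_eq:
  assumes k: "k \<ge> 1" and "is": "is \<in> multi_idx n k" and z: "z \<in> I"
  shows "t_tensor n T f (Suc k) (is @ [z]) = seed_const k * 2 ^ k / fact (2 * k) *
    (\<Sum>js\<in>multi_idx n (2 * k). alt_sum (\<lambda>ks. ktr (ks @ [z])) js *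
      (\<Prod>a<k. complex_of_real (f (is ! a) (js ! (2 * a)) (js ! (2 * a + 1)))))"
proof -
  have len: "length is = k" using "is" by (rule length_multi_idx)
  have "t_tensor n T f (Suc k) (is @ [z]) = (\<Sum>js\<in>multi_idx n (2 * k). cocycle n T f (Suc k) (js @ [z]) *
      (\<Prod>a<k. complex_of_real (f (is ! a) (js ! (2 * a)) (js ! (2 * a + 1)))))"
    unfolding t_tensor_def using len by (simp add: nth_append)
  also have "\<dots> = (\<Sum>js\<in>multi_idx n (2 * k). seed_const k * 2 ^ k / fact (2 * k) *
      (alt_sum (\<lambda>ks. ktr (ks @ [z])) js * (\<Prod>a<k. complex_of_real (f (is ! a) (js ! (2 * a)) (js ! (2 * a + 1))))))"
  proof (intro sum.cong refl)
    fix js assume js: "js \<in> multi_idx n (2 * k)"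
    have "js @ [z] \<in> multi_idx n (2 * k + 1)" using js z by (simp add: snoc_in_multi_idx)
    from cocycle_eq_alt_trace[OF k this]
    have "cocycle n T f (Suc k) (js @ [z]) = seed_const k * 2 ^ k / fact (2 * k) * alt_sum (\<lambda>ks. ktr (ks @ [z])) js"
      unfolding alt_sum_ktr_snoc[OF js z] Suc_eq_plus1[symmetric] fact_Suc
      by (simp del: of_nat_Suc)
    then show "cocycle n T f (Suc k) (js @ [z]) * (\<Prod>a<k. complex_of_real (f (is ! a) (js ! (2 * a)) (js ! (2 * a + 1)))) =
        seed_const k * 2 ^ k / fact (2 * k) *
      (alt_sum (\<lambda>ks. ktr (ks @ [z])) js * (\<Prod>a<k. complex_of_real (f (is ! a) (js ! (2 * a)) (js ! (2 * a + 1)))))"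
      by (simp only: mult.assoc)
  qed
  finally show ?thesis by (simp only: sum_distrib_left)
qed

text \<open>A permutation of the first m - 1 indices is undone by moving the corresponding pairs of
  contracted indices; that permutation is even, so the antisymmetrised trace does not notice
  it.\<close>

lemma t_tensor_sym:
  assumes k: "k \<ge> 1" and z: "z \<in> I"
  shows "sym_tensor n k (\<lambda>is. t_tensor n T f (Suc k) (is @ [z]))"
  unfolding sym_tensor_def
proof (intro allI impI)
  fix "is" "is'" assume "is": "is \<in> multi_idx n k" and m: "mset is = mset is'"
  obtain q where q: "q permutes {..<length is}" "permute_list q is = is'"
    using mset_eq_permutation[OF m[symmetric]] by blast
  have len: "length is = k" using "is" by (rule length_multi_idx)
  have qk: "q permutes {..<k}" using q len by simp
  have is': "is' \<in> multi_idx n k" using permute_list_in_multi_idx[OF qk "is"] q by simp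
  note d = double_perm_permutes[OF qk]
  have "(\<Sum>js\<in>multi_idx n (2 * k). alt_sum (\<lambda>ks. ktr (ks @ [z])) js *
      (\<Prod>a<k. complex_of_real (f (is ! a) (js ! (2 * a)) (js ! (2 * a + 1))))) =
    (\<Sum>js\<in>multi_idx n (2 * k). alt_sum (\<lambda>ks. ktr (ks @ [z])) (permute_list (double_perm q) js) *
      (\<Prod>a<k. complex_of_real (f (is' ! a) (permute_list (double_perm q) js ! (2 * a)) (permute_list (double_perm q) js ! (2 * a + 1)))))"
  proof (intro sum.cong refl arg_cong2[of _ _ _ _ "(*)"])
    fix js assume "js \<in> multi_idx n (2 * k)"
    then have lj: "length js = 2 * k" by (rule length_multi_idx)
    have d': "double_perm q permutes {..<length js}" using d lj by simp
    show "alt_sum (\<lambda>ks. ktr (ks @ [z])) js = alt_sum (\<lambda>ks. ktr (ks @ [z])) (permute_list (double_perm q) js)"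
      using alt_sum_permute_list[OF d'] sign_double_perm[OF qk] by simp
    have "(\<Prod>a<k. complex_of_real (f (is ! a) (js ! (2 * a)) (js ! (2 * a + 1)))) =
        (\<Prod>a<k. (\<lambda>a. complex_of_real (f (is ! a) (js ! (2 * a)) (js ! (2 * a + 1)))) (q a))"
      by (rule prod.permute[OF qk, unfolded comp_def])
    also have "\<dots> = (\<Prod>a<k. complex_of_real (f (is' ! a) (permute_list (double_perm q) js ! (2 * a)) (permute_list (double_perm q) js ! (2 * a + 1))))"
      unfolding q(2)[symmetric] using len lj
      by (intro prod.cong refl) (simp add: permute_list_nth[OF d'] permute_list_nth[OF q(1)], simp add: double_perm_def)
    finally show "(\<Prod>a<k. complex_of_real (f (is ! a) (js ! (2 * a)) (js ! (2 * a + 1)))) =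
        (\<Prod>a<k. complex_of_real (f (is' ! a) (permute_list (double_perm q) js ! (2 * a)) (permute_list (double_perm q) js ! (2 * a + 1))))" .
  qed
  also have "\<dots> = (\<Sum>js\<in>multi_idx n (2 * k). alt_sum (\<lambda>ks. ktr (ks @ [z])) js *
      (\<Prod>a<k. complex_of_real (f (is' ! a) (js ! (2 * a)) (js ! (2 * a + 1)))))"
    by (rule sum_multi_idx_permute[OF d])
  finally show "t_tensor n T f (Suc k) (is @ [z]) = t_tensor n T f (Suc k) (is' @ [z])"
    by (simp only: t_tensor_eq[OF k "is" z] t_tensor_eq[OF k is' z])
qed

text \<open>Each factor f carries its own index of \<open>is\<close>, so contraction with x turns
  the product of k factors into k copies of the pairing \<open>f_form x\<close>.\<close>

theorem poly_form_t_tensor: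
  assumes k: "k \<ge> 1" and z: "z \<in> I"
  shows "poly_form n k (\<lambda>is. t_tensor n T f (Suc k) (is @ [z])) x =
    seed_const k * 2 ^ k * fact k / fact (2 * k) * terms_val x (X z) (collect_terms (wick_terms k (cyclic_word k)))"
proof -
  let ?c = "seed_const k * 2 ^ k / fact (2 * k)"
  let ?A = "alt_sum (\<lambda>ks. ktr (ks @ [z]))"
  let ?F = "\<lambda>is js. \<Prod>a<k. complex_of_real (f (is ! a) (js ! (2 * a)) (js ! (2 * a + 1)))"
  have "poly_form n k (\<lambda>is. t_tensor n T f (Suc k) (is @ [z])) x =
      poly_form n k (\<lambda>is. ?c * (\<Sum>js\<in>multi_idx n (2 * k). ?A js * ?F is js)) x"
    by (intro poly_form_cong t_tensor_eq k z)
  also have "\<dots> = ?c * (\<Sum>is\<in>multi_idx n k. \<Sum>js\<in>multi_idx n (2 * k). prod_list (map x is) * (?A js * ?F is js))"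
    by (simp only: poly_form_mult) (simp only: poly_form_def sum_distrib_left)
  also have "(\<Sum>is\<in>multi_idx n k. \<Sum>js\<in>multi_idx n (2 * k). prod_list (map x is) * (?A js * ?F is js)) =
      (\<Sum>js\<in>multi_idx n (2 * k). \<Sum>is\<in>multi_idx n k. prod_list (map x is) * (?A js * ?F is js))"
    by (rule sum.swap)
  also have "\<dots> = pair_contract n (f_form x) k (\<lambda>ks. ktr (ks @ [z]))"
    unfolding pair_contract_def
  proof (intro sum.cong refl)
    fix js
    have "(\<Sum>is\<in>multi_idx n k. prod_list (map x is) * (?A js * ?F is js)) =
        ?A js * (\<Sum>is\<in>multi_idx n k. \<Prod>a<k. x (is ! a) * complex_of_real (f (is ! a) (js ! (2 * a)) (js ! (2 * a + 1))))"
      unfolding sum_distrib_left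
      by (intro sum.cong refl) (simp add: prod_list_nth length_multi_idx prod.distrib)
    also have "\<dots> = ?A js * pair_prod (f_form x) k js"
      unfolding prod_sum_multi_idx[where g = "\<lambda>a i. x i * complex_of_real (f i (js ! (2 * a)) (js ! (2 * a + 1)))"]
      by (simp add: pair_prod_def f_form_def)
    finally show "(\<Sum>is\<in>multi_idx n k. prod_list (map x is) * (?A js * ?F is js)) = pair_prod (f_form x) k js * ?A js"
      by (simp add: mult.commute)
  qed
  also have "\<dots> = fact k * terms_val x (X z) (collect_terms (wick_terms k (cyclic_word k)))"
    unfolding ktr_def by (rule pair_contract_cyclic_word[OF z])
  finally show ?thesis by simp
qed

end


section \<open>Power sums of traceless matrices\<close>

lemma upper_triangular_mult:
  assumes A: "A \<in> carrier_mat n n" "upper_triangular A" and B: "B \<in> carrier_mat n n" "upper_triangular (B :: complex mat)"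
  shows "upper_triangular (A * B)" and "i < n \<Longrightarrow> (A * B) $$ (i, i) = A $$ (i, i) * B $$ (i, i)"
proof -
  have e: "(A * B) $$ (i, j) = (if i = j then A $$ (i, i) * B $$ (i, i) else 0)" if ij: "i < n" "j \<le> i" for i j
  proof -
    have "(A * B) $$ (i, j) = (\<Sum>c<n. A $$ (i, c) * B $$ (c, j))"
      using ij by (intro mat_mult_entry[OF A(1) B(1)]) auto
    also have "\<dots> = (\<Sum>c<n. if c = i then (if i = j then A $$ (i, i) * B $$ (i, i) else 0) else 0)"
    proof (intro sum.cong refl)
      fix c assume c: "c \<in> {..<n}"
      consider "c < i" | "c = i" | "c > i" by linarith
      then show "A $$ (i, c) * B $$ (c, j) = (if c = i then (if i = j then A $$ (i, i) * B $$ (i, i) else 0) else 0)"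
      proof cases
        case 1
        then show ?thesis using upper_triangularD[OF A(2) 1] A(1) ij by simp
      next
        case 2
        then show ?thesis using upper_triangularD[OF B(2), of j i] B(1) ij by auto
      next
        case 3
        then show ?thesis using upper_triangularD[OF B(2), of j c] B(1) ij c by auto
      qed
    qed
    finally show ?thesis using ij by simp
  qed
  show "upper_triangular (A * B)" using e A B by (intro upper_triangularI) auto
  show "i < n \<Longrightarrow> (A * B) $$ (i, i) = A $$ (i, i) * B $$ (i, i)" using e by simp
qed

lemma word_prod_replicate:
  "A \<in> carrier_mat n n \<Longrightarrow> word_prod n (replicate k A) = A ^\<^sub>m k"
proof (induction k)
  case (Suc k)
  have "word_prod n (replicate (Suc k) A) = word_prod n (replicate k A @ [A])"
    by (simp only: replicate_Suc replicate_append_same[symmetric])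
  also have "\<dots> = word_prod n (replicate k A) * word_prod n [A]"
    by (rule word_prod_append) (use Suc.prems in auto)
  finally show ?case using Suc by (simp add: right_mult_one_mat[of _ n n])
qed simp

text \<open>For complex x the matrix x^i X_i need not be diagonalisable; Schur triangularisation
  suffices, because the diagonal of a power of a triangular matrix consists of the powers of the
  diagonal entries.\<close>

lemma traces_eq_power_sums:
  assumes A: "A \<in> carrier_mat n n"
  obtains ev where "\<And>k. word_trace n (replicate k A) = (\<Sum>a<n. ev a ^ k)"
proof -
  obtain es where es: "char_poly A = (\<Prod>a\<leftarrow>es. [:- a, 1:])"
    using char_poly_factorized[OF A] by blast
  obtain B where B: "B \<in> carrier_mat n n" "upper_triangular B" "similar_mat A B"
    using schur_decomposition_exists[OF A es] by blast
  then obtain P Q where w: "similar_mat_wit A B P Q" unfolding similar_mat_def by blast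
  note wD = similar_mat_witD2[OF A w]
  have Bk: "B ^\<^sub>m k \<in> carrier_mat n n" for k using B by (rule_tac pow_carrier_mat)
  have up: "upper_triangular (B ^\<^sub>m k) \<and> (\<forall>a<n. (B ^\<^sub>m k) $$ (a, a) = B $$ (a, a) ^ k)" for k
  proof (induction k)
    case 0
    then show ?case using B by simp
  next
    case (Suc k)
    then show ?case using upper_triangular_mult[OF Bk[of k] _ B(1,2)] by (simp del: index_mult_mat(1))
  qed
  have "word_trace n (replicate k A) = (\<Sum>a<n. (B $$ (a, a)) ^ k)" for k
  proof -
    have "word_trace n (replicate k A) = mtrace (P * B ^\<^sub>m k * Q)"
      using similar_mat_wit_pow_id[OF w, of k] by (simp add: word_trace_def word_prod_replicate[OF A])
    also have "\<dots> = mtrace (Q * (P * B ^\<^sub>m k))"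
      by (rule mtrace_mult_commute) (use wD Bk in auto)
    also have "Q * (P * B ^\<^sub>m k) = B ^\<^sub>m k"
      using wD Bk[of k] by (simp add: assoc_mult_mat[symmetric, of Q n n P n "B ^\<^sub>m k" n])
    also have "mtrace (B ^\<^sub>m k) = (\<Sum>a<n. (B $$ (a, a)) ^ k)"
      using B(1) up[of k] by (simp add: mtrace_def)
    finally show ?thesis .
  qed
  then show thesis by (rule that)
qed

lemma power_sum_2: fixes a b :: complex assumes "a + b = 0" shows "a ^ 3 + b ^ 3 = 0"
proof -
  have "b = - a" using assms by (simp add: add_eq_0_iff)
  then show ?thesis by simp
qed

text \<open>Newton's identity p_4 = 2 e_2^2 - 4 e_4 for e_1 = 0, with e_4 = 0 and p_2 = -2
  e_2.\<close>

lemma power_sum_3: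
  fixes a b c :: complex assumes "a + b + c = 0"
  shows "2 * (a ^ 4 + b ^ 4 + c ^ 4) = (a ^ 2 + b ^ 2 + c ^ 2) ^ 2"
proof -
  have c: "c = - (a + b)" using assms by (simp add: add_eq_0_iff2)
  show ?thesis unfolding c by (simp add: power2_eq_square power4_eq_xxxx algebra_simps)
qed

text \<open>Newton's identity p_5 = -5 e_2 e_3 + 5 e_5 for e_1 = 0, with e_5 = 0, p_2 = -2 e_2 and
  p_3 = 3 e_3.\<close>

lemma power_sum_4:
  fixes a b c e :: complex assumes "a + b + c + e = 0"
  shows "6 * (a ^ 5 + b ^ 5 + c ^ 5 + e ^ 5) = 5 * (a ^ 2 + b ^ 2 + c ^ 2 + e ^ 2) * (a ^ 3 + b ^ 3 + c ^ 3 + e ^ 3)"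
proof -
  have e: "e = - (a + b + c)" using assms by (simp add: add_eq_0_iff2)
  show ?thesis unfolding e by (simp add: eval_nat_numeral algebra_simps)
qed

section \<open>Multilinear forms of the invariant tensors\<close>

text \<open>The d-tensors are not symmetric before symmetrisation, so the place of z among copies of
  x matters and every slot takes its own vector.\<close>

fun mform :: "nat \<Rightarrow> (nat list \<Rightarrow> complex) \<Rightarrow> (nat \<Rightarrow> complex) list \<Rightarrow> complex" where
  "mform n F [] = F []"
| "mform n F (v # vs) = (\<Sum>i\<in>su_idx n. v i * mform n (\<lambda>is. F (i # is)) vs)"

lemma mform_replicate: "mform n F (replicate k x) = poly_form n k F x"
  by (induction k arbitrary: F) (simp_all add: poly_form_Suc)

lemma sum_kdelta: "z \<in> su_idx n \<Longrightarrow> (\<Sum>i\<in>su_idx n. kdelta i z * h i) = h z"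
  by (simp add: kdelta_def if_distrib[of "\<lambda>x. x * _"] cong: if_cong)

lemma poly_form_insert:
  assumes z: "z \<in> su_idx n"
  shows "b \<le> k \<Longrightarrow> poly_form n k (\<lambda>is. F (take b is @ z # drop b is)) x =
    mform n F (replicate b x @ (\<lambda>i. kdelta i z) # replicate (k - b) x)"
proof (induction b arbitrary: F k)
  case 0
  then show ?case by (simp add: mform_replicate sum_kdelta[OF z])
next
  case (Suc b)
  then obtain k' where k: "k = Suc k'" by (cases k) auto
  have "poly_form n k' (\<lambda>is. F (i # take b is @ z # drop b is)) x =
      mform n (\<lambda>is. F (i # is)) (replicate b x @ (\<lambda>i. kdelta i z) # replicate (k' - b) x)" for i
    using Suc.IH[of k' "\<lambda>is. F (i # is)"] Suc.prems by (simp add: k)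
  then show ?case by (simp add: k poly_form_Suc)
qed

lemma poly_form_symmetrise:
  assumes "z \<in> su_idx n"
  shows "poly_form n k (\<lambda>is. symmetrise F (is @ [z])) x =
    (\<Sum>b\<le>k. mform n F (replicate b x @ (\<lambda>i. kdelta i z) # replicate (k - b) x)) / of_nat (Suc k)"
  unfolding poly_form_symmetrise_snoc using poly_form_insert[OF assms]
  by (intro arg_cong2[of _ _ _ _ "(/)"] sum.cong refl) auto

section \<open>The symmetric product of su(n) vectors given by d, and its traces\<close>

context su_gens
begin

definition dot :: "(nat \<Rightarrow> complex) \<Rightarrow> (nat \<Rightarrow> complex) \<Rightarrow> complex" where
  "dot x y = (\<Sum>i\<in>I. x i * y i)"

text \<open>The bilinear product with components d_ijl x^i y^j; a d-tensor contracted with vectors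
  is a scalar product of nested products of this kind.\<close>

definition dvec :: "(nat \<Rightarrow> complex) \<Rightarrow> (nat \<Rightarrow> complex) \<Rightarrow> nat \<Rightarrow> complex" where
  "dvec x y l = (\<Sum>i\<in>I. x i * (\<Sum>j\<in>I. y j * of_real (d i j l)))"

lemma vec_mat_unit: "z \<in> I \<Longrightarrow> vec_mat (\<lambda>i. kdelta i z) = X z"
  by (rule eq_matI) (auto simp: vec_mat_def sum_kdelta)

text \<open>The anticommutator relation in matrix form: the matrix of \<open>dvec x y\<close> is i
  times the anticommutator of the matrices of x and y plus (x.y / n) times the identity, inserted at
  a slot of a word.\<close>

lemma tr_dvec:
  assumes uv: "set u \<subseteq> C" "set v \<subseteq> C"
  shows "tr (u @ vec_mat (dvec x y) # v) = \<i> * (tr (u @ vec_mat x # vec_mat y # v)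
    + tr (u @ vec_mat y # vec_mat x # v) + dot x y * tr (u @ v) / of_nat n)"
proof -
  have dl: "(\<Sum>l\<in>I. of_real (d i j l) * tr (u @ X l # v)) =
      \<i> * (tr (u @ X i # X j # v) + tr (u @ X j # X i # v) + kdelta i j * (tr (u @ v) / of_nat n))"
    if "i \<in> I" "j \<in> I" for i j
  proof -
    have "A = \<i> * (B + D + k * (t / N))" if "B = - D - k / N * t - \<i> * A" for A B D k t N :: complex
      unfolding that by (simp add: algebra_simps)
    then show ?thesis using tr_anticommutator[OF that uv] by blast
  qed
  have "tr (u @ vec_mat (dvec x y) # v) = (\<Sum>l\<in>I. \<Sum>i\<in>I. \<Sum>j\<in>I. x i * (y j * (of_real (d i j l) * tr (u @ X l # v))))"
    unfolding tr_vec_mat[OF uv] dvec_def sum_distrib_left sum_distrib_right by (simp only: mult.assoc)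
  also have "\<dots> = (\<Sum>i\<in>I. \<Sum>l\<in>I. \<Sum>j\<in>I. x i * (y j * (of_real (d i j l) * tr (u @ X l # v))))"
    by (rule sum.swap)
  also have "\<dots> = (\<Sum>i\<in>I. \<Sum>j\<in>I. \<Sum>l\<in>I. x i * (y j * (of_real (d i j l) * tr (u @ X l # v))))"
    by (rule sum.cong[OF refl], rule sum.swap)
  also have "\<dots> = (\<Sum>i\<in>I. x i * (\<Sum>j\<in>I. y j * (\<Sum>l\<in>I. of_real (d i j l) * tr (u @ X l # v))))"
    by (simp only: sum_distrib_left)
  also have "\<dots> = (\<Sum>i\<in>I. x i * (\<Sum>j\<in>I. y j *
      (\<i> * (tr (u @ X i # X j # v) + tr (u @ X j # X i # v) + kdelta i j * (tr (u @ v) / of_nat n)))))"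
    by (intro sum.cong refl arg_cong2[of _ _ _ _ "(*)"] dl)
  also have "\<dots> = \<i> * ((\<Sum>i\<in>I. x i * (\<Sum>j\<in>I. y j * tr (u @ X i # X j # v)))
      + (\<Sum>i\<in>I. x i * (\<Sum>j\<in>I. y j * tr (u @ X j # X i # v)))
      + (\<Sum>i\<in>I. x i * (\<Sum>j\<in>I. kdelta j i * (y j * (tr (u @ v) / of_nat n)))))"
  proof -
    have kd: "kdelta i j = kdelta j i" for i j by (auto simp: kdelta_def)
    have aux: "x i * (\<Sum>j\<in>I. y j * (\<i> * (p i j + q i j + kdelta i j * t))) =
        \<i> * (x i * (\<Sum>j\<in>I. y j * p i j) + x i * (\<Sum>j\<in>I. y j * q i j) + x i * (\<Sum>j\<in>I. kdelta j i * (y j * t)))"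
      for i p q t
      by (simp only: kd[of i] distrib_left sum.distrib) (simp add: sum_distrib_left mult_ac)
    have "(\<Sum>i\<in>I. x i * (\<Sum>j\<in>I. y j *
        (\<i> * (tr (u @ X i # X j # v) + tr (u @ X j # X i # v) + kdelta i j * (tr (u @ v) / of_nat n))))) =
        (\<Sum>i\<in>I. \<i> * (x i * (\<Sum>j\<in>I. y j * tr (u @ X i # X j # v)) +
          x i * (\<Sum>j\<in>I. y j * tr (u @ X j # X i # v)) +
          x i * (\<Sum>j\<in>I. kdelta j i * (y j * (tr (u @ v) / of_nat n)))))"
      by (rule sum.cong[OF refl], rule aux[where p = "\<lambda>i j. tr (u @ X i # X j # v)" and q = "\<lambda>i j. tr (u @ X j # X i # v)"])
    then show ?thesis by (simp only: sum.distrib sum_distrib_left[symmetric])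
  qed
  also have "(\<Sum>i\<in>I. x i * (\<Sum>j\<in>I. kdelta j i * (y j * (tr (u @ v) / of_nat n)))) = dot x y * tr (u @ v) / of_nat n"
  proof -
    have "(\<Sum>i\<in>I. x i * (\<Sum>j\<in>I. kdelta j i * (y j * (tr (u @ v) / of_nat n)))) =
        (\<Sum>i\<in>I. x i * (y i * (tr (u @ v) / of_nat n)))"
      by (rule sum.cong[OF refl]) (simp only: sum_kdelta)
    then show ?thesis by (simp add: dot_def sum_distrib_right sum_divide_distrib mult.assoc)
  qed
  also have "(\<Sum>i\<in>I. x i * (\<Sum>j\<in>I. y j * tr (u @ X i # X j # v))) = tr (u @ vec_mat x # vec_mat y # v)"
  proof -
    have "(\<Sum>j\<in>I. y j * tr (u @ X i # X j # v)) = tr (u @ X i # vec_mat y # v)" if "i \<in> I" for i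
      using tr_vec_mat[of "u @ [X i]" v y] uv that by simp
    then show ?thesis using tr_vec_mat[of u "vec_mat y # v" x] uv by simp
  qed
  also have "(\<Sum>i\<in>I. x i * (\<Sum>j\<in>I. y j * tr (u @ X j # X i # v))) = tr (u @ vec_mat y # vec_mat x # v)"
  proof -
    have "(\<Sum>j\<in>I. y j * tr (u @ X j # X i # v)) = tr (u @ vec_mat y # X i # v)" if "i \<in> I" for i
      using tr_vec_mat[of u "X i # v" y] uv that by simp
    then show ?thesis using tr_vec_mat[of "u @ [vec_mat y]" v x] uv by simp
  qed
  finally show ?thesis .
qed

text \<open>The general rule speaks of u @ ... and does not match explicit lists; these instances
  rewrite a product standing behind at most three letters.\<close>

lemma tr_dvec_at:
  assumes "A \<in> C" "B \<in> C" "D \<in> C" "set v \<subseteq> C"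
  shows "tr (vec_mat (dvec x y) # v) = \<i> * (tr (vec_mat x # vec_mat y # v)
      + tr (vec_mat y # vec_mat x # v) + dot x y * tr v / of_nat n)"
    and "tr (A # vec_mat (dvec x y) # v) = \<i> * (tr (A # vec_mat x # vec_mat y # v)
      + tr (A # vec_mat y # vec_mat x # v) + dot x y * tr (A # v) / of_nat n)"
    and "tr (A # B # vec_mat (dvec x y) # v) = \<i> * (tr (A # B # vec_mat x # vec_mat y # v)
      + tr (A # B # vec_mat y # vec_mat x # v) + dot x y * tr (A # B # v) / of_nat n)"
    and "tr (A # B # D # vec_mat (dvec x y) # v) = \<i> * (tr (A # B # D # vec_mat x # vec_mat y # v)
      + tr (A # B # D # vec_mat y # vec_mat x # v) + dot x y * tr (A # B # D # v) / of_nat n)"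
  using tr_dvec[of "[]" v x y] tr_dvec[of "[A]" v x y] tr_dvec[of "[A, B]" v x y] tr_dvec[of "[A, B, D]" v x y] assms
  by simp_all

lemma dot_eq_tr: "dot x y = - 2 * tr [vec_mat x, vec_mat y]"
proof -
  have "tr [vec_mat x, vec_mat y] = (\<Sum>i\<in>I. x i * (\<Sum>j\<in>I. y j * tr [X i, X j]))"
    using tr_vec_mat[of "[]" "[vec_mat y]" x] tr_vec_mat[of "[X i]" "[]" y for i] by simp
  also have "\<dots> = (\<Sum>i\<in>I. x i * (\<Sum>j\<in>I. kdelta j i * (- (y j) / 2)))"
  proof -
    have "y j * tr [X i, X j] = kdelta j i * (- (y j) / 2)" if "i \<in> I" "j \<in> I" for i j
      using that by (simp add: tr_XX kdelta_def)
    then show ?thesis by simp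
  qed
  also have "\<dots> = (\<Sum>i\<in>I. x i * (- (y i) / 2))"
    by (rule sum.cong[OF refl]) (simp only: sum_kdelta)
  also have "\<dots> = - dot x y / 2"
    by (simp add: dot_def sum_negf sum_divide_distrib)
  finally show ?thesis by simp
qed

lemma dvec_swap:
  "m \<in> I \<Longrightarrow> (\<Sum>k\<in>I. a k * (\<Sum>l\<in>I. b l * complex_of_real (d m k l))) = dvec a b m"
  unfolding dvec_def by (intro sum.cong refl arg_cong2[of _ _ _ _ "(*)"]) (simp add: d_cyclic)

lemma sum_dvec:
  "(\<Sum>i\<in>I. a i * (\<Sum>j\<in>I. b j * (\<Sum>m\<in>I. complex_of_real (d i j m) * V m))) = dot (dvec a b) V"
proof -
  have "dot (dvec a b) V = (\<Sum>m\<in>I. \<Sum>i\<in>I. \<Sum>j\<in>I. a i * (b j * (complex_of_real (d i j m) * V m)))"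
    by (simp add: dot_def dvec_def sum_distrib_left sum_distrib_right mult.assoc)
  also have "\<dots> = (\<Sum>i\<in>I. \<Sum>m\<in>I. \<Sum>j\<in>I. a i * (b j * (complex_of_real (d i j m) * V m)))"
    by (rule sum.swap)
  also have "\<dots> = (\<Sum>i\<in>I. \<Sum>j\<in>I. \<Sum>m\<in>I. a i * (b j * (complex_of_real (d i j m) * V m)))"
    by (rule sum.cong[OF refl], rule sum.swap)
  finally show ?thesis by (simp add: sum_distrib_left)
qed

lemma sum_pull:
  "(\<Sum>k\<in>I. a k * (\<Sum>l\<in>I. b l * (\<Sum>m\<in>I. g m * h m k l))) = (\<Sum>m\<in>I. g m * (\<Sum>k\<in>I. a k * (\<Sum>l\<in>I. b l * (h m k l :: complex))))"
proof -
  have "(\<Sum>k\<in>I. a k * (\<Sum>l\<in>I. b l * (\<Sum>m\<in>I. g m * h m k l))) = (\<Sum>k\<in>I. \<Sum>l\<in>I. \<Sum>m\<in>I. g m * (a k * (b l * h m k l)))"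
    by (simp add: sum_distrib_left mult_ac)
  also have "\<dots> = (\<Sum>k\<in>I. \<Sum>m\<in>I. \<Sum>l\<in>I. g m * (a k * (b l * h m k l)))"
    by (rule sum.cong[OF refl], rule sum.swap)
  also have "\<dots> = (\<Sum>m\<in>I. \<Sum>k\<in>I. \<Sum>l\<in>I. g m * (a k * (b l * h m k l)))"
    by (rule sum.swap)
  finally show ?thesis by (simp add: sum_distrib_left)
qed

lemma d_tensor_3: "d_tensor n d [i, j, k] = d i j k"
  by (simp add: d_tensor.simps)

lemma d_tensor_4: "d_tensor n d [i, j, k, l] = (\<Sum>m\<in>I. d i j m * d m k l)"
  by (simp add: d_tensor.simps[of n d "[i, j, k, l]"] d_tensor_3)

lemma d_tensor_5: "d_tensor n d [i, j, k, l, p] = (\<Sum>m\<in>I. (\<Sum>q\<in>I. d i j q * d q k m) * d m l p)"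
  by (simp add: d_tensor.simps[of n d "[i, j, k, l, p]"] d_tensor_4)

lemma mform_d_tensor_4:
  "mform n (\<lambda>is. complex_of_real (d_tensor n d is)) [a, b, c, e] = dot (dvec a b) (dvec c e)"
proof -
  have "(\<Sum>k\<in>I. c k * (\<Sum>l\<in>I. e l * complex_of_real (d_tensor n d [i, j, k, l]))) =
      (\<Sum>m\<in>I. complex_of_real (d i j m) * dvec c e m)" for i j
  proof -
    have "(\<Sum>k\<in>I. c k * (\<Sum>l\<in>I. e l * complex_of_real (d_tensor n d [i, j, k, l]))) =
        (\<Sum>k\<in>I. c k * (\<Sum>l\<in>I. e l * (\<Sum>m\<in>I. complex_of_real (d i j m) * complex_of_real (d m k l))))"
      by (simp add: d_tensor_4)
    also have "\<dots> = (\<Sum>m\<in>I. complex_of_real (d i j m) * (\<Sum>k\<in>I. c k * (\<Sum>l\<in>I. e l * complex_of_real (d m k l))))"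
      by (rule sum_pull)
    also have "\<dots> = (\<Sum>m\<in>I. complex_of_real (d i j m) * dvec c e m)"
      by (intro sum.cong refl arg_cong2[of _ _ _ _ "(*)"] dvec_swap)
    finally show ?thesis .
  qed
  then show ?thesis by (simp only: mform.simps sum_dvec)
qed

text \<open>The chain d_ijq d_qkm d_mlp is read from the right: the last factor becomes a vector
  with index m, the middle one a vector with index q, which meets the vector built from
  \<open>a\<close> and \<open>b\<close>.\<close>

lemma mform_d_tensor_5:
  "mform n (\<lambda>is. complex_of_real (d_tensor n d is)) [a, b, c, e, g] = dot (dvec a b) (dvec c (dvec e g))"
proof -
  define H where "H i j k m = complex_of_real (\<Sum>q\<in>I. d i j q * d q k m)" for i j k m
  have 1: "(\<Sum>l\<in>I. e l * (\<Sum>p\<in>I. g p * complex_of_real (d_tensor n d [i, j, k, l, p]))) =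
      (\<Sum>m\<in>I. H i j k m * dvec e g m)" for i j k
  proof -
    have "(\<Sum>l\<in>I. e l * (\<Sum>p\<in>I. g p * complex_of_real (d_tensor n d [i, j, k, l, p]))) =
        (\<Sum>l\<in>I. e l * (\<Sum>p\<in>I. g p * (\<Sum>m\<in>I. H i j k m * complex_of_real (d m l p))))"
      by (simp add: d_tensor_5 H_def)
    also have "\<dots> = (\<Sum>m\<in>I. H i j k m * (\<Sum>l\<in>I. e l * (\<Sum>p\<in>I. g p * complex_of_real (d m l p))))"
      by (rule sum_pull)
    also have "\<dots> = (\<Sum>m\<in>I. H i j k m * dvec e g m)"
      by (intro sum.cong refl arg_cong2[of _ _ _ _ "(*)"] dvec_swap)
    finally show ?thesis .
  qed
  have 2: "(\<Sum>k\<in>I. c k * (\<Sum>m\<in>I. H i j k m * V m)) = (\<Sum>q\<in>I. complex_of_real (d i j q) * dvec c V q)" for i j V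
  proof -
    have "(\<Sum>k\<in>I. c k * (\<Sum>m\<in>I. H i j k m * V m)) =
        (\<Sum>k\<in>I. c k * (\<Sum>m\<in>I. V m * (\<Sum>q\<in>I. complex_of_real (d i j q) * complex_of_real (d q k m))))"
      by (simp add: H_def mult.commute)
    also have "\<dots> = (\<Sum>q\<in>I. complex_of_real (d i j q) * (\<Sum>k\<in>I. c k * (\<Sum>m\<in>I. V m * complex_of_real (d q k m))))"
      by (rule sum_pull)
    also have "\<dots> = (\<Sum>q\<in>I. complex_of_real (d i j q) * dvec c V q)"
      by (intro sum.cong refl arg_cong2[of _ _ _ _ "(*)"] dvec_swap)
    finally show ?thesis .
  qed
  show ?thesis by (simp only: mform.simps 1 2 sum_dvec)
qed

lemma sum_dot: "(\<Sum>i\<in>I. a i * (\<Sum>j\<in>I. b j * (kdelta i j * t))) = dot a b * t"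
proof -
  have "b j * (kdelta i j * t) = kdelta j i * (b j * t)" for i j by (auto simp: kdelta_def)
  then have "(\<Sum>i\<in>I. a i * (\<Sum>j\<in>I. b j * (kdelta i j * t))) = (\<Sum>i\<in>I. a i * (\<Sum>j\<in>I. kdelta j i * (b j * t)))"
    by (simp only:)
  then show ?thesis by (simp add: sum_kdelta dot_def sum_distrib_right mult.assoc)
qed

lemmas sum_dot_1 = sum_dot[where t = 1, unfolded mult_1_right]

lemma mform_delta_delta:
  "mform n (\<lambda>is. kdelta (is ! 0) (is ! 1) * kdelta (is ! 2) (is ! 3)) [a, b, c, e] = dot a b * dot c e"
proof -
  have "mform n (\<lambda>is. kdelta (is ! 0) (is ! 1) * kdelta (is ! 2) (is ! 3)) [a, b, c, e] =
      (\<Sum>i\<in>I. a i * (\<Sum>j\<in>I. b j * (kdelta i j * (\<Sum>k\<in>I. c k * (\<Sum>l\<in>I. e l * kdelta k l)))))"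
    by (simp add: sum_distrib_left mult_ac)
  then show ?thesis by (simp only: sum_dot sum_dot_1)
qed

lemma mform_d_delta:
  "mform n (\<lambda>is. complex_of_real (d (is ! 0) (is ! 1) (is ! 2)) * kdelta (is ! 3) (is ! 4)) [a, b, c, e, g] =
    dot (dvec a b) c * dot e g"
proof -
  have "mform n (\<lambda>is. complex_of_real (d (is ! 0) (is ! 1) (is ! 2)) * kdelta (is ! 3) (is ! 4)) [a, b, c, e, g] =
      (\<Sum>i\<in>I. a i * (\<Sum>j\<in>I. b j * (\<Sum>k\<in>I. complex_of_real (d i j k) *
        (c k * (\<Sum>l\<in>I. e l * (\<Sum>p\<in>I. g p * kdelta l p))))))"
    by (simp add: sum_distrib_left mult_ac eval_nat_numeral)
  also have "\<dots> = (\<Sum>i\<in>I. a i * (\<Sum>j\<in>I. b j * (\<Sum>k\<in>I. complex_of_real (d i j k) * (c k * dot e g))))"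
    by (simp only: sum_dot sum_dot_1)
  also have "\<dots> = dot (dvec a b) c * dot e g"
    unfolding sum_dvec by (simp add: dot_def sum_distrib_right mult.assoc)
  finally show ?thesis .
qed

text \<open>A normal form for cyclic words with one odd letter: B is rotated to the end, so that
  expansions can be compared.\<close>

lemma rotations:
  assumes "A \<in> C" "B \<in> C"
  shows "tr [B, A] = tr [A, B]"
    and "tr [A, B, A] = tr [A, A, B]" "tr [B, A, A] = tr [A, A, B]"
    and "tr [A, A, B, A] = tr [A, A, A, B]" "tr [A, B, A, A] = tr [A, A, A, B]" "tr [B, A, A, A] = tr [A, A, A, B]"
    and "tr [A, A, A, B, A] = tr [A, A, A, A, B]" "tr [A, A, B, A, A] = tr [A, A, A, A, B]"
      "tr [A, B, A, A, A] = tr [A, A, A, A, B]" "tr [B, A, A, A, A] = tr [A, A, A, A, B]"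
  using assms word_trace_rotate[of "[B]" n "[A]"]
    word_trace_rotate[of "[A, B]" n "[A]"] word_trace_rotate[of "[B]" n "[A, A]"]
    word_trace_rotate[of "[A, A, B]" n "[A]"] word_trace_rotate[of "[A, B]" n "[A, A]"] word_trace_rotate[of "[B]" n "[A, A, A]"]
    word_trace_rotate[of "[A, A, A, B]" n "[A]"] word_trace_rotate[of "[A, A, B]" n "[A, A]"]
    word_trace_rotate[of "[A, B]" n "[A, A, A]"] word_trace_rotate[of "[B]" n "[A, A, A, A]"]
  by simp_all

lemma pow_trace_numeral:
  "pow_trace x 0 = of_nat n" "pow_trace x 2 = tr [vec_mat x, vec_mat x]" "pow_trace x 3 = tr [vec_mat x, vec_mat x, vec_mat x]"
  by (simp_all add: pow_trace_def eval_nat_numeral)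

lemma pow_trace_with_numeral:
  "pow_trace_with x Zm (Suc 0) = tr [vec_mat x, Zm]" "pow_trace_with x Zm 1 = tr [vec_mat x, Zm]" "pow_trace_with x Zm 2 = tr [vec_mat x, vec_mat x, Zm]"
  "pow_trace_with x Zm 3 = tr [vec_mat x, vec_mat x, vec_mat x, Zm]"
  "pow_trace_with x Zm 4 = tr [vec_mat x, vec_mat x, vec_mat x, vec_mat x, Zm]"
  by (simp_all add: pow_trace_with_def eval_nat_numeral)

text \<open>Every value follows by expanding the products into anticommutators and rotating w to the
  end. For the chain of three d the middle slot is special: with w there the 1/n term is 2 p_2 r_2,
  while in the four outer slots it is p_2 r_2 + p_3 r_1.\<close>

lemma dvec_values:
  fixes x w :: "nat \<Rightarrow> complex"
  defines "p \<equiv> pow_trace x" and "r \<equiv> pow_trace_with x (vec_mat w)"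
  shows "dot x x = - 2 * p 2" "dot x w = - 2 * r 1" "dot w x = - 2 * r 1"
    and "dot (dvec x x) x = - 4 * \<i> * p 3"
    and "dot (dvec x x) w = - 4 * \<i> * r 2" "dot (dvec x w) x = - 4 * \<i> * r 2" "dot (dvec w x) x = - 4 * \<i> * r 2"
    and "dot (dvec w x) (dvec x x) = 8 * r 3 - 8 / of_nat n * p 2 * r 1"
    "dot (dvec x w) (dvec x x) = 8 * r 3 - 8 / of_nat n * p 2 * r 1"
    "dot (dvec x x) (dvec w x) = 8 * r 3 - 8 / of_nat n * p 2 * r 1"
    "dot (dvec x x) (dvec x w) = 8 * r 3 - 8 / of_nat n * p 2 * r 1"
    and "dot (dvec w x) (dvec x (dvec x x)) = 16 * \<i> * (r 4 - (p 2 * r 2 + p 3 * r 1) / of_nat n)"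
    "dot (dvec x w) (dvec x (dvec x x)) = 16 * \<i> * (r 4 - (p 2 * r 2 + p 3 * r 1) / of_nat n)"
    "dot (dvec x x) (dvec x (dvec w x)) = 16 * \<i> * (r 4 - (p 2 * r 2 + p 3 * r 1) / of_nat n)"
    "dot (dvec x x) (dvec x (dvec x w)) = 16 * \<i> * (r 4 - (p 2 * r 2 + p 3 * r 1) / of_nat n)"
    "dot (dvec x x) (dvec w (dvec x x)) = 16 * \<i> * (r 4 - 2 * p 2 * r 2 / of_nat n)"
  unfolding p_def r_def
  by (simp_all add: dot_eq_tr tr_dvec_at[OF vec_mat_carrier vec_mat_carrier vec_mat_carrier]
      tr_vec_mat_single pow_trace_numeral pow_trace_with_numeral rotations[of "vec_mat x" "vec_mat w"]
      n_pos field_simps)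

end


section \<open>Evaluation and vanishing\<close>

lemma poly_form_symmetrise_small:
  assumes "z \<in> su_idx n"
  defines "w \<equiv> \<lambda>i. kdelta i z"
  shows "poly_form n 2 (\<lambda>is. symmetrise F (is @ [z])) x =
      (mform n F [w, x, x] + mform n F [x, w, x] + mform n F [x, x, w]) / 3"
    and "poly_form n 3 (\<lambda>is. symmetrise F (is @ [z])) x =
      (mform n F [w, x, x, x] + mform n F [x, w, x, x] + mform n F [x, x, w, x] + mform n F [x, x, x, w]) / 4"
    and "poly_form n 4 (\<lambda>is. symmetrise F (is @ [z])) x =
      (mform n F [w, x, x, x, x] + mform n F [x, w, x, x, x] + mform n F [x, x, w, x, x]
       + mform n F [x, x, x, w, x] + mform n F [x, x, x, x, w]) / 5"
  unfolding w_def poly_form_symmetrise[OF assms(1)]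
  by (simp_all add: eval_nat_numeral del: mform.simps)

lemma sym_tensor_1: "sym_tensor n 1 S"
proof -
  have "is = js" if "is \<in> multi_idx n 1" "mset is = mset js" for "is" js
    using that mset_eq_length[OF that(2)]
    by (auto simp: multi_idx_def length_Suc_conv)
  then show ?thesis by (metis sym_tensor_def)
qed

lemma multi_idx_snocE:
  assumes "is \<in> multi_idx n (Suc k)"
  obtains js z where "is = js @ [z]" "js \<in> multi_idx n k" "z \<in> su_idx n"
proof -
  have "is \<noteq> []" using assms by (auto simp: multi_idx_def)
  then have "is = butlast is @ [last is]" by simp
  then show thesis using that[of "butlast is" "last is"] assms snoc_in_multi_idx[of "butlast is" "last is" n k] by simp
qed

lemma tensor_eqI:
  assumes "sym_tensor n k S" "sym_tensor n k S'" "\<And>x. poly_form n k S x = poly_form n k S' x" "is \<in> multi_idx n k"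
  shows "S is = S' is"
  using polarisation[OF sym_tensor_diff[OF assms(1,2)] _ assms(4)] assms(3) by (simp add: poly_form_diff)

context su_gens
begin

abbreviation unit_vec :: "nat \<Rightarrow> nat \<Rightarrow> complex" where
  "unit_vec z \<equiv> \<lambda>i. kdelta i z"

lemma mform_ktr: "mform n (\<lambda>is. tr (u @ map X is)) vs = tr (u @ map vec_mat vs)" if "set u \<subseteq> C" for u
  using that
proof (induction vs arbitrary: u)
  case (Cons v vs)
  have "mform n (\<lambda>is. tr (u @ X i # map X is)) vs = tr (u @ X i # map vec_mat vs)" if "i \<in> I" for i
    using Cons.IH[of "u @ [X i]"] Cons.prems that by simp
  moreover have "set (map vec_mat vs) \<subseteq> C" by auto
  ultimately show ?case using tr_vec_mat[OF Cons.prems, of "map vec_mat vs" v] by simp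
qed simp

text \<open>The factor 2^k k! / (2k)! of \<open>poly_form_t_tensor\<close> becomes 1, 1/3, 1/15 and
  1/105 for k = 1, ..., 4. At k = 1 it is multiplied by the seed constant -2.\<close>

lemma t_form:
  fixes x :: "nat \<Rightarrow> complex"
  assumes z: "z \<in> I"
  defines "p \<equiv> pow_trace x" and "r \<equiv> pow_trace_with x (X z)"
  shows "poly_form n 1 (\<lambda>is. t_tensor n T f 2 (is @ [z])) x = - 2 * of_nat n * r 1"
    and "poly_form n 2 (\<lambda>is. t_tensor n T f 3 (is @ [z])) x = (of_nat n)\<^sup>2 / 3 * r 2"
    and "poly_form n 3 (\<lambda>is. t_tensor n T f 4 (is @ [z])) x = 1 / 15 *
      (of_nat n * ((of_nat n)\<^sup>2 + 1) * r 3 - (2 * (of_nat n)\<^sup>2 - 3) * p 2 * r 1)"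
    and "poly_form n 4 (\<lambda>is. t_tensor n T f 5 (is @ [z])) x = of_nat n / 105 *
      (of_nat n * ((of_nat n)\<^sup>2 + 5) * r 4 - (3 * (of_nat n)\<^sup>2 - 6) * p 2 * r 2 - (2 * (of_nat n)\<^sup>2 - 4) * p 3 * r 1)"
proof -
  have [simp]: "Suc (Suc 0) = 2" "Suc 2 = 3" "Suc 3 = 4" "Suc 4 = 5" by simp_all
  have [simp]: "fact 3 = (6 :: complex)" "fact 4 = (24 :: complex)" "fact 6 = (720 :: complex)" "fact 8 = (40320 :: complex)"
    by (simp_all add: fact_numeral)
  note s = p_def r_def seed_const_def code_val_def pow_trace_numeral
  show "poly_form n 1 (\<lambda>is. t_tensor n T f 2 (is @ [z])) x = - 2 * of_nat n * r 1"
    using poly_form_t_tensor[of 1 z x] z unfolding wick_terms_1 by (simp add: s)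
  show "poly_form n 2 (\<lambda>is. t_tensor n T f 3 (is @ [z])) x = (of_nat n)\<^sup>2 / 3 * r 2"
    using poly_form_t_tensor[of 2 z x] z unfolding wick_terms_2 by (simp add: s power2_eq_square)
  show "poly_form n 3 (\<lambda>is. t_tensor n T f 4 (is @ [z])) x = 1 / 15 *
      (of_nat n * ((of_nat n)\<^sup>2 + 1) * r 3 - (2 * (of_nat n)\<^sup>2 - 3) * p 2 * r 1)"
    using poly_form_t_tensor[of 3 z x] z unfolding wick_terms_3 by (simp add: s power2_eq_square algebra_simps)
  show "poly_form n 4 (\<lambda>is. t_tensor n T f 5 (is @ [z])) x = of_nat n / 105 *
      (of_nat n * ((of_nat n)\<^sup>2 + 5) * r 4 - (3 * (of_nat n)\<^sup>2 - 6) * p 2 * r 2 - (2 * (of_nat n)\<^sup>2 - 4) * p 3 * r 1)"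
    using poly_form_t_tensor[of 4 z x] z unfolding wick_terms_4 by (simp add: s power2_eq_square algebra_simps)
qed

lemma k_form:
  assumes z: "z \<in> I"
  shows "poly_form n 2 (\<lambda>is. k_tensor n T (is @ [z])) x = pow_trace_with x (X z) 2"
proof -
  have m: "mform n ktr vs = tr (map vec_mat vs)" for vs
    using mform_ktr[of "[]" vs] by (simp add: ktr_def[abs_def])
  show ?thesis
    unfolding k_tensor_eq poly_form_symmetrise_small(1)[OF z] m
    using rotations[OF vec_mat_carrier X_carrier[OF z]]
    by (simp add: vec_mat_unit[OF z] pow_trace_with_numeral)
qed

section \<open>The quartic and quintic brackets and their comparison with t\<close>

definition quartic :: "nat list \<Rightarrow> complex" where
  "quartic is = of_nat n * ((of_nat n)\<^sup>2 + 1) * d_sym n d is - 2 * ((of_nat n)\<^sup>2 - 4) * delta_delta_sym is"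

definition quintic :: "nat list \<Rightarrow> complex" where
  "quintic is = of_nat n * ((of_nat n)\<^sup>2 + 5) * d_sym n d is - 2 * (3 * (of_nat n)\<^sup>2 - 20) * d_delta_sym d is"

lemma sym_tensor_quartic: "sym_tensor n k quartic"
  unfolding quartic_def[abs_def] d_sym_def delta_delta_sym_def
  by (intro sym_tensor_diff sym_tensor_mult sym_tensor_symmetrise)

lemma sym_tensor_quintic: "sym_tensor n k quintic"
  unfolding quintic_def[abs_def] d_sym_def d_delta_sym_def
  by (intro sym_tensor_diff sym_tensor_mult sym_tensor_symmetrise)

text \<open>The 1/n term of d^(4) contributes -(n^2 + 1) to the coefficient of p_2 r_1 and the
  product of deltas contributes -(n^2 - 4); together they give -(2 n^2 - 3), as in
  \<open>t_form\<close>.\<close>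

lemma quartic_form:
  fixes x :: "nat \<Rightarrow> complex"
  assumes z: "z \<in> I"
  defines "p \<equiv> pow_trace x" and "r \<equiv> pow_trace_with x (X z)"
  shows "poly_form n 3 (\<lambda>is. quartic (is @ [z])) x =
    8 * (of_nat n * ((of_nat n)\<^sup>2 + 1) * r 3 - (2 * (of_nat n)\<^sup>2 - 3) * p 2 * r 1)"
proof -
  have r: "r = pow_trace_with x (vec_mat (unit_vec z))" by (simp add: r_def vec_mat_unit[OF z])
  have d4: "poly_form n 3 (\<lambda>is. d_sym n d (is @ [z])) x = 8 * r 3 - 8 / of_nat n * p 2 * r 1"
    unfolding d_sym_def poly_form_symmetrise_small(2)[OF z] mform_d_tensor_4 dvec_values(1,4)[of x] dvec_values(2,3,5-16)[where x = x and w = "unit_vec z"] p_def r by simp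
  have dd: "poly_form n 3 (\<lambda>is. delta_delta_sym (is @ [z])) x = 4 * p 2 * r 1"
    unfolding delta_delta_sym_def poly_form_symmetrise_small(2)[OF z] mform_delta_delta dvec_values(1,4)[of x] dvec_values(2,3,5-16)[where x = x and w = "unit_vec z"] p_def r by simp
  show ?thesis
    unfolding quartic_def poly_form_diff poly_form_mult d4 dd
    using n_pos by (simp add: field_simps power2_eq_square)
qed

text \<open>Averaging d^(5) over the five slots gives the correction 6 p_2 r_2 + 4 p_3 r_1, and the
  d-delta tensor gives a multiple of 3 p_2 r_2 + 2 p_3 r_1. They are proportional, as is the
  lower-order part of t, so the single coefficient 3 n^2 - 20 matches both products of
  traces.\<close>

lemma quintic_form:
  fixes x :: "nat \<Rightarrow> complex"
  assumes z: "z \<in> I"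
  defines "p \<equiv> pow_trace x" and "r \<equiv> pow_trace_with x (X z)"
  shows "poly_form n 4 (\<lambda>is. quintic (is @ [z])) x = 16 * \<i> *
    (of_nat n * ((of_nat n)\<^sup>2 + 5) * r 4 - (3 * (of_nat n)\<^sup>2 - 6) * p 2 * r 2 - (2 * (of_nat n)\<^sup>2 - 4) * p 3 * r 1)"
proof -
  have r: "r = pow_trace_with x (vec_mat (unit_vec z))" by (simp add: r_def vec_mat_unit[OF z])
  have d5: "poly_form n 4 (\<lambda>is. d_sym n d (is @ [z])) x =
      16 * \<i> / 5 * (5 * r 4 - (6 * p 2 * r 2 + 4 * p 3 * r 1) / of_nat n)"
    unfolding d_sym_def poly_form_symmetrise_small(3)[OF z] mform_d_tensor_5 dvec_values(1,4)[of x] dvec_values(2,3,5-16)[where x = x and w = "unit_vec z"] p_def r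
    using n_pos by (simp add: field_simps)
  have dd: "poly_form n 4 (\<lambda>is. d_delta_sym d (is @ [z])) x = 8 * \<i> / 5 * (3 * p 2 * r 2 + 2 * p 3 * r 1)"
    unfolding d_delta_sym_def poly_form_symmetrise_small(3)[OF z] mform_d_delta dvec_values(1,4)[of x] dvec_values(2,3,5-16)[where x = x and w = "unit_vec z"] p_def r
    by (simp add: field_simps)
  show ?thesis
    unfolding quintic_def poly_form_diff poly_form_mult d5 dd
    using n_pos by (simp add: field_simps power2_eq_square)
qed

lemma t_tensor_2:
  assumes "i \<in> I" "j \<in> I"
  shows "t_tensor n T f 2 [i, j] = of_nat n * kdelta i j"
proof -
  have "t_tensor n T f 2 ([i] @ [j]) = of_nat n * kdelta ([i] ! 0) j"
  proof (rule tensor_eqI[OF sym_tensor_1 sym_tensor_1])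
    fix x
    have e: "poly_form n 1 (\<lambda>is. of_nat n * kdelta (is ! 0) j) x = of_nat n * dot x (unit_vec j)"
      by (simp add: poly_form_Suc dot_def sum_distrib_left mult.left_commute)
    show "poly_form n 1 (\<lambda>is. t_tensor n T f 2 (is @ [j])) x = poly_form n 1 (\<lambda>is. of_nat n * kdelta (is ! 0) j) x"
      unfolding e t_form(1)[OF assms(2)] dvec_values(2) vec_mat_unit[OF assms(2)] by simp
  qed (use assms in \<open>simp add: multi_idx_def\<close>)
  then show ?thesis by simp
qed

lemma t_tensor_3:
  assumes "is \<in> multi_idx n 3"
  shows "t_tensor n T f 3 is = (of_nat n)\<^sup>2 / 3 * k_tensor n T is"
proof -
  from assms obtain js z where js: "is = js @ [z]" "js \<in> multi_idx n 2" "z \<in> I"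
    using multi_idx_snocE[of "is" n 2] by (auto simp: numeral_3_eq_3 numeral_2_eq_2)
  have "t_tensor n T f 3 (js @ [z]) = (of_nat n)\<^sup>2 / 3 * k_tensor n T (js @ [z])"
  proof (rule tensor_eqI[OF _ _ _ js(2)])
    show "sym_tensor n 2 (\<lambda>is. t_tensor n T f 3 (is @ [z]))"
      using t_tensor_sym[of 2 z] js(3) by (simp add: numeral_3_eq_3 numeral_2_eq_2)
    show "sym_tensor n 2 (\<lambda>is. (of_nat n)\<^sup>2 / 3 * k_tensor n T (is @ [z]))"
      unfolding k_tensor_eq by (intro sym_tensor_mult sym_tensor_snoc[OF sym_tensor_symmetrise js(3)])
  qed (simp only: poly_form_mult t_form(2)[OF js(3)] k_form[OF js(3)])
  then show ?thesis by (simp only: js(1))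
qed

text \<open>Up to rotation three generators have only two orderings, and the sum of the two traces
  determines d by \<open>d_eq_tr\<close>.\<close>

lemma k_tensor_3:
  assumes "i \<in> I" "j \<in> I" "k \<in> I"
  shows "k_tensor n T [i, j, k] = \<i> / 4 * of_real (d i j k)"
proof -
  have "{..<2} = {0, 1 :: nat}" by auto
  then have q: "{q. q permutes {..<2}} = {id, transpose 0 (1 :: nat)}"
    by (simp only: permutes_doubleton_iff) auto
  have ne: "id \<noteq> transpose 0 (1 :: nat)" by (metis id_apply transpose_apply_first zero_neq_one)
  have p: "permute_list (transpose 0 1) [i, j] = [j, i]" by (simp add: permute_list_def)
  have "k_tensor n T ([i, j] @ [k]) = (ktr [i, j, k] + ktr [j, i, k]) / 2"
    using k_tensor_snoc[of "[i, j]" 2 k] assms ne p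
    unfolding q by (simp add: multi_idx_def del: One_nat_def)
  moreover have "s / 2 = \<i> / 4 * (- 2 * \<i> * s)" for s by simp
  ultimately show ?thesis by (simp only: d_eq_tr[OF assms] ktr_def list.map append.simps)
qed

text \<open>The constant is 1/15 from \<open>t_form\<close> divided by the 8 of
  \<open>quartic_form\<close>.\<close>

lemma t_tensor_4:
  assumes "is \<in> multi_idx n 4"
  shows "t_tensor n T f 4 is = 1 / 120 * quartic is"
proof -
  from assms obtain js z where js: "is = js @ [z]" "js \<in> multi_idx n 3" "z \<in> I"
    using multi_idx_snocE[of "is" n 3] by auto
  have "t_tensor n T f 4 (js @ [z]) = 1 / 120 * quartic (js @ [z])"
  proof (rule tensor_eqI[OF _ _ _ js(2)])
    show "sym_tensor n 3 (\<lambda>is. t_tensor n T f 4 (is @ [z]))"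
      using t_tensor_sym[of 3 z] js(3) by simp
    show "sym_tensor n 3 (\<lambda>is. 1 / 120 * quartic (is @ [z]))"
      by (intro sym_tensor_mult sym_tensor_snoc[OF sym_tensor_quartic js(3)])
  qed (simp only: poly_form_mult t_form(3)[OF js(3)] quartic_form[OF js(3)], simp)
  then show ?thesis by (simp only: js(1))
qed

text \<open>The constant is n/105 from \<open>t_form\<close> divided by the 16 i of
  \<open>quintic_form\<close>.\<close>

lemma t_tensor_5:
  assumes "is \<in> multi_idx n 5"
  shows "t_tensor n T f 5 is = - \<i> * of_nat n / 1680 * quintic is"
proof -
  from assms obtain js z where js: "is = js @ [z]" "js \<in> multi_idx n 4" "z \<in> I"
    using multi_idx_snocE[of "is" n 4] by auto
  have "t_tensor n T f 5 (js @ [z]) = - \<i> * of_nat n / 1680 * quintic (js @ [z])"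
  proof (rule tensor_eqI[OF _ _ _ js(2)])
    show "sym_tensor n 4 (\<lambda>is. t_tensor n T f 5 (is @ [z]))"
      using t_tensor_sym[of 4 z] js(3) by simp
    show "sym_tensor n 4 (\<lambda>is. - \<i> * of_nat n / 1680 * quintic (is @ [z]))"
      by (intro sym_tensor_mult sym_tensor_snoc[OF sym_tensor_quintic js(3)])
    fix x
    have "m / 105 * B = - \<i> * m / 1680 * (16 * \<i> * B)" for m B :: complex by simp
    then show "poly_form n 4 (\<lambda>is. t_tensor n T f 5 (is @ [z])) x =
        poly_form n 4 (\<lambda>is. - \<i> * of_nat n / 1680 * quintic (is @ [z])) x"
      by (simp only: poly_form_mult t_form(4)[OF js(3)] quintic_form[OF js(3)])
  qed
  then show ?thesis by (simp only: js(1))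
qed

section \<open>Vanishing when the order exceeds n\<close>

lemma sum_pow_trace_with: "(\<Sum>z\<in>I. x z * pow_trace_with x (X z) k) = pow_trace x (Suc k)"
proof -
  have "set (replicate k (vec_mat x)) \<subseteq> C" by auto
  from tr_vec_mat[OF this, of "[]" x] show ?thesis
    by (simp add: pow_trace_def pow_trace_with_def replicate_append_same)
qed

lemma pow_trace_eq_power_sums:
  assumes "n \<le> N"
  obtains ev where "\<And>k. k > 0 \<Longrightarrow> pow_trace x k = (\<Sum>a<N. ev a ^ k)" "(\<Sum>a<N. ev a) = 0"
proof -
  obtain ev0 where ev0: "\<And>k. tr (replicate k (vec_mat x)) = (\<Sum>a<n. ev0 a ^ k)"
    using traces_eq_power_sums[OF vec_mat_carrier] by blast
  \<comment> \<open>Padding with zero eigenvalues lets one identity cover all n up to N. It changes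
    the zeroth power sum, hence the restriction to k > 0.\<close>
  define ev where "ev a = (if a < n then ev0 a else 0)" for a
  have p: "pow_trace x k = (\<Sum>a<N. ev a ^ k)" if "k > 0" for k
  proof -
    have "(\<Sum>a<N. ev a ^ k) = (\<Sum>a<n. ev a ^ k)"
      by (rule sum.mono_neutral_right) (use assms that in \<open>auto simp: ev_def\<close>)
    then show ?thesis by (simp add: pow_trace_def ev0 ev_def)
  qed
  have "(\<Sum>a<N. ev a) = 0" using p[of 1] tr_vec_mat_single[of x] by (simp add: pow_trace_def)
  with p show thesis by (rule that)
qed

lemma pow_trace_small:
  shows "n < 3 \<Longrightarrow> pow_trace x 3 = 0"
    and "n < 4 \<Longrightarrow> 2 * pow_trace x 4 = (pow_trace x 2)\<^sup>2"
    and "n < 5 \<Longrightarrow> 6 * pow_trace x 5 = 5 * pow_trace x 2 * pow_trace x 3"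
proof -
  assume "n < 3"
  then have "n \<le> 2" by simp
  then obtain ev :: "nat \<Rightarrow> complex" where ev: "\<And>k. k > 0 \<Longrightarrow> pow_trace x k = (\<Sum>a<2. ev a ^ k)" "(\<Sum>a<2. ev a) = 0"
    using pow_trace_eq_power_sums[of 2 x] by blast
  have "ev 0 + ev 1 = 0" using ev(2) by (simp add: eval_nat_numeral)
  from power_sum_2[OF this] show "pow_trace x 3 = 0" by (simp add: ev(1) numeral_2_eq_2)
next
  assume "n < 4"
  then have "n \<le> 3" by simp
  then obtain ev :: "nat \<Rightarrow> complex" where ev: "\<And>k. k > 0 \<Longrightarrow> pow_trace x k = (\<Sum>a<3. ev a ^ k)" "(\<Sum>a<3. ev a) = 0"
    using pow_trace_eq_power_sums[of 3 x] by blast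
  have S: "(\<Sum>a<3. g a) = g 0 + g 1 + g 2" for g :: "nat \<Rightarrow> complex" by (simp add: eval_nat_numeral)
  show "2 * pow_trace x 4 = (pow_trace x 2)\<^sup>2"
    using power_sum_3[of "ev 0" "ev 1" "ev 2"] ev(2) by (simp add: ev(1) S)
next
  assume "n < 5"
  then have "n \<le> 4" by simp
  then obtain ev :: "nat \<Rightarrow> complex" where ev: "\<And>k. k > 0 \<Longrightarrow> pow_trace x k = (\<Sum>a<4. ev a ^ k)" "(\<Sum>a<4. ev a) = 0"
    using pow_trace_eq_power_sums[of 4 x] by blast
  have S: "(\<Sum>a<4. g a) = g 0 + g 1 + g 2 + g 3" for g :: "nat \<Rightarrow> complex" by (simp add: eval_nat_numeral)
  show "6 * pow_trace x 5 = 5 * pow_trace x 2 * pow_trace x 3"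
    using power_sum_4[of "ev 0" "ev 1" "ev 2" "ev 3"] ev(2) by (simp add: ev(1) S)
qed

lemma k_tensor_vanishes:
  assumes "n < 3" "is \<in> multi_idx n 3"
  shows "k_tensor n T is = 0"
proof (rule polarisation[OF _ _ assms(2)])
  show "sym_tensor n 3 (k_tensor n T)" unfolding k_tensor_eq by (rule sym_tensor_symmetrise)
  fix x
  have "poly_form n (Suc 2) (k_tensor n T) x = pow_trace x (Suc 2)"
    unfolding poly_form_snoc sum_pow_trace_with[symmetric]
    by (intro sum.cong refl arg_cong2[of _ _ _ _ "(*)"] k_form)
  then show "poly_form n 3 (k_tensor n T) x = 0" using pow_trace_small(1)[OF assms(1)] by simp
qed

lemma quartic_vanishes:
  assumes "n < 4" "is \<in> multi_idx n 4"
  shows "quartic is = 0"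
proof (rule polarisation[OF sym_tensor_quartic _ assms(2)])
  fix x
  let ?p = "pow_trace x"
  let ?a = "of_nat n * ((of_nat n)\<^sup>2 + 1) :: complex" and ?b = "2 * (of_nat n)\<^sup>2 - 3 :: complex"
  have "poly_form n (Suc 3) quartic x = (\<Sum>z\<in>I. x z * (8 * (?a * pow_trace_with x (X z) 3 - ?b * ?p 2 * pow_trace_with x (X z) 1)))"
    unfolding poly_form_snoc by (intro sum.cong refl arg_cong2[of _ _ _ _ "(*)"] quartic_form)
  also have "\<dots> = (\<Sum>z\<in>I. 8 * ?a * (x z * pow_trace_with x (X z) 3) - 8 * ?b * ?p 2 * (x z * pow_trace_with x (X z) 1))"
    by (intro sum.cong refl) (simp add: algebra_simps)
  also have "\<dots> = 8 * ?a * ?p 4 - 8 * ?b * ?p 2 * ?p 2"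
    unfolding sum_subtractf sum_distrib_left[symmetric] sum_pow_trace_with by (simp add: numeral_2_eq_2[symmetric])
  also have "\<dots> = 4 * ?a * (2 * ?p 4) - 8 * ?b * (?p 2)\<^sup>2"
    by (simp add: power2_eq_square)
  also have "\<dots> = 4 * (?a - 2 * ?b) * (?p 2)\<^sup>2"
    unfolding pow_trace_small(2)[OF assms(1), of x] by (simp add: algebra_simps)
  \<comment> \<open>As a polynomial this is n^3 - 4 n^2 + n + 6 = (n + 1)(n - 2)(n - 3), with roots
    at both admissible n.\<close>
  also have "?a - 2 * ?b = 0"
  proof -
    have "n = 2 \<or> n = 3" using n_ge_2 assms(1) by linarith
    then show ?thesis by auto
  qed
  finally show "poly_form n 4 quartic x = 0" by simp
qed

lemma quintic_vanishes:
  assumes "n < 5" "is \<in> multi_idx n 5"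
  shows "quintic is = 0"
proof (rule polarisation[OF sym_tensor_quintic _ assms(2)])
  fix x
  let ?p = "pow_trace x"
  let ?a = "of_nat n * ((of_nat n)\<^sup>2 + 5) :: complex" and ?b = "3 * (of_nat n)\<^sup>2 - 6 :: complex"
    and ?c = "2 * (of_nat n)\<^sup>2 - 4 :: complex"
  let ?r = "\<lambda>z. pow_trace_with x (X z)"
  have "poly_form n (Suc 4) quintic x = (\<Sum>z\<in>I. x z * (16 * \<i> * (?a * ?r z 4 - ?b * ?p 2 * ?r z 2 - ?c * ?p 3 * ?r z 1)))"
    unfolding poly_form_snoc by (intro sum.cong refl arg_cong2[of _ _ _ _ "(*)"] quintic_form)
  also have "\<dots> = (\<Sum>z\<in>I. 16 * \<i> * ?a * (x z * ?r z 4) - 16 * \<i> * ?b * ?p 2 * (x z * ?r z 2) - 16 * \<i> * ?c * ?p 3 * (x z * ?r z 1))"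
    by (intro sum.cong refl) (simp add: algebra_simps)
  also have "\<dots> = 16 * \<i> * ?a * ?p 5 - 16 * \<i> * ?b * ?p 2 * ?p 3 - 16 * \<i> * ?c * ?p 3 * ?p 2"
    unfolding sum_subtractf sum_distrib_left[symmetric] sum_pow_trace_with
    by (simp add: numeral_2_eq_2[symmetric])
  also have "\<dots> = 8 / 3 * \<i> * (?a * (6 * ?p 5) - 6 * (?b + ?c) * ?p 2 * ?p 3)"
    by (simp add: algebra_simps)
  also have "\<dots> = 8 / 3 * \<i> * (5 * ?a - 6 * (?b + ?c)) * ?p 2 * ?p 3"
    unfolding pow_trace_small(3)[OF assms(1), of x] by (simp add: algebra_simps)
  also have "\<dots> = 0"
  \<comment> \<open>The coefficient is 5 (n + 1)(n - 3)(n - 4), which vanishes at n = 3 and n = 4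
    but not at n = 2; there p_3 = 0 takes over.\<close>
  proof (cases "n = 2")
    case True
    then show ?thesis using pow_trace_small(1)[of x] by simp
  next
    case False
    then have "n = 3 \<or> n = 4" using n_ge_2 assms(1) by linarith
    then have "5 * ?a - 6 * (?b + ?c) = 0" by auto
    then show ?thesis by simp
  qed
  finally show "poly_form n 5 quintic x = 0" by simp
qed

end

theorem mainTheorem12:
  shows "\<exists>lam :: nat \<Rightarrow> complex. \<forall>(n::nat) T f d. n \<ge> 2 \<and> su_generators n T f d \<longrightarrow>
    (\<forall>i1\<in>su_idx n. \<forall>i2\<in>su_idx n.
       t_tensor n T f 2 [i1, i2] = of_nat n * kdelta i1 i2) \<and>
    (\<forall>i1\<in>su_idx n. \<forall>i2\<in>su_idx n. \<forall>i3\<in>su_idx n.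
       t_tensor n T f 3 [i1, i2, i3] = (of_nat n)\<^sup>2 / 3 * k_tensor n T [i1, i2, i3] \<and>
       (of_nat n)\<^sup>2 / 3 * k_tensor n T [i1, i2, i3] =
         \<i> * (of_nat n)\<^sup>2 / 12 * complex_of_real (d i1 i2 i3)) \<and>
    (\<forall>is\<in>multi_idx n 4.
       t_tensor n T f 4 is = 1 / 120 *
         (of_nat n * ((of_nat n)\<^sup>2 + 1) * d_sym n d is
           - 2 * ((of_nat n)\<^sup>2 - 4) * delta_delta_sym is)) \<and>
    (\<forall>is\<in>multi_idx n 5.
       t_tensor n T f 5 is = lam n *
         (of_nat n * ((of_nat n)\<^sup>2 + 5) * d_sym n d is
           - 2 * (3 * (of_nat n)\<^sup>2 - 20) * d_delta_sym d is)) \<and>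
    (n < 3 \<longrightarrow> (\<forall>is\<in>multi_idx n 3. t_tensor n T f 3 is = 0)) \<and>
    (n < 4 \<longrightarrow> (\<forall>is\<in>multi_idx n 4. t_tensor n T f 4 is = 0 \<and>
         of_nat n * ((of_nat n)\<^sup>2 + 1) * d_sym n d is
           - 2 * ((of_nat n)\<^sup>2 - 4) * delta_delta_sym is = 0)) \<and>
    (n < 5 \<longrightarrow> (\<forall>is\<in>multi_idx n 5. t_tensor n T f 5 is = 0 \<and>
         of_nat n * ((of_nat n)\<^sup>2 + 5) * d_sym n d is
           - 2 * (3 * (of_nat n)\<^sup>2 - 20) * d_delta_sym d is = 0))"
proof -
  have "su_gens n T f d" if "n \<ge> 2 \<and> su_generators n T f d" for n T f d
    using that by (simp add: su_gens_def)
  note L = this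
  show ?thesis
  \<comment> \<open>The scalar from \<open>t_tensor_5\<close>; it depends on n alone and not on the
    choice of generators.\<close>
  proof (rule exI[of _ "\<lambda>n. - \<i> * of_nat n / 1680"], intro allI impI conjI ballI, goal_cases)
    case (1 n T f d i1 i2)
    then show ?case using su_gens.t_tensor_2[OF L] by blast
  next
    case (2 n T f d i1 i2 i3)
    then show ?case using su_gens.t_tensor_3[OF L, of n T f d "[i1, i2, i3]"] by (simp add: multi_idx_def)
  next
    case (3 n T f d i1 i2 i3)
    then have k: "k_tensor n T [i1, i2, i3] = \<i> / 4 * of_real (d i1 i2 i3)"
      using su_gens.k_tensor_3[OF L] by blast
    show ?case unfolding k by simp
  next
    case (4 n T f d "is")
    then show ?case using su_gens.t_tensor_4[OF L, of n T f d "is"] su_gens.quartic_def[OF L, of n T f d "is"] by simp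
  next
    case (5 n T f d "is")
    then show ?case using su_gens.t_tensor_5[OF L, of n T f d "is"] su_gens.quintic_def[OF L, of n T f d "is"] by simp
  next
    case (6 n T f d "is")
    then show ?case using su_gens.t_tensor_3[OF L, of n T f d "is"] su_gens.k_tensor_vanishes[OF L, of n T f d "is"] by simp
  next
    case (7 n T f d "is")
    then show ?case using su_gens.t_tensor_4[OF L, of n T f d "is"] su_gens.quartic_vanishes[OF L, of n T f d "is"] by simp
  next
    case (8 n T f d "is")
    then show ?case using su_gens.quartic_vanishes[OF L, of n T f d "is"] su_gens.quartic_def[OF L, of n T f d "is"] by simp
  next
    case (9 n T f d "is")
    then show ?case using su_gens.t_tensor_5[OF L, of n T f d "is"] su_gens.quintic_vanishes[OF L, of n T f d "is"] by simp
  next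
    case (10 n T f d "is")
    then show ?case using su_gens.quintic_vanishes[OF L, of n T f d "is"] su_gens.quintic_def[OF L, of n T f d "is"] by simp
  qed
qed

end
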